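(* Let $r\geq 2$ be an integer, let $n$ be a positive integer and $c$ a real number with $2/\ln n\leq c\leq r^{-(2r+9)(r+1)}$, and let $G$ be a graph of order $n$. If $\mu(G)>\mu(T_r(n))$, then $G$ contains a (not necessarily induced) subgraph isomorphic to $K_r^{+}(\lfloor c\ln n\rfloor,\ldots,\lfloor c\ln n\rfloor,\lceil n^{1-\sqrt{c}}\rceil)$, where the first $r-1$ arguments equal $\lfloor c\ln n\rfloor$.
   Context: All graphs are finite and simple; $\ln$ is the natural logarithm. For a graph $G$, $\mu(G)$ denotes the largest eigenvalue of the adjacency matrix of $G$. $T_r(n)$ is the $r$-partite Turán graph of order $n$, i.e. the complete $r$-partite graph on $n$ vertices whose part sizes differ by at most one. For integers $s_1\geq 2, s_2,\ldots,s_r\ge 1$, $K_r^{+}(s_1,\ldots,s_r)$ denotes the complete $r$-partite graph with parts of sizes $s_1,\ldots,s_r$ together with one additional edge joining two vertices of the first part (the part of size $s_1$). *)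

theory Defs
  imports
    Complex_Main
    "Graph_Theory.Pair_Digraph"
    "Graph_Theory.Digraph_Isomorphism"
    "Jordan_Normal_Form.Char_Poly"
begin

text \<open>
  Finite simple graphs are the symmetric, loop-free digraphs without multiple arcs of
  locale \<^locale>\<open>graph\<close>; an edge is a pair of opposite arcs.

  The rows and columns of the adjacency matrix follow an arbitrary enumeration of the vertices.
  By \<open>eigenvalue_adjacency_matrix_iff\<close> below the choice does not affect the eigenvalues.
\<close>

definition vertex_enum :: "('a, 'b) pre_digraph \<Rightarrow> 'a list" where
  "vertex_enum G = (SOME vs. distinct vs \<and> set vs = verts G)"

definition adjacency_matrix :: "('a, 'b) pre_digraph \<Rightarrow> real mat" where
  "adjacency_matrix G =
    (let vs = vertex_enum G; n = card (verts G)
     in mat n n (\<lambda>(i, j). if vs ! i \<rightarrow>\<^bsub>G\<^esub> vs ! j then 1 else 0))"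

definition largest_eigenvalue :: "('a, 'b) pre_digraph \<Rightarrow> real" where
  "largest_eigenvalue G = Max {k. eigenvalue (adjacency_matrix G) k}"

text \<open>The vertex \<open>(i, j)\<close> is the \<open>j\<close>-th vertex of the \<open>i\<close>-th part (both counted from 0).\<close>

definition complete_multipartite :: "nat list \<Rightarrow> (nat \<times> nat) pair_pre_digraph" where
  "complete_multipartite ss =
    (let V = {(i, j). i < length ss \<and> j < ss ! i}
     in \<lparr> pverts = V, parcs = {(u, v). u \<in> V \<and> v \<in> V \<and> fst u \<noteq> fst v} \<rparr>)"

text \<open>Meaningful if the first part has at least two vertices.\<close>

definition complete_multipartite_plus :: "nat list \<Rightarrow> (nat \<times> nat) pair_pre_digraph" where
  "complete_multipartite_plus ss =
    \<lparr> pverts = pverts (complete_multipartite ss),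
      parcs = parcs (complete_multipartite ss) \<union> {((0, 0), (0, 1)), ((0, 1), (0, 0))} \<rparr>"

text \<open>
  The part sizes \<open>n div r, (n + 1) div r, \<dots>, (n + r - 1) div r\<close> are the balanced ones; see
  \<open>turan_sizes_sum\<close> and \<open>turan_sizes_balanced\<close>. Parts are empty if \<open>n < r\<close>.
\<close>

definition turan_sizes :: "nat \<Rightarrow> nat \<Rightarrow> nat list" where
  "turan_sizes r n = map (\<lambda>i. (n + i) div r) [0..<r]"

definition turan_graph :: "nat \<Rightarrow> nat \<Rightarrow> (nat \<times> nat) pair_pre_digraph" where
  "turan_graph r n = complete_multipartite (turan_sizes r n)"

lemma vertex_enum:
  assumes "finite (verts G)"
  shows "distinct (vertex_enum G)" "set (vertex_enum G) = verts G"
    "length (vertex_enum G) = card (verts G)"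
proof -
  have "\<exists>vs. distinct vs \<and> set vs = verts G"
    using finite_distinct_list[OF assms] by blast
  then have *: "distinct (vertex_enum G) \<and> set (vertex_enum G) = verts G"
    unfolding vertex_enum_def by (rule someI_ex)
  then show "distinct (vertex_enum G)" "set (vertex_enum G) = verts G" by auto
  with * show "length (vertex_enum G) = card (verts G)"
    by (metis distinct_card)
qed

lemma eigenvalue_adjacency_matrix_iff:
  assumes fin: "finite (verts G)"
  shows "eigenvalue (adjacency_matrix G) k \<longleftrightarrow>
    (\<exists>x :: 'a \<Rightarrow> real. (\<exists>v\<in>verts G. x v \<noteq> 0) \<and>
      (\<forall>u\<in>verts (G :: ('a, 'b) pre_digraph). (\<Sum>v | v \<in> verts G \<and> u \<rightarrow>\<^bsub>G\<^esub> v. x v) = k * x u))"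
    (is "?L \<longleftrightarrow> ?R")
proof -
  define vs where "vs = vertex_enum G"
  define n where "n = card (verts G)"
  have d: "distinct vs" and s: "set vs = verts G" and l: "length vs = n"
    using vertex_enum[OF fin] by (auto simp: vs_def n_def)
  have bij: "bij_betw (\<lambda>i. vs ! i) {0..<n} (verts G)"
    using d s l bij_betw_nth[of vs "{0..<n}" "verts G"] by (auto simp: lessThan_atLeast0)
  define A where "A = adjacency_matrix G"
  have A: "A = mat n n (\<lambda>(i, j). if vs ! i \<rightarrow>\<^bsub>G\<^esub> vs ! j then 1 else 0)"
    by (simp add: A_def adjacency_matrix_def vs_def n_def Let_def)
  have row: "(A *\<^sub>v y) $ i = (\<Sum>v | v \<in> verts G \<and> vs ! i \<rightarrow>\<^bsub>G\<^esub> v. x v)"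
    if y: "y \<in> carrier_vec n" and i: "i < n" and xy: "\<And>j. j < n \<Longrightarrow> x (vs ! j) = y $ j" for x y i
  proof -
    have "(A *\<^sub>v y) $ i = (\<Sum>j\<in>{0..<n}. (if vs ! i \<rightarrow>\<^bsub>G\<^esub> vs ! j then 1 else 0) * y $ j)"
      using y i by (simp add: A scalar_prod_def)
    also have "\<dots> = (\<Sum>j\<in>{0..<n}. if vs ! i \<rightarrow>\<^bsub>G\<^esub> vs ! j then x (vs ! j) else 0)"
      using xy by (intro sum.cong) auto
    also have "\<dots> = (\<Sum>v\<in>verts G. if vs ! i \<rightarrow>\<^bsub>G\<^esub> v then x v else 0)"
      using sum.reindex_bij_betw[OF bij, of "\<lambda>v. if vs ! i \<rightarrow>\<^bsub>G\<^esub> v then x v else 0"] by simp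
    also have "\<dots> = (\<Sum>v | v \<in> verts G \<and> vs ! i \<rightarrow>\<^bsub>G\<^esub> v. x v)"
      using sum.inter_filter[OF fin, of x "\<lambda>v. vs ! i \<rightarrow>\<^bsub>G\<^esub> v"] by simp
    finally show ?thesis .
  qed
  have dim: "dim_row A = n" by (simp add: A)
  have ex: "\<exists>i<n. vs ! i = v" if "v \<in> verts G" for v
    using that s l by (metis in_set_conv_nth)
  have mem: "vs ! i \<in> verts G" if "i < n" for i
    using that s l nth_mem by blast
  show ?thesis
  proof
    assume ?L
    then obtain y where y: "y \<in> carrier_vec n" "y \<noteq> 0\<^sub>v n" "A *\<^sub>v y = k \<cdot>\<^sub>v y"
      unfolding eigenvalue_def eigenvector_def A_def[symmetric] dim by blast
    define x where "x v = y $ (the_inv_into {0..<n} (\<lambda>i. vs ! i) v)" for v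
    have xy: "x (vs ! j) = y $ j" if "j < n" for j
      using that bij by (simp add: x_def bij_betw_def the_inv_into_f_f)
    obtain j where "j < n" "y $ j \<noteq> 0"
      using y by (metis carrier_vecD eq_vecI index_zero_vec)
    then have "\<exists>v\<in>verts G. x v \<noteq> 0" using xy mem by metis
    moreover have "\<forall>u\<in>verts G. (\<Sum>v | v \<in> verts G \<and> u \<rightarrow>\<^bsub>G\<^esub> v. x v) = k * x u"
    proof
      fix u assume "u \<in> verts G"
      then obtain i where i: "i < n" "vs ! i = u" using ex by blast
      have "(A *\<^sub>v y) $ i = k * y $ i" using y i by simp
      then show "(\<Sum>v | v \<in> verts G \<and> u \<rightarrow>\<^bsub>G\<^esub> v. x v) = k * x u"
        using row[of y i x] y i xy by auto
    qed
    ultimately show ?R by blast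
  next
    assume ?R
    then obtain x where x: "\<exists>v\<in>verts G. x v \<noteq> 0"
      "\<And>u. u \<in> verts G \<Longrightarrow> (\<Sum>v | v \<in> verts G \<and> u \<rightarrow>\<^bsub>G\<^esub> v. x v) = k * x u" by blast
    define y where "y = vec n (\<lambda>i. x (vs ! i))"
    have y: "y \<in> carrier_vec n" by (simp add: y_def)
    obtain j where "j < n" "x (vs ! j) \<noteq> 0" using x(1) ex by metis
    then have "y \<noteq> 0\<^sub>v n" by (metis y_def index_vec index_zero_vec(1))
    moreover have "A *\<^sub>v y = k \<cdot>\<^sub>v y"
    proof (rule eq_vecI)
      fix i assume "i < dim_vec (k \<cdot>\<^sub>v y)"
      then have i: "i < n" by (simp add: y_def)
      have "(A *\<^sub>v y) $ i = (\<Sum>v | v \<in> verts G \<and> vs ! i \<rightarrow>\<^bsub>G\<^esub> v. x v)"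
        using y i by (intro row) (auto simp: y_def)
      then show "(A *\<^sub>v y) $ i = (k \<cdot>\<^sub>v y) $ i"
        using x(2)[OF mem[OF i]] i by (simp add: y_def)
    qed (simp add: A y_def)
    ultimately show ?L
      unfolding eigenvalue_def eigenvector_def A_def[symmetric] dim using y by blast
  qed
qed

lemma finite_parts: "finite {(i, j :: nat). i < length ss \<and> j < ss ! i}"
proof -
  have "{(i, j :: nat). i < length ss \<and> j < ss ! i} = (SIGMA i:{..<length ss}. {..<ss ! i})" by auto
  then show ?thesis by simp
qed

lemma card_complete_multipartite:
  "card (pverts (complete_multipartite ss)) = sum_list ss"
proof -
  have "{(i, j :: nat). i < length ss \<and> j < ss ! i} = (SIGMA i:{..<length ss}. {..<ss ! i})" by auto
  then show ?thesis
    by (simp add: complete_multipartite_def Let_def card_SigmaI sum_list_sum_nth lessThan_atLeast0)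
qed

lemma pair_graph_complete_multipartite: "pair_graph (complete_multipartite ss)"
proof unfold_locales
  show "finite (pverts (complete_multipartite ss))"
    using finite_parts by (simp add: complete_multipartite_def Let_def)
  then have "finite (pverts (complete_multipartite ss) \<times> pverts (complete_multipartite ss))"
    by simp
  then show "finite (parcs (complete_multipartite ss))"
    by (rule rev_finite_subset) (auto simp: complete_multipartite_def Let_def)
qed (auto simp: complete_multipartite_def Let_def symmetric_def sym_def)

lemma pair_graph_complete_multipartite_plus:
  assumes "ss \<noteq> []" "2 \<le> ss ! 0"
  shows "pair_graph (complete_multipartite_plus ss)"
proof -
  interpret pair_graph "complete_multipartite ss" by (rule pair_graph_complete_multipartite)
  have "(0, 0) \<in> pverts (complete_multipartite ss)" "(0, 1) \<in> pverts (complete_multipartite ss)"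
    using assms by (auto simp: complete_multipartite_def Let_def)
  then show ?thesis
    using pair_finite_verts pair_finite_arcs pair_no_loops arcs_ends_symmetric[OF pair_sym_arcs]
    by unfold_locales
      (auto simp: complete_multipartite_plus_def symmetric_def sym_def
        dest: arc_fst_in_verts arc_snd_in_verts)
qed

lemma turan_sizes_sum:
  assumes "0 < r"
  shows "sum_list (turan_sizes r n) = n"
proof -
  have "(\<Sum>i<r. (n + i) div r) = n"
  proof (induction n)
    case 0
    then show ?case by simp
  next
    case (Suc n)
    have "(\<Sum>i<r. (Suc n + i) div r) + n div r = (\<Sum>i<Suc r. (n + i) div r)"
      by (subst sum.lessThan_Suc_shift) simp
    also have "\<dots> = n + (n div r + 1)" using Suc assms by simp
    finally show ?case by simp
  qed
  then show ?thesis
    by (simp add: turan_sizes_def sum_list_sum_nth lessThan_atLeast0)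
qed

lemma turan_sizes_balanced:
  assumes "0 < r" "a \<in> set (turan_sizes r n)" "b \<in> set (turan_sizes r n)"
  shows "a \<le> b + 1"
proof -
  obtain i j where ij: "i < r" "a = (n + i) div r" "b = (n + j) div r"
    using assms by (auto simp: turan_sizes_def)
  have "a \<le> (n + r) div r" unfolding ij by (rule div_le_mono) (use ij in simp)
  also have "\<dots> = n div r + 1" using assms by simp
  also have "\<dots> \<le> b + 1" unfolding ij by (simp add: div_le_mono)
  finally show ?thesis .
qed

lemma card_turan_graph: "0 < r \<Longrightarrow> card (pverts (turan_graph r n)) = n"
  by (simp add: turan_graph_def card_complete_multipartite turan_sizes_sum)

end

theory Submission
  imports Defs "HOL-Analysis.Function_Topology" "HOL-Analysis.Convex"
begin

text \<open>
  Deleting a vertex of smallest entry in the principal eigenvector raises the ratio of the spectral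
  radius to the order as long as some vertex has degree at most \<open>(1 - 1/r - \<epsilon>)\<close> times the
  order. Either many deletions are possible, or after few of them all degrees are large.

  In the first case the ratio ends well above \<open>1 - 1/r\<close>. A Moon--Moser inequality for cliques weighted
  by the eigenvector then gives a positive proportion of all \<open>(r+1)\<close>-cliques, hence a large complete
  \<open>(r+1)\<close>-partite subgraph, and this contains the required graph.

  In the second case there is an \<open>(r+1)\<close>-clique: by the spectral Turan theorem if nothing was
  deleted, and because the ratio exceeds \<open>1 - 1/r\<close> otherwise. Large degrees allow its vertices to be
  replaced one after the other, until a single edge remains that lies in a positive proportion of all
  possible \<open>(r+1)\<close>-cliques. The other \<open>r - 1\<close> vertices of each have many common neighbours, so there
  are many \<open>r\<close>-cliques all of whose vertices but the first are joined to both ends of that edge.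
  In a blowup of these the edge is added to the first part.
\<close>

section \<open>The Rayleigh principle\<close>

definition nbrs :: "('a \<Rightarrow> 'a \<Rightarrow> bool) \<Rightarrow> 'a set \<Rightarrow> 'a \<Rightarrow> 'a set" where
  "nbrs E S u = {v \<in> S. E u v}"

definition quad_form :: "('a \<Rightarrow> 'a \<Rightarrow> bool) \<Rightarrow> 'a set \<Rightarrow> ('a \<Rightarrow> real) \<Rightarrow> real" where
  "quad_form E S x = (\<Sum>u\<in>S. x u * sum x (nbrs E S u))"

definition spectral_radius :: "('a \<Rightarrow> 'a \<Rightarrow> bool) \<Rightarrow> 'a set \<Rightarrow> real" where
  "spectral_radius E S = Sup (quad_form E S ` {x. (\<Sum>v\<in>S. (x v)\<^sup>2) = 1})"

definition principal_vector :: "('a \<Rightarrow> 'a \<Rightarrow> bool) \<Rightarrow> 'a set \<Rightarrow> ('a \<Rightarrow> real) \<Rightarrow> bool" where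
  "principal_vector E S x \<longleftrightarrow>
    (\<forall>v\<in>S. 0 \<le> x v) \<and> (\<Sum>v\<in>S. (x v)\<^sup>2) = 1 \<and>
    (\<forall>u\<in>S. sum x (nbrs E S u) = spectral_radius E S * x u)"

lemma nbrs_subset: "nbrs E S u \<subseteq> S"
  by (auto simp: nbrs_def)

lemma finite_nbrs: "finite S \<Longrightarrow> finite (nbrs E S u)"
  by (simp add: nbrs_def)

lemma sum_nbrs_eq: "finite S \<Longrightarrow> sum x (nbrs E S u) = (\<Sum>v\<in>S. if E u v then x v else 0)"
  unfolding nbrs_def by (rule sum.inter_filter)

lemma quad_form_eq:
  "finite S \<Longrightarrow> quad_form E S x = (\<Sum>u\<in>S. \<Sum>v\<in>S. if E u v then x u * x v else 0)"
  unfolding quad_form_def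
  by (intro sum.cong) (auto simp: sum_nbrs_eq sum_distrib_left intro!: sum.cong)

lemma quad_form_cong:
  assumes "\<And>u v. u \<in> S \<Longrightarrow> v \<in> S \<Longrightarrow> E u v \<longleftrightarrow> F u v" "\<And>v. v \<in> S \<Longrightarrow> x v = y v"
  shows "quad_form E S x = quad_form F S y"
proof -
  have "nbrs E S u = nbrs F S u" if "u \<in> S" for u
    using assms(1)[OF that] by (auto simp: nbrs_def)
  moreover have "sum x (nbrs F S u) = sum y (nbrs F S u)" for u
    by (intro sum.cong refl assms(2)) (auto simp: nbrs_def)
  ultimately show ?thesis
    unfolding quad_form_def by (intro sum.cong) (simp_all add: assms(2))
qed

lemma spectral_radius_cong:
  assumes "\<And>u v. u \<in> S \<Longrightarrow> v \<in> S \<Longrightarrow> E u v \<longleftrightarrow> F u v"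
  shows "spectral_radius E S = spectral_radius F S"
proof -
  have "quad_form E S = quad_form F S"
    by (intro ext quad_form_cong assms) simp_all
  then show ?thesis by (simp add: spectral_radius_def)
qed

lemma quad_form_scale: "quad_form E S (\<lambda>v. k * x v) = k\<^sup>2 * quad_form E S x"
  by (simp add: quad_form_def sum_distrib_left[symmetric] power2_eq_square mult_ac)

lemma quad_form_nonneg: "(\<And>v. v \<in> S \<Longrightarrow> 0 \<le> x v) \<Longrightarrow> 0 \<le> quad_form E S x"
  unfolding quad_form_def by (intro sum_nonneg mult_nonneg_nonneg) (auto simp: nbrs_def)

lemma compact_unit_sphere:
  assumes "finite S"
  shows "compact {x :: 'a \<Rightarrow> real. (\<forall>v. v \<notin> S \<longrightarrow> x v = 0) \<and> (\<Sum>v\<in>S. (x v)\<^sup>2) = 1}"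
    (is "compact ?sphere")
proof -
  let ?box = "Pi\<^sub>E UNIV (\<lambda>v. if v \<in> S then {-1..1} else {0 :: real})"
  let ?unit = "{x :: 'a \<Rightarrow> real. (\<Sum>v\<in>S. (x v)\<^sup>2) = 1}"
  have "compactin (product_topology (\<lambda>_. euclidean) UNIV) ?box"
    by (subst compactin_PiE) auto
  then have "compact ?box" by (simp add: euclidean_product_topology)
  moreover have "closed ?unit"
    by (intro closed_Collect_eq continuous_intros
        continuous_on_subset[OF continuous_on_product_coordinates]) auto
  ultimately have "compact (?box \<inter> ?unit)" by (rule compact_Int_closed)
  also have "?box \<inter> ?unit = ?sphere"
  proof -
    have "-1 \<le> x v \<and> x v \<le> 1" if "(\<Sum>v\<in>S. (x v)\<^sup>2) = 1" "v \<in> S" for x :: "'a \<Rightarrow> real" and v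
    proof -
      have "(x v)\<^sup>2 \<le> 1" unfolding that(1)[symmetric]
        using assms that(2) by (intro member_le_sum) auto
      then show ?thesis by (simp add: abs_square_le_1 abs_le_iff minus_le_iff)
    qed
    then show ?thesis by (auto simp: PiE_def Pi_def split: if_splits)
  qed
  finally show ?thesis .
qed

lemma quad_form_attains_sup:
  assumes "finite S" "S \<noteq> {}"
  shows "\<exists>x. (\<Sum>v\<in>S. (x v)\<^sup>2) = 1 \<and>
    (\<forall>y. (\<Sum>v\<in>S. (y v)\<^sup>2) = 1 \<longrightarrow> quad_form E S y \<le> quad_form E S x)"
proof -
  let ?sphere = "{x :: 'a \<Rightarrow> real. (\<forall>v. v \<notin> S \<longrightarrow> x v = 0) \<and> (\<Sum>v\<in>S. (x v)\<^sup>2) = 1}"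
  obtain a where "a \<in> S" using assms(2) by blast
  then have "(\<lambda>v. if v = a then 1 else 0) \<in> ?sphere"
    using assms(1) by (auto simp: if_distrib[of "\<lambda>z. z\<^sup>2"] cong: if_cong)
  then have nonempty: "?sphere \<noteq> {}" by (metis empty_iff)
  have "continuous_on ?sphere (\<lambda>x. quad_form E S x)"
    unfolding quad_form_def
    by (intro continuous_intros continuous_on_subset[OF continuous_on_product_coordinates]) auto
  from continuous_attains_sup[OF compact_unit_sphere[OF assms(1)] nonempty this]
  obtain x where maximizer: "x \<in> ?sphere" "\<And>y. y \<in> ?sphere \<Longrightarrow> quad_form E S y \<le> quad_form E S x"
    by blast
  have "quad_form E S y \<le> quad_form E S x" if "(\<Sum>v\<in>S. (y v)\<^sup>2) = 1" for y
  proof -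
    let ?z = "\<lambda>v. if v \<in> S then y v else 0"
    have "?z \<in> ?sphere" using that by simp
    then have "quad_form E S ?z \<le> quad_form E S x" by (rule maximizer(2))
    also have "quad_form E S ?z = quad_form E S y" by (rule quad_form_cong) simp_all
    finally show ?thesis .
  qed
  then show ?thesis using maximizer(1) by blast
qed

lemma spectral_radius_attained:
  assumes "finite S" "S \<noteq> {}"
  obtains x where "(\<Sum>v\<in>S. (x v)\<^sup>2) = 1" "quad_form E S x = spectral_radius E S"
    "\<And>y. (\<Sum>v\<in>S. (y v)\<^sup>2) = 1 \<Longrightarrow> quad_form E S y \<le> spectral_radius E S"
proof -
  obtain x where maximizer: "(\<Sum>v\<in>S. (x v)\<^sup>2) = 1"
    "\<And>y. (\<Sum>v\<in>S. (y v)\<^sup>2) = 1 \<Longrightarrow> quad_form E S y \<le> quad_form E S x"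
    using quad_form_attains_sup[OF assms] by blast
  moreover from maximizer have "quad_form E S x = spectral_radius E S"
    unfolding spectral_radius_def by (intro cSup_eq_maximum[symmetric]) auto
  ultimately show ?thesis using that by simp
qed

lemma quad_form_le_spectral_radius:
  assumes "finite S"
  shows "quad_form E S y \<le> spectral_radius E S * (\<Sum>v\<in>S. (y v)\<^sup>2)"
proof (cases "(\<Sum>v\<in>S. (y v)\<^sup>2) = 0")
  case True
  then have "\<forall>v\<in>S. y v = 0" using assms by (simp add: sum_nonneg_eq_0_iff)
  then show ?thesis using True by (simp add: quad_form_def)
next
  case False
  define N where "N = (\<Sum>v\<in>S. (y v)\<^sup>2)"
  have "0 \<le> N" by (simp add: N_def sum_nonneg)
  then have "0 < N" using False by (simp add: N_def)
  have "S \<noteq> {}" using False by auto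
  have "(\<Sum>v\<in>S. (1 / sqrt N * y v)\<^sup>2) = (1 / sqrt N)\<^sup>2 * N"
    by (simp only: power_mult_distrib sum_distrib_left N_def)
  also have "\<dots> = 1" using \<open>0 < N\<close> by (simp add: power_divide)
  finally have "quad_form E S (\<lambda>v. 1 / sqrt N * y v) \<le> spectral_radius E S"
    using spectral_radius_attained[OF assms \<open>S \<noteq> {}\<close>] by metis
  then have "(1 / sqrt N)\<^sup>2 * quad_form E S y \<le> spectral_radius E S"
    by (simp only: quad_form_scale)
  then show ?thesis
    using \<open>0 < N\<close> unfolding N_def[symmetric] by (simp add: power_divide field_simps)
qed

lemma linear_le_square_imp_zero:
  fixes p q :: real
  assumes "\<And>t. t * p \<le> t\<^sup>2 * q"
  shows "p = 0"
proof (rule ccontr)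
  assume "p \<noteq> 0"
  define k where "k = \<bar>q\<bar> + 1"
  have k_bounds: "k > 0" "q < k" unfolding k_def by auto
  have "p / k * p \<le> (p / k)\<^sup>2 * q" by (rule assms)
  also have "\<dots> < (p / k)\<^sup>2 * k"
    using k_bounds \<open>p \<noteq> 0\<close> by (intro mult_strict_left_mono) auto
  also have "\<dots> = p / k * p" using k_bounds by (simp add: power2_eq_square field_simps)
  finally show False by simp
qed

lemma sum_principal_vector_pos:
  assumes "finite S" "principal_vector E S x"
  shows "0 < sum x S"
proof -
  have "\<exists>v\<in>S. x v \<noteq> 0"
  proof (rule ccontr)
    assume "\<not> ?thesis"
    then have "(\<Sum>v\<in>S. (x v)\<^sup>2) = 0" by simp
    then show False using assms(2) by (simp add: principal_vector_def)
  qed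
  then show ?thesis
    using assms by (force simp: principal_vector_def intro: sum_pos2)
qed

lemma quad_form_principal_vector:
  assumes "principal_vector E S x"
  shows "quad_form E S x = spectral_radius E S"
proof -
  have "quad_form E S x = (\<Sum>u\<in>S. spectral_radius E S * (x u)\<^sup>2)"
    unfolding quad_form_def using assms
    by (intro sum.cong) (auto simp: principal_vector_def power2_eq_square)
  then show ?thesis using assms by (simp add: sum_distrib_left[symmetric] principal_vector_def)
qed

locale adjacency =
  fixes E :: "'a \<Rightarrow> 'a \<Rightarrow> bool"
  assumes sym: "E u v \<Longrightarrow> E v u" and irrefl: "\<not> E u u"
begin

lemma sym_iff: "E u v \<longleftrightarrow> E v u"
  using sym by blast

lemma quad_form_add_at:
  assumes "finite S" "u \<in> S"
  shows "quad_form E S (\<lambda>v. x v + (if v = u then t else 0)) =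
    quad_form E S x + 2 * t * sum x (nbrs E S u)"
proof -
  define e where "e v = (if v = u then t else 0)" for v
  have "quad_form E S (\<lambda>v. x v + e v) =
    (\<Sum>a\<in>S. \<Sum>b\<in>S. (if E a b then x a * x b else 0) + (if E a b then x a * e b else 0)
      + (if E a b then e a * x b else 0) + (if E a b then e a * e b else 0))"
    unfolding quad_form_eq[OF assms(1)] by (intro sum.cong) (auto simp: algebra_simps)
  also have "\<dots> = quad_form E S x + (\<Sum>a\<in>S. \<Sum>b\<in>S. if E a b then x a * e b else 0)
      + (\<Sum>a\<in>S. \<Sum>b\<in>S. if E a b then e a * x b else 0)
      + (\<Sum>a\<in>S. \<Sum>b\<in>S. if E a b then e a * e b else 0)"
    by (simp add: sum.distrib quad_form_eq[OF assms(1)])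
  also have "(\<Sum>a\<in>S. \<Sum>b\<in>S. if E a b then e a * e b else 0) = 0"
    by (intro sum.neutral ballI) (auto simp: e_def irrefl)
  also have "(\<Sum>a\<in>S. \<Sum>b\<in>S. if E a b then x a * e b else 0) =
      (\<Sum>a\<in>S. \<Sum>b\<in>S. if E a b then e a * x b else 0)"
    by (subst sum.swap) (intro sum.cong refl, simp add: sym_iff mult.commute)
  also have "(\<Sum>a\<in>S. \<Sum>b\<in>S. if E a b then e a * x b else 0) =
      (\<Sum>a\<in>S. if a = u then t * sum x (nbrs E S u) else 0)"
    by (intro sum.cong refl)
      (auto simp: e_def sum_nbrs_eq[OF assms(1)] sum_distrib_left intro!: sum.cong sum.neutral)
  also have "\<dots> = t * sum x (nbrs E S u)"
    using assms by simp
  finally show ?thesis by (simp add: e_def)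
qed

lemma rayleigh_maximizer_eigenvector:
  assumes "finite S" "(\<Sum>v\<in>S. (x v)\<^sup>2) = 1" "quad_form E S x = spectral_radius E S" "u \<in> S"
  shows "sum x (nbrs E S u) = spectral_radius E S * x u"
proof -
  let ?\<mu> = "spectral_radius E S"
  have "t * (2 * (sum x (nbrs E S u) - ?\<mu> * x u)) \<le> t\<^sup>2 * ?\<mu>" for t
  proof -
    let ?y = "\<lambda>v. x v + (if v = u then t else 0)"
    have "(\<Sum>v\<in>S. (?y v)\<^sup>2) = (\<Sum>v\<in>S. (x v)\<^sup>2 + (if v = u then 2 * t * x u + t\<^sup>2 else 0))"
      by (intro sum.cong) (auto simp: power2_eq_square algebra_simps)
    also have "\<dots> = 1 + 2 * t * x u + t\<^sup>2"
      using assms(1,2,4) by (simp add: sum.distrib)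
    finally have "(\<Sum>v\<in>S. (?y v)\<^sup>2) = 1 + 2 * t * x u + t\<^sup>2" .
    with quad_form_le_spectral_radius[OF assms(1), of E ?y]
      quad_form_add_at[OF assms(1,4), of x t] assms(3)
    show ?thesis by (simp add: algebra_simps)
  qed
  then have "2 * (sum x (nbrs E S u) - ?\<mu> * x u) = 0" by (rule linear_le_square_imp_zero)
  then show ?thesis by simp
qed

lemma principal_vector_exists:
  assumes "finite S" "S \<noteq> {}"
  shows "\<exists>x. principal_vector E S x"
proof -
  obtain z where maximizer: "(\<Sum>v\<in>S. (z v)\<^sup>2) = 1" "quad_form E S z = spectral_radius E S"
    using spectral_radius_attained[OF assms] by metis
  define x where "x v = \<bar>z v\<bar>" for v
  have unit: "(\<Sum>v\<in>S. (x v)\<^sup>2) = 1" using maximizer(1) by (simp add: x_def)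
  have "quad_form E S z \<le> quad_form E S x"
    unfolding quad_form_eq[OF assms(1)] x_def
    by (intro sum_mono) (auto simp: abs_mult[symmetric])
  then have "quad_form E S x = spectral_radius E S"
    using quad_form_le_spectral_radius[OF assms(1), of E x] maximizer(2) unit by simp
  from rayleigh_maximizer_eigenvector[OF assms(1) unit this]
  have "principal_vector E S x"
    using unit by (auto simp: principal_vector_def x_def)
  then show ?thesis by blast
qed

lemma spectral_radius_nonneg:
  assumes "finite S" "S \<noteq> {}"
  shows "0 \<le> spectral_radius E S"
proof -
  obtain x where principal: "principal_vector E S x"
    using principal_vector_exists[OF assms] by blast
  then have "0 \<le> quad_form E S x" by (intro quad_form_nonneg) (simp add: principal_vector_def)
  then show ?thesis by (simp add: quad_form_principal_vector[OF principal])
qed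

end

lemma finite_eigenvalues:
  fixes A :: "'a :: field mat"
  assumes "A \<in> carrier_mat n n"
  shows "finite {k. eigenvalue A k}"
proof -
  have "{k. eigenvalue A k} = {k. poly (char_poly A) k = 0}"
    using eigenvalue_root_char_poly[OF assms] by simp
  moreover have "char_poly A \<noteq> 0"
    using degree_monic_char_poly[OF assms] by auto
  ultimately show ?thesis using poly_roots_finite by simp
qed

lemma adjacency_graph:
  assumes "graph G"
  shows "adjacency (dominates G)"
proof -
  interpret graph G by fact
  show ?thesis
    using adj_not_same by unfold_locales (auto intro: arcs_ends_symmetric[OF sym_arcs])
qed

lemma largest_eigenvalue_eq_spectral_radius:
  assumes "graph G" "verts G \<noteq> {}"
  shows "largest_eigenvalue G = spectral_radius (dominates G) (verts G)"
proof -
  interpret graph G by fact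
  let ?E = "dominates G"
  interpret adjacency ?E by (rule adjacency_graph) fact
  have eigenvalue_iff: "eigenvalue (adjacency_matrix G) k \<longleftrightarrow>
      (\<exists>x. (\<exists>v\<in>verts G. x v \<noteq> 0) \<and> (\<forall>u\<in>verts G. sum x (nbrs ?E (verts G) u) = k * x u))" for k
    unfolding nbrs_def by (rule eigenvalue_adjacency_matrix_iff[OF finite_verts])
  obtain x where principal: "principal_vector ?E (verts G) x"
    using principal_vector_exists[OF finite_verts assms(2)] by blast
  then have "\<exists>v\<in>verts G. x v \<noteq> 0"
    using sum_principal_vector_pos[OF finite_verts principal] by (metis less_irrefl sum.neutral)
  then have "eigenvalue (adjacency_matrix G) (spectral_radius ?E (verts G))"
    unfolding eigenvalue_iff using principal by (auto simp: principal_vector_def)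
  moreover have "k \<le> spectral_radius ?E (verts G)" if "eigenvalue (adjacency_matrix G) k" for k
  proof -
    obtain y v where nonzero: "v \<in> verts G" "y v \<noteq> 0"
      and eigenvector: "\<And>u. u \<in> verts G \<Longrightarrow> sum y (nbrs ?E (verts G) u) = k * y u"
      using \<open>eigenvalue (adjacency_matrix G) k\<close> unfolding eigenvalue_iff by blast
    have "quad_form ?E (verts G) y = (\<Sum>u\<in>verts G. k * (y u)\<^sup>2)"
      unfolding quad_form_def by (intro sum.cong) (auto simp: eigenvector power2_eq_square)
    then have "k * (\<Sum>u\<in>verts G. (y u)\<^sup>2) = quad_form ?E (verts G) y"
      by (simp add: sum_distrib_left)
    also have "\<dots> \<le> spectral_radius ?E (verts G) * (\<Sum>u\<in>verts G. (y u)\<^sup>2)"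
      by (rule quad_form_le_spectral_radius[OF finite_verts])
    finally have "k * (\<Sum>u\<in>verts G. (y u)\<^sup>2) \<le>
      spectral_radius ?E (verts G) * (\<Sum>u\<in>verts G. (y u)\<^sup>2)" .
    moreover have "0 < (\<Sum>u\<in>verts G. (y u)\<^sup>2)" using nonzero by (intro sum_pos2[of _ v]) auto
    ultimately show ?thesis by simp
  qed
  moreover have "finite {k. eigenvalue (adjacency_matrix G) k}"
    by (rule finite_eigenvalues[of _ "card (verts G)"]) (simp add: adjacency_matrix_def Let_def)
  ultimately show ?thesis
    unfolding largest_eigenvalue_def by (intro Max_eqI) auto
qed

section \<open>The spectral Turan theorem\<close>

definition cross_class :: "('a \<Rightarrow> nat) \<Rightarrow> 'a \<Rightarrow> 'a \<Rightarrow> bool" where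
  "cross_class p u v \<longleftrightarrow> p u \<noteq> p v"

definition class_size :: "'a set \<Rightarrow> ('a \<Rightarrow> nat) \<Rightarrow> nat \<Rightarrow> nat" where
  "class_size S p i = card {v \<in> S. p v = i}"

lemma adjacency_cross_class: "adjacency (cross_class p)"
  by unfold_locales (auto simp: cross_class_def)

lemma sum_classes:
  fixes f :: "nat \<Rightarrow> real"
  assumes "finite S" "p ` S \<subseteq> {..<r}"
  shows "(\<Sum>v\<in>S. f (p v)) = (\<Sum>i<r. real (class_size S p i) * f i)"
proof -
  have "(\<Sum>v\<in>S. f (p v)) = (\<Sum>i<r. \<Sum>v | v \<in> S \<and> p v = i. f (p v))"
    by (rule sum.group[symmetric]) (use assms in auto)
  also have "\<dots> = (\<Sum>i<r. real (class_size S p i) * f i)"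
    by (intro sum.cong) (auto simp: class_size_def)
  finally show ?thesis .
qed

lemma sum_class_size:
  assumes "finite S" "p ` S \<subseteq> {..<r}"
  shows "(\<Sum>i<r. class_size S p i) = card S"
  unfolding class_size_def card_eq_sum by (rule sum.group) (use assms in auto)

lemma sum_nbrs_cross_class:
  fixes x :: "'a \<Rightarrow> real"
  assumes "finite S"
  shows "sum x (nbrs (cross_class p) S u) = sum x S - (\<Sum>v | v \<in> S \<and> p v = p u. x v)"
proof -
  have "nbrs (cross_class p) S u = S - {v \<in> S. p v = p u}"
    by (auto simp: nbrs_def cross_class_def)
  then show ?thesis using assms by (simp add: sum_diff)
qed

text \<open>In the eigenvalue equation \<open>sum x S - (\<Sum>v | v \<in> S \<and> p v = p u. x v) = \<mu> * x u\<close> the entry \<open>x u\<close> depends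
  only on the class of \<open>u\<close>.\<close>

lemma cross_class_eigenvalue_equation:
  assumes "finite S" "S \<noteq> {}" "p ` S \<subseteq> {..<r}"
    and radius: "\<mu> = spectral_radius (cross_class p) S" "0 < \<mu>"
  shows "(\<Sum>i<r. real (class_size S p i) / (\<mu> + real (class_size S p i))) = 1"
proof -
  interpret adjacency "cross_class p" by (rule adjacency_cross_class)
  obtain x where principal: "principal_vector (cross_class p) S x"
    using principal_vector_exists[OF assms(1,2)] by blast
  have pos: "0 < sum x S" by (rule sum_principal_vector_pos[OF assms(1) principal])
  have eigen: "sum x S - (\<Sum>v | v \<in> S \<and> p v = p u. x v) = \<mu> * x u" if "u \<in> S" for u
    using principal that
    unfolding principal_vector_def radius(1) sum_nbrs_cross_class[OF assms(1), symmetric]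
    by blast
  have entry: "x u = sum x S * (1 / (\<mu> + real (class_size S p (p u))))" if u_mem: "u \<in> S" for u
  proof -
    have "x v = x u" if "v \<in> S" "p v = p u" for v
      using eigen[OF u_mem] eigen[OF that(1)] that(2) radius(2) by simp
    then have "(\<Sum>v | v \<in> S \<and> p v = p u. x v) = real (class_size S p (p u)) * x u"
      by (simp add: class_size_def)
    then have "sum x S = x u * (\<mu> + real (class_size S p (p u)))"
      using eigen[OF u_mem] by (simp add: algebra_simps)
    then show ?thesis using radius(2) by (simp add: field_simps add_pos_nonneg)
  qed
  have "sum x S = sum x S * (\<Sum>v\<in>S. 1 / (\<mu> + real (class_size S p (p v))))"
    unfolding sum_distrib_left by (intro sum.cong refl entry)
  then have "(\<Sum>v\<in>S. 1 / (\<mu> + real (class_size S p (p v)))) = 1" using pos by simp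
  then show ?thesis
    unfolding sum_classes[OF assms(1,3), of "\<lambda>i. 1 / (\<mu> + real (class_size S p i))"] by simp
qed

lemma le_spectral_radius_cross_class_iff:
  assumes "finite S" "S \<noteq> {}" "p ` S \<subseteq> {..<r}" "0 < \<mu>"
  shows "\<mu> \<le> spectral_radius (cross_class p) S \<longleftrightarrow>
    1 \<le> (\<Sum>i<r. real (class_size S p i) / (\<mu> + real (class_size S p i)))" (is "_ \<longleftrightarrow> 1 \<le> ?total")
proof
  let ?\<nu> = "spectral_radius (cross_class p) S"
  assume radius_ge: "\<mu> \<le> ?\<nu>"
  then have "1 = (\<Sum>i<r. real (class_size S p i) / (?\<nu> + real (class_size S p i)))"
    using cross_class_eigenvalue_equation[OF assms(1-3) refl] assms(4) by simp
  also have "\<dots> \<le> ?total"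
    using radius_ge assms(4) by (intro sum_mono divide_left_mono mult_pos_pos add_pos_nonneg) auto
  finally show "1 \<le> ?total" .
next
  assume total: "1 \<le> ?total"
  define g where "g v = 1 / (\<mu> + real (class_size S p (p v)))" for v
  have g_pos: "0 < g v" for v using assms(4) by (simp add: g_def add_pos_nonneg)
  have "\<mu> * (g u)\<^sup>2 \<le> g u * sum g (nbrs (cross_class p) S u)" if "u \<in> S" for u
  proof -
    have "(\<Sum>v | v \<in> S \<and> p v = p u. g v) = real (class_size S p (p u)) * g u"
      by (simp add: g_def class_size_def)
    then have "\<mu> * g u = 1 - (\<Sum>v | v \<in> S \<and> p v = p u. g v)"
      using assms(4) by (simp add: g_def field_simps add_pos_nonneg)
    also have "\<dots> \<le> sum g (nbrs (cross_class p) S u)"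
      using total sum_classes[OF assms(1,3), of "\<lambda>i. 1 / (\<mu> + real (class_size S p i))"]
      by (simp add: sum_nbrs_cross_class[OF assms(1)] g_def)
    finally show ?thesis
      using mult_left_mono[of _ _ "g u"] g_pos[of u] by (fastforce simp: power2_eq_square)
  qed
  then have "\<mu> * (\<Sum>v\<in>S. (g v)\<^sup>2) \<le> quad_form (cross_class p) S g"
    unfolding quad_form_def sum_distrib_left by (rule sum_mono)
  also have "\<dots> \<le> spectral_radius (cross_class p) S * (\<Sum>v\<in>S. (g v)\<^sup>2)"
    by (rule quad_form_le_spectral_radius[OF assms(1)])
  finally have "\<mu> * (\<Sum>v\<in>S. (g v)\<^sup>2) \<le> spectral_radius (cross_class p) S * (\<Sum>v\<in>S. (g v)\<^sup>2)" .
  moreover have "0 < (\<Sum>v\<in>S. (g v)\<^sup>2)"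
    using assms(1,2) g_pos by (intro sum_pos zero_less_power)
  ultimately show "\<mu> \<le> spectral_radius (cross_class p) S" by simp
qed

definition cliques :: "('a \<Rightarrow> 'a \<Rightarrow> bool) \<Rightarrow> 'a set \<Rightarrow> nat \<Rightarrow> 'a list set" where
  "cliques E S k = {xs. length xs = k \<and> set xs \<subseteq> S \<and> sorted_wrt E xs}"

lemma finite_cliques: "finite S \<Longrightarrow> finite (cliques E S k)"
  by (rule finite_subset[OF _ finite_lists_length_eq[of S k]]) (auto simp: cliques_def)

lemma card_cliques_le: "finite S \<Longrightarrow> card (cliques E S k) \<le> card S ^ k"
  using card_mono[OF finite_lists_length_eq[of S k], of "cliques E S k"]
  by (auto simp: cliques_def card_lists_length_eq)

lemma cliques_mono: "S \<subseteq> T \<Longrightarrow> cliques E S k \<subseteq> cliques E T k"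
  by (auto simp: cliques_def)

lemma cliques_0: "cliques E S 0 = {[]}"
  by (auto simp: cliques_def)

lemma cliques_Suc_0: "cliques E S (Suc 0) = (\<lambda>v. [v]) ` S"
  by (auto simp: cliques_def length_Suc_conv)

context adjacency
begin

lemma majorization_extend:
  fixes x :: "'a \<Rightarrow> real"
  assumes finite: "finite S" and nonneg: "\<And>v. v \<in> S \<Longrightarrow> 0 \<le> x v"
    and max_degree: "\<And>v. v \<in> S \<Longrightarrow> sum x (nbrs E S v) \<le> sum x (nbrs E S u)"
    and colouring: "p ` nbrs E S u \<subseteq> {..<r}"
      "\<And>v. v \<in> nbrs E S u \<Longrightarrow>
        sum x (nbrs E (nbrs E S u) v) \<le> sum x (nbrs (cross_class p) (nbrs E S u) v)"
    and v_mem: "v \<in> S"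
  shows "sum x (nbrs E S v) \<le> sum x (nbrs (cross_class (\<lambda>w. if w \<in> nbrs E S u then p w else r)) S v)"
    (is "_ \<le> sum x (nbrs (cross_class ?q) S v)")
proof (cases "v \<in> nbrs E S u")
  case True
  let ?N = "nbrs E S u"
  have finite_N: "finite ?N" by (rule finite_nbrs[OF finite])
  have "nbrs E S v = nbrs E ?N v \<union> nbrs E (S - ?N) v"
    by (auto simp: nbrs_def)
  then have "sum x (nbrs E S v) = sum x (nbrs E ?N v) + sum x (nbrs E (S - ?N) v)"
    using finite finite_N by (simp add: sum.union_disjoint nbrs_def disjoint_iff)
  also have "\<dots> \<le> sum x (nbrs (cross_class p) ?N v) + sum x (S - ?N)"
    using finite nonneg
    by (intro add_mono[OF colouring(2)[OF True] sum_mono2]) (auto simp: nbrs_def)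
  also have "\<dots> = sum x (nbrs (cross_class p) ?N v \<union> (S - ?N))"
    using finite finite_N by (intro sum.union_disjoint[symmetric] finite_nbrs) (auto simp: nbrs_def)
  also have "nbrs (cross_class p) ?N v \<union> (S - ?N) = nbrs (cross_class ?q) S v"
  proof -
    have "p v \<noteq> r" using colouring(1) True by auto
    moreover have "?N \<subseteq> S" by (rule nbrs_subset)
    ultimately show ?thesis
      using True unfolding nbrs_def[of "cross_class _"] cross_class_def by auto
  qed
  finally show ?thesis .
next
  case False
  have "p w \<noteq> r" if "w \<in> nbrs E S u" for w using colouring(1) that by auto
  then have "nbrs (cross_class ?q) S v = nbrs E S u"
    using False nbrs_subset[of E S u] unfolding nbrs_def[of "cross_class _"] cross_class_def by auto
  then show ?thesis using max_degree[OF v_mem] by simp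
qed

text \<open>Erdos's degree majorization for weighted degrees: the neighbourhood of a vertex of largest
  weighted degree is coloured recursively, and the remaining vertices form one more part.\<close>

lemma weighted_degree_majorization:
  fixes x :: "'a \<Rightarrow> real"
  assumes "finite S" "cliques E S (Suc r) = {}" "\<And>v. v \<in> S \<Longrightarrow> 0 \<le> x v"
  shows "\<exists>p. p ` S \<subseteq> {..<r} \<and>
    (\<forall>v\<in>S. sum x (nbrs E S v) \<le> sum x (nbrs (cross_class p) S v))"
  using assms
proof (induction r arbitrary: S)
  case 0
  then have "S = {}" by (simp add: cliques_Suc_0)
  then show ?case by simp
next
  case (Suc r)
  show ?case
  proof (cases "S = {}")
    case False
    have "Max ((\<lambda>v. sum x (nbrs E S v)) ` S) \<in> (\<lambda>v. sum x (nbrs E S v)) ` S"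
      using Suc.prems(1) False by simp
    then obtain u where "u \<in> S" "sum x (nbrs E S u) = Max ((\<lambda>v. sum x (nbrs E S v)) ` S)" by auto
    then have max_degree: "sum x (nbrs E S v) \<le> sum x (nbrs E S u)" if "v \<in> S" for v
      using Suc.prems(1) that by simp
    have "cliques E (nbrs E S u) (Suc r) = {}"
    proof (rule ccontr)
      assume "cliques E (nbrs E S u) (Suc r) \<noteq> {}"
      then obtain xs where "xs \<in> cliques E (nbrs E S u) (Suc r)" by blast
      then have "u # xs \<in> cliques E S (Suc (Suc r))"
        using \<open>u \<in> S\<close> by (auto simp: cliques_def nbrs_def)
      then show False using Suc.prems(2) by blast
    qed
    with Suc.IH[of "nbrs E S u"] Suc.prems nbrs_subset[of E S u]
    obtain p where colouring: "p ` nbrs E S u \<subseteq> {..<r}"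
      "\<And>v. v \<in> nbrs E S u \<Longrightarrow>
        sum x (nbrs E (nbrs E S u) v) \<le> sum x (nbrs (cross_class p) (nbrs E S u) v)"
      by (meson finite_nbrs subsetD)
    let ?q = "\<lambda>w. if w \<in> nbrs E S u then p w else r"
    have "?q ` S \<subseteq> {..<Suc r}" using colouring(1) by (auto simp: less_Suc_eq)
    then show ?thesis
      using majorization_extend[OF Suc.prems(1,3) max_degree colouring] by blast
  qed simp
qed

lemma spectral_radius_le_cross_class:
  assumes "finite S" "S \<noteq> {}" "cliques E S (Suc r) = {}"
  shows "\<exists>p. p ` S \<subseteq> {..<r} \<and> spectral_radius E S \<le> spectral_radius (cross_class p) S"
proof -
  obtain x where principal: "principal_vector E S x"
    using principal_vector_exists[OF assms(1,2)] by blast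
  then have nonneg: "0 \<le> x v" if "v \<in> S" for v using that by (simp add: principal_vector_def)
  from weighted_degree_majorization[where x = x, OF assms(1,3) this]
  obtain p where colouring: "p ` S \<subseteq> {..<r}"
    "\<forall>v\<in>S. sum x (nbrs E S v) \<le> sum x (nbrs (cross_class p) S v)" by blast
  have "spectral_radius E S = quad_form E S x"
    by (rule quad_form_principal_vector[OF principal, symmetric])
  also have "\<dots> \<le> quad_form (cross_class p) S x"
    unfolding quad_form_def using colouring(2) nonneg by (intro sum_mono mult_left_mono) auto
  also have "\<dots> \<le> spectral_radius (cross_class p) S"
    using quad_form_le_spectral_radius[OF assms(1), of _ x] principal
    by (simp add: principal_vector_def)
  finally show ?thesis using colouring(1) by blast
qed

end

text \<open>The line through the graph of the concave function at two consecutive integers lies above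
  it at every integer.\<close>

lemma sum_ratio_le_balanced:
  fixes m k :: "nat \<Rightarrow> nat" and \<mu> :: real
  assumes pos: "0 < \<mu>" and same_total: "(\<Sum>i<r. k i) = (\<Sum>i<r. m i)"
    and balanced: "\<And>i. i < r \<Longrightarrow> m i = q \<or> m i = Suc q"
  shows "(\<Sum>i<r. real (k i) / (\<mu> + real (k i))) \<le> (\<Sum>i<r. real (m i) / (\<mu> + real (m i)))"
proof -
  define slope where "slope = \<mu> / ((\<mu> + real q) * (\<mu> + real q + 1))"
  define line where "line t = real q / (\<mu> + real q) + (real t - real q) * slope" for t :: nat
  have denom_pos: "\<mu> + real t > 0" for t using pos by simp
  have gap: "line t - real t / (\<mu> + real t) =
      \<mu> * ((real t - real q) * (real t - real q - 1)) / ((\<mu> + real q) * (\<mu> + real q + 1) * (\<mu> + real t))" for t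
    using denom_pos[of q] denom_pos[of t] denom_pos[of "Suc q"]
    unfolding line_def slope_def by (simp add: divide_simps) (simp add: algebra_simps)
  have above: "real t / (\<mu> + real t) \<le> line t" for t
  proof -
    have "0 \<le> (real t - real q) * (real t - real q - 1)"
      by (cases "t \<le> q") (auto intro: mult_nonpos_nonpos)
    then have "0 \<le> \<mu> * ((real t - real q) * (real t - real q - 1))" using pos by simp
    then have "0 \<le> line t - real t / (\<mu> + real t)"
      unfolding gap by (rule divide_nonneg_nonneg) (use pos in simp)
    then show ?thesis by simp
  qed
  have touching: "line (m i) = real (m i) / (\<mu> + real (m i))" if "i < r" for i
  proof -
    have "line (m i) - real (m i) / (\<mu> + real (m i)) = 0"
      unfolding gap using balanced[OF that] by auto
    then show ?thesis by simp
  qed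
  have same_sum: "(\<Sum>i<r. real (k i)) = (\<Sum>i<r. real (m i))" using same_total by (metis of_nat_sum)
  have "(\<Sum>i<r. real (k i) / (\<mu> + real (k i))) \<le> (\<Sum>i<r. line (k i))" by (intro sum_mono above)
  also have "\<dots> = (\<Sum>i<r. line (m i))"
    unfolding line_def
    by (simp add: same_sum sum.distrib sum_subtractf left_diff_distrib sum_distrib_right[symmetric])
  also have "\<dots> = (\<Sum>i<r. real (m i) / (\<mu> + real (m i)))" by (intro sum.cong) (simp_all add: touching)
  finally show ?thesis .
qed

lemma pverts_turan_graph:
  "pverts (turan_graph r n) = (SIGMA i:{..<r}. {..<(n + i) div r})"
  by (auto simp: turan_graph_def complete_multipartite_def turan_sizes_def Let_def)

lemma class_size_turan_graph:
  assumes "i < r"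
  shows "class_size (pverts (turan_graph r n)) fst i = (n + i) div r"
proof -
  have "{v \<in> pverts (turan_graph r n). fst v = i} = {i} \<times> {..<(n + i) div r}"
    using assms by (auto simp: pverts_turan_graph)
  then show ?thesis by (simp add: class_size_def card_cartesian_product)
qed

lemma turan_part_size_cases:
  assumes "i < r"
  shows "(n + i) div r = n div r \<or> (n + i) div r = Suc (n div r)"
proof -
  have "n div r \<le> (n + i) div r" "(n + i) div r \<le> (n + r) div r"
    by (rule div_le_mono; use assms in simp)+
  moreover have "(n + r) div r = Suc (n div r)" using assms by simp
  ultimately show ?thesis by linarith
qed

lemma sum_turan_part_sizes: "0 < (r :: nat) \<Longrightarrow> (\<Sum>i<r. (n + i) div r) = n"
  using turan_sizes_sum[of r n] by (simp add: turan_sizes_def sum_list_sum_nth lessThan_atLeast0)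

lemma pverts_turan_graph_not_empty: "0 < r \<Longrightarrow> 0 < n \<Longrightarrow> pverts (turan_graph r n) \<noteq> {}"
  using card_turan_graph[of r n] by auto

lemma finite_pverts_turan_graph: "finite (pverts (turan_graph r n))"
  by (simp add: pverts_turan_graph)

lemma graph_turan_graph: "graph (with_proj (turan_graph r n))"
proof -
  interpret pair_graph "turan_graph r n"
    unfolding turan_graph_def by (rule pair_graph_complete_multipartite)
  show ?thesis by unfold_locales
qed

lemma largest_eigenvalue_turan_graph:
  assumes "0 < r" "0 < n"
  shows "largest_eigenvalue (with_proj (turan_graph r n)) =
    spectral_radius (cross_class fst) (pverts (turan_graph r n))"
proof -
  have "largest_eigenvalue (with_proj (turan_graph r n)) =
      spectral_radius (dominates (with_proj (turan_graph r n))) (pverts (turan_graph r n))"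
    using largest_eigenvalue_eq_spectral_radius[OF graph_turan_graph]
      pverts_turan_graph_not_empty[OF assms] by simp
  also have "\<dots> = spectral_radius (cross_class fst) (pverts (turan_graph r n))"
    by (rule spectral_radius_cong)
      (simp add: cross_class_def turan_graph_def complete_multipartite_def Let_def)
  finally show ?thesis .
qed

lemma sum_squares_turan_part_sizes_le:
  assumes "0 < r"
  shows "(\<Sum>i<r. (real ((n + i) div r))\<^sup>2) \<le> (real n)\<^sup>2 / real r + real r"
proof -
  let ?m = "\<lambda>i. real ((n + i) div r)"
  have deviation: "(?m i - real n / real r)\<^sup>2 \<le> 1" if "i < r" for i
  proof -
    have "real n = real r * real (n div r) + real (n mod r)"
      by (metis mult_div_mod_eq of_nat_add of_nat_mult)
    then have "real n / real r = real (n div r) + real (n mod r) / real r"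
      using assms by (simp add: field_simps)
    moreover have "0 \<le> real (n mod r) / real r" "real (n mod r) / real r \<le> 1" using assms by auto
    ultimately have "\<bar>?m i - real n / real r\<bar> \<le> 1"
      using turan_part_size_cases[OF that, of n] by auto
    then show ?thesis by (simp add: abs_square_le_1)
  qed
  have "(\<Sum>i<r. ?m i) = real n" using sum_turan_part_sizes[OF assms, of n] by (metis of_nat_sum)
  then have "(\<Sum>i<r. (?m i - real n / real r)\<^sup>2) =
      (\<Sum>i<r. (?m i)\<^sup>2) - 2 * (real n / real r) * real n + real r * (real n / real r)\<^sup>2"
    by (simp add: power2_diff sum.distrib sum_subtractf sum_distrib_left[symmetric]
        sum_distrib_right[symmetric] sum_divide_distrib[symmetric] mult_ac)
  moreover have "(\<Sum>i<r. (?m i - real n / real r)\<^sup>2) \<le> (\<Sum>i<r. 1)"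
    by (intro sum_mono) (simp add: deviation)
  moreover have
    "2 * (real n / real r) * real n - real r * (real n / real r)\<^sup>2 = (real n)\<^sup>2 / real r"
    using assms by (simp add: power2_eq_square field_simps)
  ultimately show ?thesis by simp
qed

lemma largest_eigenvalue_turan_graph_ge:
  assumes "0 < r" "0 < n"
  shows "(1 - 1 / real r) * real n - real r / real n \<le> largest_eigenvalue (with_proj (turan_graph r n))"
proof -
  let ?V = "pverts (turan_graph r n)"
  let ?m = "\<lambda>i. real ((n + i) div r)"
  have card_V: "card ?V = n" using card_turan_graph[OF assms(1)] .
  have classes: "fst ` ?V \<subseteq> {..<r}" by (auto simp: pverts_turan_graph)
  have sum_m: "(\<Sum>i<r. ?m i) = real n"
    using sum_turan_part_sizes[OF assms(1), of n] by (metis of_nat_sum)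
  have "quad_form (cross_class fst) ?V (\<lambda>_. 1) = (\<Sum>u\<in>?V. real n - real (class_size ?V fst (fst u)))"
    unfolding quad_form_def sum_nbrs_cross_class[OF finite_pverts_turan_graph]
    by (simp add: class_size_def card_V)
  also have "\<dots> = (\<Sum>i<r. ?m i * (real n - ?m i))"
    using sum_classes[OF finite_pverts_turan_graph classes,
        of "\<lambda>i. real n - real (class_size ?V fst i)"]
    by (simp add: class_size_turan_graph)
  also have "\<dots> = (real n)\<^sup>2 - (\<Sum>i<r. (?m i)\<^sup>2)"
    by (simp add: right_diff_distrib sum_subtractf sum_distrib_right[symmetric] sum_m power2_eq_square)
  finally have
    "(real n)\<^sup>2 - ((real n)\<^sup>2 / real r + real r) \<le> quad_form (cross_class fst) ?V (\<lambda>_. 1)"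
    using sum_squares_turan_part_sizes_le[OF assms(1), of n] by simp
  also have "\<dots> \<le> largest_eigenvalue (with_proj (turan_graph r n)) * real n"
    using quad_form_le_spectral_radius[OF finite_pverts_turan_graph, of "cross_class fst" r n "\<lambda>_. 1"]
    by (simp add: largest_eigenvalue_turan_graph[OF assms] card_V)
  finally show ?thesis using assms by (simp add: power2_eq_square field_simps)
qed

theorem (in adjacency) spectral_turan:
  assumes "finite S" "S \<noteq> {}" "0 < r" "cliques E S (Suc r) = {}"
  shows "spectral_radius E S \<le> largest_eigenvalue (with_proj (turan_graph r (card S)))"
proof -
  define n where "n = card S"
  let ?T = "pverts (turan_graph r n)"
  let ?\<mu> = "spectral_radius E S"
  have n_pos: "0 < n" using assms(1,2) by (simp add: n_def card_gt_0_iff)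
  note T_not_empty = pverts_turan_graph_not_empty[OF assms(3) n_pos]
  have T_classes: "fst ` ?T \<subseteq> {..<r}" by (auto simp: pverts_turan_graph)
  have "?\<mu> \<le> spectral_radius (cross_class fst) ?T"
  proof (cases "0 < ?\<mu>")
    case False
    then show ?thesis
      using adjacency.spectral_radius_nonneg[OF adjacency_cross_class finite_pverts_turan_graph T_not_empty]
      by (meson not_less order_trans)
  next
    case True
    obtain p where colouring: "p ` S \<subseteq> {..<r}" "?\<mu> \<le> spectral_radius (cross_class p) S"
      using spectral_radius_le_cross_class[OF assms(1,2,4)] by blast
    let ?k = "class_size S p" and ?m = "class_size ?T fst"
    have "1 \<le> (\<Sum>i<r. real (?k i) / (?\<mu> + real (?k i)))"
      using le_spectral_radius_cross_class_iff[OF assms(1,2) colouring(1) True] colouring(2)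
      by blast
    also have "\<dots> \<le> (\<Sum>i<r. real (?m i) / (?\<mu> + real (?m i)))"
    proof (rule sum_ratio_le_balanced[OF True])
      show "?m i = n div r \<or> ?m i = Suc (n div r)" if "i < r" for i
        using turan_part_size_cases[OF that] class_size_turan_graph[OF that] by simp
      show "(\<Sum>i<r. ?k i) = (\<Sum>i<r. ?m i)"
        using sum_class_size[OF assms(1) colouring(1)]
          sum_class_size[OF finite_pverts_turan_graph T_classes]
        by (simp add: card_turan_graph[OF assms(3)] n_def)
    qed
    finally show ?thesis
      using le_spectral_radius_cross_class_iff[OF finite_pverts_turan_graph T_not_empty T_classes True]
      by blast
  qed
  then show ?thesis
    unfolding largest_eigenvalue_turan_graph[OF assms(3) n_pos, symmetric] by (simp add: n_def)
qed

section \<open>Cliques weighted by the principal eigenvector\<close>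

definition common_nbrs :: "('a \<Rightarrow> 'a \<Rightarrow> bool) \<Rightarrow> 'a set \<Rightarrow> 'a set \<Rightarrow> 'a set" where
  "common_nbrs E S A = {v \<in> S. \<forall>a\<in>A. E a v}"

definition insert_nth :: "nat \<Rightarrow> 'a \<Rightarrow> 'a list \<Rightarrow> 'a list" where
  "insert_nth i v xs = take i xs @ v # drop i xs"

definition delete_nth :: "nat \<Rightarrow> 'a list \<Rightarrow> 'a list" where
  "delete_nth i xs = take i xs @ drop (Suc i) xs"

definition clique_weight :: "('a \<Rightarrow> 'a \<Rightarrow> bool) \<Rightarrow> 'a set \<Rightarrow> ('a \<Rightarrow> real) \<Rightarrow> nat \<Rightarrow> real" where
  "clique_weight E S x k = (\<Sum>xs\<in>cliques E S k. prod_list (map x xs))"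

definition spectral_density :: "('a \<Rightarrow> 'a \<Rightarrow> bool) \<Rightarrow> 'a set \<Rightarrow> real" where
  "spectral_density E S = spectral_radius E S / real (card S)"

lemma finite_common_nbrs: "finite S \<Longrightarrow> finite (common_nbrs E S A)"
  by (simp add: common_nbrs_def)

lemma common_nbrs_subset: "common_nbrs E S A \<subseteq> S"
  by (auto simp: common_nbrs_def)

lemma delete_nth_insert_nth: "i \<le> length xs \<Longrightarrow> delete_nth i (insert_nth i v xs) = xs"
  by (simp add: insert_nth_def delete_nth_def min_def)

lemma nth_insert_nth: "i \<le> length xs \<Longrightarrow> insert_nth i v xs ! i = v"
  by (simp add: insert_nth_def nth_append min_def)

lemma insert_nth_delete_nth: "i < length xs \<Longrightarrow> insert_nth i (xs ! i) (delete_nth i xs) = xs"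
  by (simp add: insert_nth_def delete_nth_def id_take_nth_drop[symmetric])

lemma prod_list_insert_nth:
  fixes x :: "'a \<Rightarrow> 'b :: comm_monoid_mult"
  shows "prod_list (map x (insert_nth i v xs)) = x v * prod_list (map x xs)"
proof -
  have "prod_list (map x xs) = prod_list (map x (take i xs)) * prod_list (map x (drop i xs))"
    by (metis append_take_drop_id map_append prod_list.append)
  then show ?thesis by (simp add: insert_nth_def mult_ac)
qed

lemma prod_list_map_nonneg:
  fixes x :: "'a \<Rightarrow> 'b :: linordered_semidom"
  shows "(\<And>v. v \<in> set xs \<Longrightarrow> 0 \<le> x v) \<Longrightarrow> 0 \<le> prod_list (map x xs)"
  by (induction xs) auto

lemma nth_in_set_delete_nth:
  assumes "j < length xs" "i \<noteq> j"
  shows "xs ! j \<in> set (delete_nth i xs)"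
proof (cases "j < i")
  case True
  then have "xs ! j \<in> set (take i xs)"
    using assms(1) by (auto simp: in_set_conv_nth intro!: exI[of _ j])
  then show ?thesis by (simp add: delete_nth_def)
next
  case False
  then have "xs ! j \<in> set (drop (Suc i) xs)"
    using assms by (auto simp: in_set_conv_nth intro!: exI[of _ "j - Suc i"])
  then show ?thesis by (simp add: delete_nth_def)
qed

lemma card_delete_nth_Ball_le:
  "card {i. i < length xs \<and> (\<forall>w\<in>set (delete_nth i xs). P w)} \<le>
    (if \<forall>w\<in>set xs. P w then length xs else 1)" (is "card ?I \<le> _")
proof (cases "\<forall>w\<in>set xs. P w")
  case True
  have "card ?I \<le> card {..<length xs}" by (rule card_mono) auto
  then show ?thesis using True by simp
next
  case False
  then obtain j where counterexample: "j < length xs" "\<not> P (xs ! j)" by (metis in_set_conv_nth)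
  then have "?I \<subseteq> {j}" using nth_in_set_delete_nth[OF counterexample(1)] by blast
  then have "card ?I \<le> card {j}" by (intro card_mono) auto
  then show ?thesis unfolding if_not_P[OF False] by simp
qed

lemma sum_common_nbrs_delete_nth_le:
  fixes x :: "'a \<Rightarrow> real"
  assumes finite: "finite S" and nonneg: "\<And>v. v \<in> S \<Longrightarrow> 0 \<le> x v" and length_zs: "length zs = Suc k"
  shows "(\<Sum>i<Suc k. sum x (common_nbrs E S (set (delete_nth i zs))))
    \<le> sum x S + real k * sum x (common_nbrs E S (set zs))"
proof -
  define I where "I y = {i. i < length zs \<and> (\<forall>w\<in>set (delete_nth i zs). E w y)}" for y
  have sum_common_nbrs: "sum x (common_nbrs E S A) = (\<Sum>y\<in>S. if \<forall>a\<in>A. E a y then x y else 0)" for A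
    unfolding common_nbrs_def by (rule sum.inter_filter[OF finite])
  have "(\<Sum>i<Suc k. sum x (common_nbrs E S (set (delete_nth i zs)))) =
      (\<Sum>y\<in>S. \<Sum>i<Suc k. if \<forall>w\<in>set (delete_nth i zs). E w y then x y else 0)"
    unfolding sum_common_nbrs by (rule sum.swap)
  also have "\<dots> = (\<Sum>y\<in>S. x y * real (card (I y)))"
  proof (rule sum.cong[OF refl])
    fix y
    have "(\<Sum>i<Suc k. if \<forall>w\<in>set (delete_nth i zs). E w y then x y else 0) = sum (\<lambda>_. x y) (I y)"
      unfolding I_def length_zs by (subst sum.inter_filter[symmetric]) (auto intro!: sum.cong)
    then show
      "(\<Sum>i<Suc k. if \<forall>w\<in>set (delete_nth i zs). E w y then x y else 0) = x y * real (card (I y))"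
      by simp
  qed
  also have "\<dots> \<le> (\<Sum>y\<in>S. x y + real k * (if \<forall>w\<in>set zs. E w y then x y else 0))"
  proof (rule sum_mono)
    fix y assume "y \<in> S"
    have "card (I y) \<le> (if \<forall>w\<in>set zs. E w y then Suc k else 1)"
      using card_delete_nth_Ball_le[of zs "\<lambda>w. E w y"] by (simp only: I_def length_zs)
    then have "real (card (I y)) \<le> (if \<forall>w\<in>set zs. E w y then real (Suc k) else 1)"
      by (simp split: if_splits)
    from mult_left_mono[OF this nonneg[OF \<open>y \<in> S\<close>]]
    show "x y * real (card (I y)) \<le> x y + real k * (if \<forall>w\<in>set zs. E w y then x y else 0)"
      by (auto simp: algebra_simps split: if_splits)
  qed
  also have "\<dots> = sum x S + real k * sum x (common_nbrs E S (set zs))"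
    by (simp add: sum.distrib sum_common_nbrs sum_distrib_left[symmetric])
  finally show ?thesis .
qed

lemma sum_principal_vector_square_le:
  assumes "principal_vector E S x"
  shows "(sum x S)\<^sup>2 \<le> real (card S)"
  using Cauchy_Schwarz_ineq_sum[of "\<lambda>_. 1" x S] assms by (simp add: principal_vector_def)

lemma spectral_radius_mult_entry_le:
  assumes "finite S" "principal_vector E S x" "v \<in> S"
  shows "spectral_radius E S * x v \<le> sum x S"
proof -
  have "spectral_radius E S * x v = sum x (nbrs E S v)"
    using assms by (simp add: principal_vector_def)
  also have "\<dots> \<le> sum x S"
    using assms by (intro sum_mono2 nbrs_subset) (auto simp: principal_vector_def)
  finally show ?thesis .
qed

lemma clique_weight_Suc_0: "clique_weight E S x (Suc 0) = sum x S"
  by (simp add: clique_weight_def cliques_Suc_0 sum.reindex inj_on_def)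

context adjacency
begin

lemma insert_nth_in_cliques_iff:
  assumes "length ys = k" "i \<le> k"
  shows "insert_nth i v ys \<in> cliques E S (Suc k) \<longleftrightarrow>
    ys \<in> cliques E S k \<and> v \<in> common_nbrs E S (set ys)"
proof -
  obtain as bs where ys_split: "ys = as @ bs" "as = take i ys" "bs = drop i ys"
    by (metis append_take_drop_id)
  have "as @ v # bs \<in> cliques E S (Suc k) \<longleftrightarrow>
      as @ bs \<in> cliques E S k \<and> v \<in> common_nbrs E S (set (as @ bs))"
    using assms ys_split(1) by (auto simp: cliques_def common_nbrs_def sorted_wrt_append intro: sym)
  then show ?thesis using ys_split by (metis insert_nth_def)
qed

lemma Cons_in_cliques_iff:
  "v # xs \<in> cliques E S (Suc k) \<longleftrightarrow> xs \<in> cliques E S k \<and> v \<in> common_nbrs E S (set xs)"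
  by (auto simp: cliques_def common_nbrs_def intro: sym)

lemma sum_cliques_Suc:
  fixes f :: "'a list \<Rightarrow> 'b :: comm_monoid_add"
  assumes finite: "finite S" and i_le: "i \<le> k"
  shows "sum f (cliques E S (Suc k)) =
    (\<Sum>ys\<in>cliques E S k. \<Sum>v\<in>common_nbrs E S (set ys). f (insert_nth i v ys))"
proof -
  let ?pairs = "SIGMA ys:cliques E S k. common_nbrs E S (set ys)"
  have "sum f (cliques E S (Suc k)) = (\<Sum>(ys, v)\<in>?pairs. f (insert_nth i v ys))"
  proof (rule sum.reindex_bij_witness[where
        i = "\<lambda>(ys, v). insert_nth i v ys" and j = "\<lambda>zs. (delete_nth i zs, zs ! i)"])
    fix zs assume zs_clique: "zs \<in> cliques E S (Suc k)"
    then have "length zs = Suc k" by (simp add: cliques_def)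
    then have lengths: "i < length zs" "length (delete_nth i zs) = k"
      using i_le by (simp_all add: delete_nth_def)
    then show "(delete_nth i zs, zs ! i) \<in> ?pairs"
      using insert_nth_in_cliques_iff[OF lengths(2) i_le, of "zs ! i"] zs_clique
      by (simp add: insert_nth_delete_nth)
    show "(case (delete_nth i zs, zs ! i) of (ys, v) \<Rightarrow> insert_nth i v ys) = zs"
      "(case (delete_nth i zs, zs ! i) of (ys, v) \<Rightarrow> f (insert_nth i v ys)) = f zs"
      using lengths(1) by (simp_all add: insert_nth_delete_nth)
  next
    fix p assume "p \<in> ?pairs"
    then obtain ys v where p_pair: "p = (ys, v)" "ys \<in> cliques E S k" "v \<in> common_nbrs E S (set ys)"
      by blast
    then have lengths: "length ys = k" by (simp add: cliques_def)
    then show "(case p of (ys, v) \<Rightarrow> insert_nth i v ys) \<in> cliques E S (Suc k)"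
      using insert_nth_in_cliques_iff[OF lengths i_le] p_pair by simp
    show "(delete_nth i (case p of (ys, v) \<Rightarrow> insert_nth i v ys),
        (case p of (ys, v) \<Rightarrow> insert_nth i v ys) ! i) = p"
      using lengths i_le by (simp add: p_pair(1) delete_nth_insert_nth nth_insert_nth)
  qed
  also have "\<dots> = (\<Sum>ys\<in>cliques E S k. \<Sum>v\<in>common_nbrs E S (set ys). f (insert_nth i v ys))"
    using finite by (subst sum.Sigma) (auto simp: finite_cliques finite_common_nbrs)
  finally show ?thesis .
qed

lemma clique_weight_Suc:
  assumes "finite S"
  shows "clique_weight E S x (Suc k) =
    (\<Sum>ys\<in>cliques E S k. prod_list (map x ys) * sum x (common_nbrs E S (set ys)))"
  unfolding clique_weight_def sum_cliques_Suc[OF assms le0] prod_list_insert_nth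
  by (simp add: sum_distrib_right[symmetric] mult.commute)

lemma clique_weight_Suc_Suc_0:
  assumes "finite S" "principal_vector E S x"
  shows "clique_weight E S x (Suc (Suc 0)) = spectral_radius E S"
proof -
  have "common_nbrs E S {v} = nbrs E S v" for v by (auto simp: common_nbrs_def nbrs_def)
  then have "clique_weight E S x (Suc (Suc 0)) = quad_form E S x"
    unfolding clique_weight_Suc[OF assms(1)] quad_form_def
    by (simp add: cliques_Suc_0 sum.reindex inj_on_def)
  then show ?thesis by (simp add: quad_form_principal_vector[OF assms(2)])
qed

lemma sum_cliques_delete_nth:
  fixes x :: "'a \<Rightarrow> real"
  assumes finite: "finite S" and i_le: "i \<le> k"
  shows "(\<Sum>zs\<in>cliques E S (Suc k). prod_list (map x zs) * sum x (common_nbrs E S (set (delete_nth i zs))))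
    = (\<Sum>ys\<in>cliques E S k. prod_list (map x ys) * (sum x (common_nbrs E S (set ys)))\<^sup>2)"
  unfolding sum_cliques_Suc[OF finite i_le]
proof (rule sum.cong[OF refl])
  fix ys assume "ys \<in> cliques E S k"
  then have "i \<le> length ys" using i_le by (simp add: cliques_def)
  then show "(\<Sum>v\<in>common_nbrs E S (set ys). prod_list (map x (insert_nth i v ys)) *
      sum x (common_nbrs E S (set (delete_nth i (insert_nth i v ys))))) =
    prod_list (map x ys) * (sum x (common_nbrs E S (set ys)))\<^sup>2"
    by (simp add: prod_list_insert_nth delete_nth_insert_nth sum_distrib_right[symmetric]
        power2_eq_square)
qed

lemma weighted_moon_moser:
  assumes finite: "finite S" and nonneg: "\<And>v. v \<in> S \<Longrightarrow> 0 \<le> x v"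
  shows "real (Suc k) * (clique_weight E S x (Suc k))\<^sup>2 \<le>
    (real k * clique_weight E S x (Suc (Suc k)) + sum x S * clique_weight E S x (Suc k))
      * clique_weight E S x k"
proof -
  let ?F = "clique_weight E S x"
  define w where "w ys = prod_list (map x ys)" for ys
  define d where "d ys = sum x (common_nbrs E S (set ys))" for ys
  define Q where "Q = (\<Sum>ys\<in>cliques E S k. w ys * (d ys)\<^sup>2)"
  have clique_weights: "?F j = sum w (cliques E S j)"
    "?F (Suc j) = (\<Sum>ys\<in>cliques E S j. w ys * d ys)" for j
    unfolding w_def d_def by (simp only: clique_weight_def) (rule clique_weight_Suc[OF finite])
  have w_nonneg: "0 \<le> w ys" if "ys \<in> cliques E S j" for ys j
    unfolding w_def using that nonneg by (intro prod_list_map_nonneg) (auto simp: cliques_def)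
  have "real (Suc k) * Q = (\<Sum>i<Suc k. \<Sum>zs\<in>cliques E S (Suc k). w zs * d (delete_nth i zs))"
    unfolding Q_def w_def d_def
    by (simp add: sum_cliques_delete_nth[OF finite] del: sum.lessThan_Suc)
  also have "\<dots> = (\<Sum>zs\<in>cliques E S (Suc k). w zs * (\<Sum>i<Suc k. d (delete_nth i zs)))"
    unfolding sum_distrib_left by (rule sum.swap)
  also have "\<dots> \<le> (\<Sum>zs\<in>cliques E S (Suc k). w zs * (sum x S + real k * d zs))"
    unfolding d_def using sum_common_nbrs_delete_nth_le[OF finite nonneg] w_nonneg
    by (intro sum_mono mult_left_mono) (auto simp: cliques_def)
  also have "\<dots> = real k * ?F (Suc (Suc k)) + sum x S * ?F (Suc k)"
    unfolding clique_weights(2)[of "Suc k"] clique_weights(1)[of "Suc k"]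
    by (simp add: algebra_simps sum.distrib sum_distrib_left)
  finally have Q_le: "real (Suc k) * Q \<le> real k * ?F (Suc (Suc k)) + sum x S * ?F (Suc k)" .
  have "(?F (Suc k))\<^sup>2 = (\<Sum>ys\<in>cliques E S k. sqrt (w ys) * (sqrt (w ys) * d ys))\<^sup>2"
    unfolding clique_weights(2) using w_nonneg
    by (intro arg_cong[where f = "\<lambda>z. z\<^sup>2"] sum.cong) (auto simp: mult.assoc[symmetric])
  also have "\<dots> \<le> (\<Sum>ys\<in>cliques E S k. (sqrt (w ys))\<^sup>2) * (\<Sum>ys\<in>cliques E S k. (sqrt (w ys) * d ys)\<^sup>2)"
    by (rule Cauchy_Schwarz_ineq_sum)
  also have "\<dots> = ?F k * Q"
    unfolding clique_weights(1) Q_def using w_nonneg by (simp add: power_mult_distrib)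
  finally have "real (Suc k) * (?F (Suc k))\<^sup>2 \<le> (real (Suc k) * Q) * ?F k"
    by (simp add: mult.assoc mult.commute[of Q] mult_left_mono)
  also have "\<dots> \<le> (real k * ?F (Suc (Suc k)) + sum x S * ?F (Suc k)) * ?F k"
    using Q_le w_nonneg by (intro mult_right_mono) (auto simp: clique_weights(1) intro: sum_nonneg)
  finally show ?thesis .
qed

end

lemma moon_moser_ratio_step:
  fixes a b c k \<sigma> X :: real
  assumes pos: "0 < a" "0 < b" "0 < k" and ratio: "(1 - k * \<sigma>) * X * a \<le> b"
    and moon_moser: "(k + 1) * b\<^sup>2 \<le> (k * c + X * b) * a"
  shows "(1 - (k + 1) * \<sigma>) * X * b \<le> c"
proof -
  have "((k + 1) * b * (1 - k * \<sigma>) * X) * a = (k + 1) * b * ((1 - k * \<sigma>) * X * a)"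
    by (simp only: mult_ac)
  also have "\<dots> \<le> (k + 1) * b * b" using ratio pos by (intro mult_left_mono) auto
  also have "\<dots> \<le> (k * c + X * b) * a" using moon_moser by (simp add: power2_eq_square mult.assoc)
  finally have "(k + 1) * b * (1 - k * \<sigma>) * X \<le> k * c + X * b" using pos(1) by simp
  then have "k * ((1 - (k + 1) * \<sigma>) * X * b) \<le> k * c" by (simp add: algebra_simps)
  then show ?thesis using pos(3) by simp
qed

lemma of_nat_mult_less_one:
  fixes \<sigma> :: real
  assumes "real r * \<sigma> < 1" "k \<le> r"
  shows "real k * \<sigma> < 1"
proof (cases "0 \<le> \<sigma>")
  case True
  then have "real k * \<sigma> \<le> real r * \<sigma>" using assms(2) by (intro mult_right_mono) auto
  then show ?thesis using assms(1) by simp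
next
  case False
  then have "real k * \<sigma> \<le> 0" by (simp add: mult_nonneg_nonpos)
  then show ?thesis by simp
qed

context adjacency
begin

lemma clique_weight_ratio:
  assumes finite: "finite S" and principal: "principal_vector E S x"
    and deficit: "\<sigma> = 1 - spectral_density E S" "real r * \<sigma> < 1" and k_less: "k < r"
  shows "0 < clique_weight E S x (Suc k) \<and>
    (1 - real (Suc k) * \<sigma>) * sum x S * clique_weight E S x (Suc k) \<le> clique_weight E S x (Suc (Suc k))"
  using k_less
proof (induction k)
  case 0
  have "S \<noteq> {}" using principal by (auto simp: principal_vector_def)
  then have "spectral_radius E S = (1 - \<sigma>) * real (card S)"
    using finite by (simp add: deficit(1) spectral_density_def)
  moreover have "(1 - \<sigma>) * (sum x S)\<^sup>2 \<le> (1 - \<sigma>) * real (card S)"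
    using sum_principal_vector_square_le[OF principal] of_nat_mult_less_one[OF deficit(2), of 1] 0
    by (intro mult_left_mono) auto
  ultimately show ?case
    using sum_principal_vector_pos[OF finite principal]
    by (simp add: clique_weight_Suc_0 clique_weight_Suc_Suc_0[OF finite principal] power2_eq_square mult.assoc)
next
  case (Suc k)
  let ?F = "clique_weight E S x"
  have IH: "0 < ?F (Suc k)" "(1 - real (Suc k) * \<sigma>) * sum x S * ?F (Suc k) \<le> ?F (Suc (Suc k))"
    using Suc by auto
  have "0 < (1 - real (Suc k) * \<sigma>) * sum x S * ?F (Suc k)"
    using of_nat_mult_less_one[OF deficit(2), of "Suc k"] Suc.prems IH(1)
      sum_principal_vector_pos[OF finite principal]
    by (intro mult_pos_pos) auto
  then have pos: "0 < ?F (Suc (Suc k))" using IH(2) by (rule less_le_trans)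
  have "real (Suc k) + 1 = real (Suc (Suc k))" by simp
  moreover have "0 \<le> x v" if "v \<in> S" for v using principal that by (simp add: principal_vector_def)
  ultimately show ?case
    using moon_moser_ratio_step[OF IH(1) pos _ IH(2)] weighted_moon_moser[OF finite, of x "Suc k"] pos
    by simp
qed

lemma clique_weight_ge:
  assumes "finite S" "principal_vector E S x"
    and deficit: "\<sigma> = 1 - spectral_density E S" "real r * \<sigma> < 1" and "k \<le> r"
  shows "sum x S ^ Suc k * (\<Prod>j\<le>k. 1 - real j * \<sigma>) \<le> clique_weight E S x (Suc k)"
  using assms(5)
proof (induction k)
  case 0
  then show ?case by (simp add: clique_weight_Suc_0)
next
  case (Suc k)
  let ?p = "1 - real (Suc k) * \<sigma>"
  have "sum x S ^ Suc (Suc k) * (\<Prod>j\<le>Suc k. 1 - real j * \<sigma>) =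
      ?p * sum x S * (sum x S ^ Suc k * (\<Prod>j\<le>k. 1 - real j * \<sigma>))"
    by (simp only: prod.atMost_Suc power_Suc mult_ac)
  also have "\<dots> \<le> ?p * sum x S * clique_weight E S x (Suc k)"
    using Suc of_nat_mult_less_one[OF deficit(2), of "Suc k"]
      sum_principal_vector_pos[OF assms(1,2)]
    by (intro mult_left_mono) auto
  also have "\<dots> \<le> clique_weight E S x (Suc (Suc k))"
    using clique_weight_ratio[OF assms(1-4)] Suc.prems by simp
  finally show ?case .
qed

text \<open>The entries of the eigenvector are at most their sum divided by the spectral radius, so that the sum
  cancels when the weighted count is turned into a count.\<close>

lemma spectral_radius_power_mult_clique_weight_le:
  assumes finite: "finite S" and principal: "principal_vector E S x"
  shows "spectral_radius E S ^ k * clique_weight E S x k \<le> sum x S ^ k * real (card (cliques E S k))"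
proof -
  let ?\<mu> = "spectral_radius E S"
  have "S \<noteq> {}" using principal by (auto simp: principal_vector_def)
  then have radius: "0 \<le> ?\<mu>" by (rule spectral_radius_nonneg[OF finite])
  have nonneg: "0 \<le> x v" if "v \<in> S" for v using principal that by (simp add: principal_vector_def)
  have "?\<mu> ^ length xs * prod_list (map x xs) \<le> sum x S ^ length xs" if "set xs \<subseteq> S" for xs
    using that
  proof (induction xs)
    case (Cons v xs)
    have "(?\<mu> * x v) * (?\<mu> ^ length xs * prod_list (map x xs)) \<le> sum x S * sum x S ^ length xs"
    proof (rule mult_mono)
      show "?\<mu> * x v \<le> sum x S"
        using spectral_radius_mult_entry_le[OF finite principal] Cons.prems by simp
      show "0 \<le> ?\<mu> ^ length xs * prod_list (map x xs)"
        using Cons.prems nonneg radius by (intro mult_nonneg_nonneg prod_list_map_nonneg) auto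
    qed (use Cons nonneg in \<open>auto intro: sum_nonneg\<close>)
    then show ?case by (simp add: mult_ac)
  qed simp
  then have "?\<mu> ^ k * prod_list (map x xs) \<le> sum x S ^ k" if "xs \<in> cliques E S k" for xs
    using that unfolding cliques_def by blast
  then have "(\<Sum>xs\<in>cliques E S k. ?\<mu> ^ k * prod_list (map x xs)) \<le> (\<Sum>xs\<in>cliques E S k. sum x S ^ k)"
    by (rule sum_mono)
  then show ?thesis by (simp add: clique_weight_def sum_distrib_left mult.commute)
qed

theorem card_cliques_spectral_ge:
  assumes "finite S" "S \<noteq> {}"
    and deficit: "\<sigma> = 1 - spectral_density E S" "real r * \<sigma> < 1"
  shows "spectral_radius E S ^ Suc r * (\<Prod>k\<le>r. 1 - real k * \<sigma>) \<le> real (card (cliques E S (Suc r)))"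
proof -
  let ?\<mu> = "spectral_radius E S"
  obtain x where principal: "principal_vector E S x"
    using principal_vector_exists[OF assms(1,2)] by blast
  have pos: "0 < sum x S" by (rule sum_principal_vector_pos[OF assms(1) principal])
  have "sum x S ^ Suc r * (?\<mu> ^ Suc r * (\<Prod>k\<le>r. 1 - real k * \<sigma>)) =
      ?\<mu> ^ Suc r * (sum x S ^ Suc r * (\<Prod>k\<le>r. 1 - real k * \<sigma>))"
    by (simp only: mult_ac)
  also have "\<dots> \<le> ?\<mu> ^ Suc r * clique_weight E S x (Suc r)"
    using clique_weight_ge[OF assms(1) principal deficit order_refl]
      spectral_radius_nonneg[OF assms(1,2)]
    by (intro mult_left_mono) auto
  also have "\<dots> \<le> sum x S ^ Suc r * real (card (cliques E S (Suc r)))"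
    by (rule spectral_radius_power_mult_clique_weight_le[OF assms(1) principal])
  finally show ?thesis using pos by (simp only: mult_le_cancel_left_pos zero_less_power)
qed

end

lemma prod_one_minus_ge:
  fixes \<sigma> :: real
  assumes r_pos: "0 < r" and deficit_le: "real r * \<sigma> \<le> 1"
  shows "fact r / real r ^ r * (1 - real r * \<sigma>) \<le> (\<Prod>k\<le>r. 1 - real k * \<sigma>)"
proof -
  have "fact r / real r ^ r = (\<Prod>k<r. 1 - real k / real r)"
  proof -
    have "(\<Prod>k<r. 1 - real k / real r) = (\<Prod>k<r. real (r - k) / real r)"
      using r_pos by (intro prod.cong) (auto simp: field_simps of_nat_diff)
    also have "\<dots> = real (\<Prod>k<r. r - k) / real r ^ r" by (simp add: prod_dividef)
    also have "(\<Prod>k<r. r - k) = fact r" by (simp add: fact_prod_rev lessThan_atLeast0)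
    finally show ?thesis by simp
  qed
  also have "\<dots> \<le> (\<Prod>k<r. 1 - real k * \<sigma>)"
  proof (intro prod_mono conjI)
    fix k assume k_less: "k \<in> {..<r}"
    show "0 \<le> 1 - real k / real r" using k_less r_pos by (simp add: field_simps)
    have "\<sigma> \<le> 1 / real r" using deficit_le r_pos by (simp add: field_simps)
    then have "real k * \<sigma> \<le> real k * (1 / real r)" by (intro mult_left_mono) auto
    then show "1 - real k / real r \<le> 1 - real k * \<sigma>" by simp
  qed
  finally have "fact r / real r ^ r * (1 - real r * \<sigma>) \<le> (\<Prod>k<r. 1 - real k * \<sigma>) * (1 - real r * \<sigma>)"
    using deficit_le by (intro mult_right_mono) auto
  then show ?thesis by (simp add: lessThan_Suc_atMost[symmetric])
qed

lemma (in adjacency) cliques_not_empty_of_spectral_density: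
  assumes "finite S" "2 \<le> r" and dense: "1 - 1 / real r < spectral_density E S"
  shows "cliques E S (Suc r) \<noteq> {}"
proof -
  define \<sigma> where "\<sigma> = 1 - spectral_density E S"
  have "0 \<le> 1 - 1 / real r" using assms(2) by simp
  then have "0 < spectral_density E S" using dense by (rule le_less_trans)
  then have "S \<noteq> {}" "0 < spectral_radius E S"
    by (auto simp: spectral_density_def zero_less_divide_iff)
  have "\<sigma> < 1 / real r" using dense by (simp add: \<sigma>_def)
  then have deficit_less: "real r * \<sigma> < 1" using assms(2) by (simp add: field_simps)
  have "0 < fact r / real r ^ r * (1 - real r * \<sigma>)"
    using deficit_less assms(2) by (intro mult_pos_pos) auto
  also have "\<dots> \<le> (\<Prod>k\<le>r. 1 - real k * \<sigma>)" using prod_one_minus_ge deficit_less assms(2) by simp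
  finally have "0 < spectral_radius E S ^ Suc r * (\<Prod>k\<le>r. 1 - real k * \<sigma>)"
    using \<open>0 < spectral_radius E S\<close> by (intro mult_pos_pos) auto
  also have "\<dots> \<le> real (card (cliques E S (Suc r)))"
    by (rule card_cliques_spectral_ge[OF assms(1) \<open>S \<noteq> {}\<close> \<sigma>_def deficit_less])
  finally show ?thesis by (intro notI) simp
qed

section \<open>Deleting vertices\<close>

lemma mult_le_one_of_deficit:
  fixes z \<mu> d m \<epsilon> :: real
  assumes entry: "0 \<le> z" "z * (\<mu>\<^sup>2 + d * (m - d)) \<le> d"
    and degree: "0 \<le> d" "d + \<epsilon> / 2 * m \<le> \<mu>" and pos: "0 < \<epsilon>" "0 < m"
  shows "z * ((1 + \<epsilon>) * m) \<le> 1"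
proof (cases "d = 0")
  case True
  have "0 < \<epsilon> / 2 * m" using pos by simp
  then have "0 < \<mu>" using degree(2) True by simp
  then have "z = 0" using entry True by (simp add: mult_le_0_iff not_le)
  then show ?thesis by simp
next
  case False
  have "0 < \<epsilon> / 2 * m" using pos by simp
  then have "d \<le> \<mu>" using degree(2) by linarith
  then have "(\<epsilon> / 2 * m) * (2 * d) \<le> (\<mu> - d) * (\<mu> + d)"
    using degree by (intro mult_mono) auto
  then have "((1 + \<epsilon>) * m) * d \<le> \<mu>\<^sup>2 + d * (m - d)"
    by (simp add: power2_eq_square algebra_simps)
  then have "z * (((1 + \<epsilon>) * m) * d) \<le> z * (\<mu>\<^sup>2 + d * (m - d))"
    using entry(1) by (rule mult_left_mono)
  also have "\<dots> \<le> d" by (rule entry(2))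
  finally have "(z * ((1 + \<epsilon>) * m)) * d \<le> 1 * d" by simp
  then show ?thesis by (rule mult_right_le_imp_le) (use False degree(1) in simp)
qed

lemma radius_ratio_of_mult_le_one:
  fixes \<mu> \<mu>' z K :: real
  assumes "0 \<le> \<mu>" "2 \<le> K" "z * K \<le> 1" and deleted_radius: "\<mu> * (1 - 2 * z) \<le> \<mu>' * (1 - z)"
  shows "\<mu> * (K - 2) \<le> (K - 1) * \<mu>'"
proof -
  have "z * K < 1 * K" using assms(2,3) by linarith
  then have "z < 1" by (rule mult_right_less_imp_less) (use assms(2) in simp)
  have "(K - 2) * (1 - z) \<le> (K - 1) * (1 - 2 * z)"
    using assms(3) by (simp add: algebra_simps)
  from mult_left_mono[OF this assms(1)]
  have "(\<mu> * (K - 2)) * (1 - z) \<le> (K - 1) * (\<mu> * (1 - 2 * z))" by (simp only: mult_ac)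
  also have "\<dots> \<le> (K - 1) * (\<mu>' * (1 - z))"
    using deleted_radius assms(2) by (intro mult_left_mono) auto
  finally have "(\<mu> * (K - 2)) * (1 - z) \<le> ((K - 1) * \<mu>') * (1 - z)" by (simp only: mult.assoc)
  then show ?thesis using \<open>z < 1\<close> by (simp only: mult_le_cancel_right_pos diff_gt_0_iff_gt)
qed

lemma density_gain_of_radius_ratio:
  fixes \<mu> \<mu>' m \<epsilon> :: real
  defines "K \<equiv> (1 + \<epsilon>) * m"
  assumes ratio: "\<mu> * (K - 2) \<le> (K - 1) * \<mu>'"
    and tolerance: "0 < \<epsilon>" "\<epsilon> \<le> 1 / 10" "10 \<le> \<epsilon> * m" and order_ge: "100 \<le> m"
    and density_ge: "2 / 5 \<le> \<mu> / m"
  shows "\<mu> / m + \<epsilon> / (4 * m) \<le> \<mu>' / (m - 1)"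
proof -
  have K_bounds: "m \<le> K" "K \<le> 11 / 10 * m"
    unfolding K_def using tolerance order_ge by (auto simp: field_simps)
  have "m * (K - 2) = (K - 1) * (m - 1) + (\<epsilon> * m - 1)" unfolding K_def by (simp add: algebra_simps)
  then have "\<mu> * (K - 2) = (\<mu> / m) * ((K - 1) * (m - 1) + (\<epsilon> * m - 1))"
    using order_ge by (simp add: field_simps)
  then have split: "\<mu> * (K - 2) / ((K - 1) * (m - 1)) =
      \<mu> / m + (\<mu> / m) * ((\<epsilon> * m - 1) / ((K - 1) * (m - 1)))"
    using K_bounds order_ge by (simp add: add_divide_distrib distrib_left)
  have "\<epsilon> / (4 * m) \<le> (2 / 5) * ((9 / 10 * (\<epsilon> * m)) / ((11 / 10 * m) * m))"
    using order_ge tolerance by (simp add: field_simps)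
  also have "\<dots> \<le> (\<mu> / m) * ((\<epsilon> * m - 1) / ((K - 1) * (m - 1)))"
  proof (rule mult_mono[OF density_ge frac_le])
    show "(K - 1) * (m - 1) \<le> 11 / 10 * m * m" using K_bounds order_ge by (intro mult_mono) auto
    show "0 < (K - 1) * (m - 1)" using K_bounds order_ge by (intro mult_pos_pos) auto
    show "0 \<le> \<mu> / m" using density_ge by (rule order_trans[rotated]) simp
  qed (use tolerance order_ge in auto)
  finally have "\<mu> / m + \<epsilon> / (4 * m) \<le> \<mu> * (K - 2) / ((K - 1) * (m - 1))" unfolding split by simp
  also have "\<dots> \<le> (K - 1) * \<mu>' / ((K - 1) * (m - 1))"
    using ratio K_bounds order_ge by (intro divide_right_mono) auto
  also have "\<dots> = \<mu>' / (m - 1)" using K_bounds order_ge by simp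
  finally show ?thesis .
qed

context adjacency
begin

lemma minimal_entry_degree_inequality:
  assumes finite: "finite S" and principal: "principal_vector E S x" and w_mem: "w \<in> S"
    and degree: "d = real (card (nbrs E S w))" and minimal_entry: "u \<in> S" "\<And>v. v \<in> S \<Longrightarrow> x u \<le> x v"
  shows "(x u)\<^sup>2 * ((spectral_radius E S)\<^sup>2 + d * (real (card S) - d)) \<le> d"
proof -
  let ?\<mu> = "spectral_radius E S" and ?N = "nbrs E S w"
  have nonneg: "0 \<le> x v" if "v \<in> S" for v using principal that by (simp add: principal_vector_def)
  have radius: "0 \<le> ?\<mu>" using spectral_radius_nonneg[OF finite] w_mem by blast
  have "(?\<mu> * x u)\<^sup>2 \<le> (sum x ?N)\<^sup>2"
    using principal minimal_entry w_mem nonneg radius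
    by (intro power_mono) (auto simp: principal_vector_def intro: mult_left_mono)
  also have "\<dots> \<le> d * (\<Sum>v\<in>?N. (x v)\<^sup>2)"
    using Cauchy_Schwarz_ineq_sum[of "\<lambda>_. 1" x ?N] by (simp add: degree)
  also have "(\<Sum>v\<in>?N. (x v)\<^sup>2) \<le> 1 - (real (card S) - d) * (x u)\<^sup>2"
  proof -
    have "(\<Sum>v\<in>S - ?N. (x u)\<^sup>2) \<le> (\<Sum>v\<in>S - ?N. (x v)\<^sup>2)"
      using minimal_entry nonneg by (intro sum_mono power_mono) auto
    also have "\<dots> = 1 - (\<Sum>v\<in>?N. (x v)\<^sup>2)"
      using finite principal
      by (subst sum_diff[OF finite nbrs_subset]) (simp add: principal_vector_def)
    finally show ?thesis
      using finite
      by (simp add: degree card_Diff_subset finite_nbrs nbrs_subset of_nat_diff card_mono)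
  qed
  finally have "(?\<mu> * x u)\<^sup>2 \<le> d * (1 - (real (card S) - d) * (x u)\<^sup>2)"
    by (simp add: mult_left_mono degree)
  then show ?thesis by (simp add: algebra_simps power_mult_distrib)
qed

lemma spectral_radius_delete:
  assumes finite: "finite S" and principal: "principal_vector E S x" and u_mem: "u \<in> S"
  shows "spectral_radius E S * (1 - 2 * (x u)\<^sup>2) \<le> spectral_radius E (S - {u}) * (1 - (x u)\<^sup>2)"
proof -
  define y where "y v = x v + (if v = u then - x u else 0)" for v
  have y_entries: "y u = 0" "v \<noteq> u \<Longrightarrow> y v = x v" for v by (simp_all add: y_def)
  have "quad_form E S y = quad_form E S x + 2 * (- x u) * sum x (nbrs E S u)"
    unfolding y_def by (rule quad_form_add_at[OF finite u_mem])
  also have "\<dots> = spectral_radius E S * (1 - 2 * (x u)\<^sup>2)"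
    using principal u_mem
    by (simp add: quad_form_principal_vector[OF principal] principal_vector_def
        power2_eq_square algebra_simps)
  finally have "spectral_radius E S * (1 - 2 * (x u)\<^sup>2) = quad_form E S y" by simp
  also have "\<dots> = quad_form E (S - {u}) y"
    using finite u_mem by (simp add: quad_form_eq sum.remove[of S u] y_entries(1) cong: if_cong)
  also have "\<dots> \<le> spectral_radius E (S - {u}) * (\<Sum>v\<in>S - {u}. (y v)\<^sup>2)"
    using finite by (intro quad_form_le_spectral_radius) simp
  also have "(\<Sum>v\<in>S - {u}. (y v)\<^sup>2) = (\<Sum>v\<in>S - {u}. (x v)\<^sup>2)"
    by (intro sum.cong) (auto simp: y_entries(2))
  also have "\<dots> = 1 - (x u)\<^sup>2"
    using principal finite u_mem by (subst sum_diff1) (auto simp: principal_vector_def)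
  finally show ?thesis .
qed

lemma spectral_density_delete:
  fixes \<epsilon> :: real
  assumes finite: "finite S" and w_mem: "w \<in> S"
    and deg: "real (card (nbrs E S w)) \<le> (spectral_density E S - \<epsilon> / 2) * real (card S)"
    and density: "2 / 5 \<le> spectral_density E S"
    and tolerance: "0 < \<epsilon>" "\<epsilon> \<le> 1 / 10" "10 \<le> \<epsilon> * real (card S)"
  shows "\<exists>u\<in>S. spectral_density E S + \<epsilon> / (4 * real (card S)) \<le> spectral_density E (S - {u})"
proof -
  let ?\<mu> = "spectral_radius E S" and ?m = "real (card S)"
  have "\<epsilon> * ?m \<le> 1 / 10 * ?m" using tolerance(2) by (rule mult_right_mono) simp
  then have order_ge: "100 \<le> ?m" using tolerance(3) by linarith
  obtain x where principal: "principal_vector E S x"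
    using principal_vector_exists[OF finite] w_mem by blast
  have "Min (x ` S) \<in> x ` S" using finite w_mem by (intro Min_in) auto
  then obtain u where "u \<in> S" "x u = Min (x ` S)" by auto
  then have minimal_entry: "u \<in> S" "x u \<le> x v" if "v \<in> S" for v using finite that by simp_all
  have "(x u)\<^sup>2 * ((1 + \<epsilon>) * ?m) \<le> 1"
  proof (rule mult_le_one_of_deficit)
    show "(x u)\<^sup>2 * (?\<mu>\<^sup>2 + real (card (nbrs E S w)) * (?m - real (card (nbrs E S w))))
        \<le> real (card (nbrs E S w))"
      using minimal_entry_degree_inequality[OF finite principal w_mem refl] minimal_entry \<open>u \<in> S\<close>
      by blast
    show "real (card (nbrs E S w)) + \<epsilon> / 2 * ?m \<le> ?\<mu>"
      using deg order_ge by (simp add: spectral_density_def algebra_simps)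
  qed (use tolerance order_ge in auto)
  then have "?\<mu> * ((1 + \<epsilon>) * ?m - 2) \<le> ((1 + \<epsilon>) * ?m - 1) * spectral_radius E (S - {u})"
  proof (rule radius_ratio_of_mult_le_one[rotated 2])
    show "?\<mu> * (1 - 2 * (x u)\<^sup>2) \<le> spectral_radius E (S - {u}) * (1 - (x u)\<^sup>2)"
      by (rule spectral_radius_delete[OF finite principal \<open>u \<in> S\<close>])
    show "0 \<le> ?\<mu>" using spectral_radius_nonneg[OF finite] w_mem by blast
    show "2 \<le> (1 + \<epsilon>) * ?m" unfolding distrib_right using tolerance(3) by linarith
  qed
  then have "?\<mu> / ?m + \<epsilon> / (4 * ?m) \<le> spectral_radius E (S - {u}) / (?m - 1)"
    using density_gain_of_radius_ratio tolerance order_ge density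
    by (simp add: spectral_density_def)
  moreover have "real (card (S - {u})) = ?m - 1"
    using finite \<open>u \<in> S\<close> order_ge by (simp add: of_nat_diff)
  ultimately show ?thesis using \<open>u \<in> S\<close> by (auto simp: spectral_density_def)
qed

lemma vertex_deletion_step:
  fixes \<epsilon> \<theta> :: real
  assumes finite: "finite V" and S_subset: "S \<subseteq> V" and w_mem: "w \<in> S"
    and deg: "real (card (nbrs E S w)) \<le> \<theta> * real (card S)"
    and threshold: "\<theta> + \<epsilon> / 2 \<le> spectral_density E V" and density: "2 / 5 \<le> spectral_density E V"
    and tolerance: "0 < \<epsilon>" "\<epsilon> \<le> 1 / 10" "10 \<le> \<epsilon> * real (card S)"
    and gain: "spectral_density E V + real j * (\<epsilon> / (4 * real (card V))) \<le> spectral_density E S"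
  shows "\<exists>u\<in>S. spectral_density E V + real (Suc j) * (\<epsilon> / (4 * real (card V))) \<le> spectral_density E (S - {u})"
proof -
  let ?\<eta> = "\<epsilon> / (4 * real (card V))"
  have finite_S: "finite S" using S_subset finite by (rule finite_subset)
  have "0 \<le> real j * ?\<eta>" using tolerance(1) by simp
  then have increase: "spectral_density E V \<le> spectral_density E S" using gain by linarith
  then have "\<theta> * real (card S) \<le> (spectral_density E S - \<epsilon> / 2) * real (card S)"
    using threshold by (intro mult_right_mono) auto
  then have "real (card (nbrs E S w)) \<le> (spectral_density E S - \<epsilon> / 2) * real (card S)"
    using deg by linarith
  moreover have "2 / 5 \<le> spectral_density E S" using density increase by linarith
  ultimately obtain u where deletable: "u \<in> S"
    "spectral_density E S + \<epsilon> / (4 * real (card S)) \<le> spectral_density E (S - {u})"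
    using spectral_density_delete[OF finite_S w_mem _ _ tolerance] by blast
  have "0 < card S" using w_mem finite_S by (auto simp: card_gt_0_iff)
  then have "?\<eta> \<le> \<epsilon> / (4 * real (card S))"
    using card_mono[OF finite S_subset] tolerance(1) by (intro divide_left_mono) auto
  then have "spectral_density E V + real (Suc j) * ?\<eta> \<le> spectral_density E (S - {u})"
    unfolding of_nat_Suc distrib_right mult_1_left using gain deletable(2) by linarith
  then show ?thesis using deletable(1) by blast
qed

lemma vertex_deletion:
  fixes \<epsilon> \<theta> :: real
  assumes finite: "finite V"
    and threshold: "\<theta> + \<epsilon> / 2 \<le> spectral_density E V" and density: "2 / 5 \<le> spectral_density E V"
    and tolerance: "0 < \<epsilon>" "\<epsilon> \<le> 1 / 10" "10 \<le> \<epsilon> * real (card V - k)"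
  shows "\<exists>j S. j \<le> k \<and> S \<subseteq> V \<and> card S = card V - j \<and>
    spectral_density E V + real j * (\<epsilon> / (4 * real (card V))) \<le> spectral_density E S \<and>
    (j = k \<or> (\<forall>w\<in>S. \<theta> * real (card S) < real (card (nbrs E S w))))"
  using tolerance(3)
proof (induction k)
  case 0
  then show ?case by auto
next
  case (Suc k)
  have "\<epsilon> * real (card V - Suc k) \<le> \<epsilon> * real (card V - k)"
    using tolerance(1) by (intro mult_left_mono) auto
  then have large: "10 \<le> \<epsilon> * real (card V - k)" using Suc.prems by (rule order_trans[rotated])
  with Suc.IH obtain j S where "j \<le> k" and remaining: "S \<subseteq> V" "card S = card V - j"
    and gain: "spectral_density E V + real j * (\<epsilon> / (4 * real (card V))) \<le> spectral_density E S"
    and stop: "j = k \<or> (\<forall>w\<in>S. \<theta> * real (card S) < real (card (nbrs E S w)))" by blast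
  show ?case
  proof (cases "\<forall>w\<in>S. \<theta> * real (card S) < real (card (nbrs E S w))")
    case True
    then show ?thesis using \<open>j \<le> k\<close> remaining gain by (meson le_SucI)
  next
    case False
    then obtain w where small_degree: "w \<in> S" "real (card (nbrs E S w)) \<le> \<theta> * real (card S)"
      by (auto simp: not_less)
    have "j = k" using stop False by blast
    then have "10 \<le> \<epsilon> * real (card S)" using large remaining(2) by (simp only:)
    with vertex_deletion_step[OF finite remaining(1) small_degree threshold density tolerance(1,2) _ gain]
    obtain u where deletable: "u \<in> S"
      "spectral_density E V + real (Suc k) * (\<epsilon> / (4 * real (card V))) \<le> spectral_density E (S - {u})"
      unfolding \<open>j = k\<close> by blast
    moreover have "card (S - {u}) = card V - Suc k" using remaining deletable(1) \<open>j = k\<close> by simp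
    ultimately show ?thesis using remaining(1) by blast
  qed
qed

end

section \<open>Many cliques on one edge\<close>

definition tail_joined_cliques :: "('a \<Rightarrow> 'a \<Rightarrow> bool) \<Rightarrow> 'a set \<Rightarrow> nat \<Rightarrow> 'a set \<Rightarrow> 'a list set" where
  "tail_joined_cliques E S k A = {xs \<in> cliques E S k. A \<subseteq> common_nbrs E S (set (tl xs))}"

lemma exists_ge_average:
  fixes f :: "'a \<Rightarrow> 'b :: linordered_semidom"
  assumes "finite A" "A \<noteq> {}"
  shows "\<exists>a\<in>A. sum f A \<le> of_nat (card A) * f a"
proof -
  have "Max (f ` A) \<in> f ` A" using assms by simp
  then obtain a where maximal: "a \<in> A" "f a = Max (f ` A)" by auto
  then have "sum f A \<le> of_nat (card A) * f a"
    using assms(1) by (intro sum_bounded_above) simp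
  then show ?thesis using maximal(1) by blast
qed

lemma card_Cons_Sigma:
  assumes "finite T" "\<And>ys. ys \<in> T \<Longrightarrow> finite (B ys)"
  shows "card ((\<lambda>(ys, y). y # ys) ` Sigma T B) = (\<Sum>ys\<in>T. card (B ys))"
  using assms by (simp add: card_image inj_on_def case_prod_unfold card_SigmaI)

lemma tail_joined_cliques_mono:
  "S \<subseteq> T \<Longrightarrow> tail_joined_cliques E S k A \<subseteq> tail_joined_cliques E T k A"
  by (auto simp: tail_joined_cliques_def common_nbrs_def cliques_def)

lemma finite_tail_joined_cliques: "finite S \<Longrightarrow> finite (tail_joined_cliques E S k A)"
  by (simp add: tail_joined_cliques_def finite_cliques)

context adjacency
begin

lemma sorted_wrt_imp_pairwise_distinct: "sorted_wrt E xs \<Longrightarrow> pairwise E (set xs) \<and> distinct xs"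
  by (induction xs) (auto simp: pairwise_insert irrefl intro: sym)

lemma card_Diff_nbrs:
  assumes "finite S"
  shows "real (card (S - nbrs E S v)) = real (card S) - real (card (nbrs E S v))"
  using assms by (simp add: card_Diff_subset finite_nbrs nbrs_subset of_nat_diff card_mono)

lemma card_common_nbrs_ge:
  assumes finite: "finite S" and deg: "\<And>v. v \<in> S \<Longrightarrow> real (card S) - D \<le> real (card (nbrs E S v))"
    and A_subset: "A \<subseteq> S"
  shows "real (card S) - real (card A) * D \<le> real (card (common_nbrs E S A))"
proof -
  have "S - common_nbrs E S A = (\<Union>v\<in>A. S - nbrs E S v)"
    by (auto simp: common_nbrs_def nbrs_def)
  moreover have "finite A" using A_subset finite by (rule finite_subset)
  ultimately have "card (S - common_nbrs E S A) \<le> (\<Sum>v\<in>A. card (S - nbrs E S v))"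
    by (simp only: card_UN_le)
  then have "real (card (S - common_nbrs E S A)) \<le> (\<Sum>v\<in>A. real (card (S - nbrs E S v)))"
    by (simp only: of_nat_sum[symmetric] of_nat_le_iff)
  also have "\<dots> \<le> (\<Sum>v\<in>A. D)"
    using A_subset deg by (intro sum_mono) (force simp: card_Diff_nbrs[OF finite])
  finally show ?thesis
    using finite
    by (simp add: card_Diff_subset finite_common_nbrs common_nbrs_subset of_nat_diff card_mono)
qed

text \<open>A common neighbour of \<open>A\<close> that is not counted on the right-hand side misses two vertices of \<open>Q\<close>, and
  the degrees leave room for \<open>card Q * D / 2\<close> such vertices only.\<close>

lemma card_replacing_vertices_ge:
  assumes finite: "finite S" and deg: "\<And>v. v \<in> S \<Longrightarrow> real (card S) - D \<le> real (card (nbrs E S v))"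
    and A_subset: "A \<subseteq> S" and core: "Q \<subseteq> S" "Q \<noteq> {}"
  shows "real (card S) - real (card A) * D - real (card Q) * D / 2
    \<le> real (card (\<Union>q\<in>Q. common_nbrs E S (A \<union> (Q - {q}))))" (is "_ \<le> real (card ?good)")
proof -
  let ?bad = "common_nbrs E S A - ?good"
  have finite_Q: "finite Q" using core(1) finite by (rule finite_subset)
  have two_missing: "2 \<le> real (card {q \<in> Q. \<not> E q y})" if y_bad: "y \<in> ?bad" for y
  proof (rule ccontr)
    assume "\<not> ?thesis"
    then have "card {q \<in> Q. \<not> E q y} \<le> Suc 0" by simp
    then have unique: "q = q'" if "q \<in> Q" "\<not> E q y" "q' \<in> Q" "\<not> E q' y" for q q'
      using that finite_Q card_le_Suc0_iff_eq[of "{q \<in> Q. \<not> E q y}"] by auto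
    obtain q where "q \<in> Q" "\<forall>q'\<in>Q - {q}. E q' y"
      using core(2) unique by (metis DiffE equals0I insertCI)
    then have "y \<in> ?good" using y_bad by (auto simp: common_nbrs_def)
    then show False using y_bad by blast
  qed
  have "2 * real (card ?bad) = (\<Sum>y\<in>?bad. 2)" by simp
  also have "\<dots> \<le> (\<Sum>y\<in>?bad. real (card {q \<in> Q. \<not> E q y}))" by (intro sum_mono two_missing)
  also have "\<dots> \<le> (\<Sum>y\<in>S. real (card {q \<in> Q. \<not> E q y}))"
    using finite by (intro sum_mono2) (auto simp: common_nbrs_def)
  also have "\<dots> = (\<Sum>y\<in>S. \<Sum>q\<in>Q. if \<not> E q y then 1 else 0)"
    using finite_Q by (simp add: sum.inter_filter[symmetric])
  also have "\<dots> = (\<Sum>q\<in>Q. \<Sum>y\<in>S. if \<not> E q y then 1 else 0)" by (rule sum.swap)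
  also have "\<dots> = (\<Sum>q\<in>Q. real (card (S - nbrs E S q)))"
    using finite by (simp add: sum.inter_filter[symmetric] nbrs_def set_diff_eq cong: conj_cong)
  also have "\<dots> \<le> (\<Sum>q\<in>Q. D)"
    using core deg by (intro sum_mono) (force simp: card_Diff_nbrs[OF finite])
  finally have "2 * real (card ?bad) \<le> real (card Q) * D" by simp
  moreover have "?good \<subseteq> common_nbrs E S A" using core(2) by (auto simp: common_nbrs_def)
  then have "real (card ?bad) = real (card (common_nbrs E S A)) - real (card ?good)"
    using finite finite_common_nbrs[OF finite, of E A]
    by (simp add: card_Diff_subset finite_subset of_nat_diff card_mono)
  ultimately show ?thesis using card_common_nbrs_ge[OF finite deg A_subset] by linarith
qed

lemma clique_replacement_step:
  fixes D g :: real
  assumes finite: "finite S" and deg: "\<And>v. v \<in> S \<Longrightarrow> real (card S) - D \<le> real (card (nbrs E S v))"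
    and core: "Q \<subseteq> S" "Q \<noteq> {}" and g_le: "g \<le> real (card S) - real d * D - real (card Q) * D / 2"
    and tuples: "T \<subseteq> cliques E S d" "\<And>ys. ys \<in> T \<Longrightarrow> Q \<subseteq> common_nbrs E S (set ys)"
  shows "\<exists>q\<in>Q. \<exists>T'\<subseteq>cliques E S (Suc d).
    (\<forall>ys\<in>T'. Q - {q} \<subseteq> common_nbrs E S (set ys)) \<and>
    real (card T) * g \<le> real (card Q) * real (card T')"
proof -
  define new where "new q ys = common_nbrs E S (set ys \<union> (Q - {q}))" for q ys
  define T' where "T' q = (\<lambda>(ys, y). y # ys) ` Sigma T (new q)" for q
  have finite_T: "finite T" using tuples(1) finite_cliques[OF finite] by (rule finite_subset)
  have finite_Q: "finite Q" using core(1) finite by (rule finite_subset)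
  have card_T': "card (T' q) = (\<Sum>ys\<in>T. card (new q ys))" for q
    unfolding T'_def new_def by (intro card_Cons_Sigma finite_T finite_common_nbrs finite)
  have "card (nbrs E S v) \<le> card S" for v by (intro card_mono finite nbrs_subset)
  then have "0 \<le> D" using deg core by (smt (verit) equals0I of_nat_le_iff subsetD)
  have many_new: "g \<le> (\<Sum>q\<in>Q. real (card (new q ys)))" if "ys \<in> T" for ys
  proof -
    have tuple: "set ys \<subseteq> S" "length ys = d" using tuples(1) that by (auto simp: cliques_def)
    have "real (card (set ys)) * D \<le> real d * D"
      using tuple(2) card_length[of ys] \<open>0 \<le> D\<close> by (intro mult_right_mono) auto
    then have "g \<le> real (card S) - real (card (set ys)) * D - real (card Q) * D / 2"
      using g_le by linarith
    also have "\<dots> \<le> real (card (\<Union>q\<in>Q. new q ys))"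
      unfolding new_def by (rule card_replacing_vertices_ge[OF finite deg tuple(1) core])
    also have "\<dots> \<le> real (\<Sum>q\<in>Q. card (new q ys))"
      using card_UN_le[OF finite_Q, of "\<lambda>q. new q ys"] by (simp only: of_nat_le_iff)
    finally show ?thesis by simp
  qed
  have "real (card T) * g = (\<Sum>ys\<in>T. g)" by simp
  also have "\<dots> \<le> (\<Sum>ys\<in>T. \<Sum>q\<in>Q. real (card (new q ys)))" by (intro sum_mono many_new)
  also have "\<dots> = (\<Sum>q\<in>Q. real (card (T' q)))" unfolding card_T' of_nat_sum by (rule sum.swap)
  finally have total: "real (card T) * g \<le> (\<Sum>q\<in>Q. real (card (T' q)))" .
  obtain q where replaced: "q \<in> Q" "(\<Sum>q\<in>Q. real (card (T' q))) \<le> real (card Q) * real (card (T' q))"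
    using exists_ge_average[OF finite_Q core(2), of "\<lambda>q. real (card (T' q))"] by blast
  have "T' q \<subseteq> cliques E S (Suc d)"
    using tuples(1) by (auto simp: T'_def new_def Cons_in_cliques_iff common_nbrs_def)
  moreover have "Q - {q} \<subseteq> common_nbrs E S (set ys)" if new_tuple: "ys \<in> T' q" for ys
  proof -
    obtain y zs where tuple: "ys = y # zs" "zs \<in> T" "y \<in> new q zs"
      using new_tuple by (auto simp: T'_def)
    then show ?thesis
      using tuples(2)[OF tuple(2)] by (auto simp: new_def common_nbrs_def subset_iff intro: sym)
  qed
  ultimately show ?thesis using replaced total by (meson order_trans)
qed

lemma clique_replacement:
  fixes D g :: real
  assumes finite: "finite S" and deg: "\<And>v. v \<in> S \<Longrightarrow> real (card S) - D \<le> real (card (nbrs E S v))"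
    and clique: "cliques E S (Suc r) \<noteq> {}"
    and g_bounds: "0 \<le> g" "g \<le> real (card S) - (real r - 1 / 2) * D" "0 \<le> D" and d_less: "d < r"
  shows "\<exists>Q T. Q \<subseteq> S \<and> card Q = Suc r - d \<and> pairwise E Q \<and>
    T \<subseteq> cliques E S d \<and> (\<forall>ys\<in>T. Q \<subseteq> common_nbrs E S (set ys)) \<and>
    g ^ d * fact (Suc r - d) / fact (Suc r) \<le> real (card T)"
  using d_less
proof (induction d)
  case 0
  obtain R where clique_list: "sorted_wrt E R" "set R \<subseteq> S" "length R = Suc r"
    using clique by (auto simp: cliques_def)
  then have "pairwise E (set R)" "card (set R) = Suc r"
    using sorted_wrt_imp_pairwise_distinct by (auto simp: distinct_card)
  then show ?case
    using clique_list(2)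
    by (intro exI[of _ "set R"] exI[of _ "{[]}"]) (simp add: cliques_0 common_nbrs_def)
next
  case (Suc d)
  then obtain Q T where core: "Q \<subseteq> S" "card Q = Suc r - d" "pairwise E Q"
    and tuples: "T \<subseteq> cliques E S d" "\<And>ys. ys \<in> T \<Longrightarrow> Q \<subseteq> common_nbrs E S (set ys)"
    and card_T: "g ^ d * fact (Suc r - d) / fact (Suc r) \<le> real (card T)" by auto
  have "Q \<noteq> {}" using core(2) Suc.prems by auto
  have card_Q: "card Q = Suc (r - d)" using core(2) Suc.prems by simp
  have "real d + real (card Q) / 2 \<le> real r - 1 / 2"
    using card_Q Suc.prems by (simp add: of_nat_diff field_simps)
  then have "(real d + real (card Q) / 2) * D \<le> (real r - 1 / 2) * D"
    using g_bounds(3) by (rule mult_right_mono)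
  then have g_le: "g \<le> real (card S) - real d * D - real (card Q) * D / 2"
    using g_bounds(2) by (simp add: algebra_simps)
  obtain q T' where replaced: "q \<in> Q" and extended: "T' \<subseteq> cliques E S (Suc d)"
    "\<forall>ys\<in>T'. Q - {q} \<subseteq> common_nbrs E S (set ys)"
    and card_T': "real (card T) * g \<le> real (card Q) * real (card T')"
    using clique_replacement_step[OF finite deg core(1) \<open>Q \<noteq> {}\<close> g_le tuples] by blast
  have "g ^ Suc d * fact (Suc r - Suc d) / fact (Suc r) * real (card Q) =
      g ^ d * fact (Suc r - d) / fact (Suc r) * g"
    using Suc.prems by (simp add: card_Q Suc_diff_le del: fact_Suc of_nat_Suc)
      (simp add: mult_ac)
  also have "\<dots> \<le> real (card T') * real (card Q)"
    using mult_right_mono[OF card_T g_bounds(1)] card_T'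
    by (simp only: mult.commute[of "real (card T')"])
  finally have "g ^ Suc d * fact (Suc r - Suc d) / fact (Suc r) \<le> real (card T')"
    by (rule mult_right_le_imp_le) (simp add: card_Q)
  moreover have "card (Q - {q}) = Suc r - Suc d" using core(2) replaced by simp
  moreover have "pairwise E (Q - {q})" using core(3) by (rule pairwise_subset) blast
  ultimately show ?case using core(1) extended by (meson Diff_subset order_trans)
qed

theorem many_cliques_on_an_edge:
  fixes D g :: real
  assumes finite: "finite S" and deg: "\<And>v. v \<in> S \<Longrightarrow> real (card S) - D \<le> real (card (nbrs E S v))"
    and clique: "cliques E S (Suc r) \<noteq> {}" and r_pos: "0 < r"
    and g_bounds: "0 \<le> g" "g \<le> real (card S) - (real r - 1 / 2) * D" "0 \<le> D"
  shows "\<exists>u\<in>S. \<exists>v\<in>S. E u v \<and>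
    2 * g ^ r / fact (Suc r) \<le> real (card (tail_joined_cliques E S r {u, v}))"
proof -
  obtain Q T where core: "Q \<subseteq> S" "card Q = Suc r - (r - 1)" "pairwise E Q"
    and tuples: "T \<subseteq> cliques E S (r - 1)" "\<forall>ys\<in>T. Q \<subseteq> common_nbrs E S (set ys)"
    and card_T: "g ^ (r - 1) * fact (Suc r - (r - 1)) / fact (Suc r) \<le> real (card T)"
    using clique_replacement[OF finite deg clique g_bounds, of "r - 1"] r_pos by auto
  have two_left: "Suc r - (r - 1) = 2" using r_pos by simp
  then obtain u v where edge: "Q = {u, v}" "u \<noteq> v" using core(2) by (metis card_2_iff)
  have finite_T: "finite T" using tuples(1) finite_cliques[OF finite] by (rule finite_subset)
  define M where "M = (\<lambda>(ys, y). y # ys) ` Sigma T (\<lambda>ys. common_nbrs E S (set ys))"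
  have "g \<le> real (card (common_nbrs E S (set ys)))" if "ys \<in> T" for ys
  proof -
    have tuple: "set ys \<subseteq> S" "length ys = r - 1" using tuples(1) that by (auto simp: cliques_def)
    then have "real (card (set ys)) \<le> real r - 1 / 2" using card_length[of ys] r_pos by linarith
    then have "real (card (set ys)) * D \<le> (real r - 1 / 2) * D"
      using g_bounds(3) by (rule mult_right_mono)
    then show ?thesis using g_bounds(2) card_common_nbrs_ge[OF finite deg tuple(1)] by linarith
  qed
  then have "(\<Sum>ys\<in>T. g) \<le> (\<Sum>ys\<in>T. real (card (common_nbrs E S (set ys))))" by (rule sum_mono)
  also have "\<dots> = real (card M)"
    unfolding M_def by (simp add: card_Cons_Sigma finite_T finite_common_nbrs finite)
  finally have "real (card T) * g \<le> real (card M)" by simp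
  moreover have "2 * g ^ r / fact (Suc r) = g ^ (r - 1) * fact (Suc r - (r - 1)) / fact (Suc r) * g"
    unfolding two_left using r_pos by (cases r) simp_all
  ultimately have "2 * g ^ r / fact (Suc r) \<le> real (card M)"
    using mult_right_mono[OF card_T g_bounds(1)] by linarith
  also have "\<dots> \<le> real (card (tail_joined_cliques E S r {u, v}))"
  proof -
    have "M \<subseteq> cliques E S (Suc (r - 1))"
      using tuples(1) by (auto simp: M_def Cons_in_cliques_iff)
    then have "M \<subseteq> tail_joined_cliques E S r {u, v}"
      using tuples(2) r_pos edge(1) by (auto simp: M_def tail_joined_cliques_def)
    then show ?thesis by (intro of_nat_mono card_mono finite_tail_joined_cliques finite)
  qed
  finally show ?thesis
    using core(1,3) edge by (auto simp: pairwise_def)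
qed

end

section \<open>Complete multipartite subgraphs from many cliques\<close>

text \<open>The entries at position \<open>a\<close> of the tuples \<open>F i\<close> form the \<open>a\<close>-th part.\<close>

definition cross_adjacent :: "('a \<Rightarrow> 'a \<Rightarrow> bool) \<Rightarrow> nat \<Rightarrow> 'i set \<Rightarrow> ('i \<Rightarrow> 'a list) \<Rightarrow> bool" where
  "cross_adjacent E j I F \<longleftrightarrow> (\<forall>i\<in>I. length (F i) = j) \<and>
    (\<forall>i\<in>I. \<forall>i'\<in>I. \<forall>a<j. \<forall>b<j. a \<noteq> b \<longrightarrow> E (F i ! a) (F i' ! b)) \<and>
    (\<forall>a<j. inj_on (\<lambda>i. F i ! a) I)"

lemma cross_adjacentD:
  "cross_adjacent E j I F \<Longrightarrow> i \<in> I \<Longrightarrow> i' \<in> I \<Longrightarrow> a < j \<Longrightarrow> b < j \<Longrightarrow> a \<noteq> b \<Longrightarrow> E (F i ! a) (F i' ! b)"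
  by (simp add: cross_adjacent_def)

lemma cross_adjacent_length: "cross_adjacent E j I F \<Longrightarrow> i \<in> I \<Longrightarrow> length (F i) = j"
  by (simp add: cross_adjacent_def)

lemma cross_adjacent_inj_on: "cross_adjacent E j I F \<Longrightarrow> a < j \<Longrightarrow> inj_on (\<lambda>i. F i ! a) I"
  by (simp add: cross_adjacent_def)

lemma cross_adjacent_subset: "cross_adjacent E j I F \<Longrightarrow> G \<subseteq> I \<Longrightarrow> cross_adjacent E j G F"
  unfolding cross_adjacent_def by (meson inj_on_subset subsetD)

lemma cross_adjacent_tl:
  assumes "cross_adjacent E (Suc j) I F"
  shows "cross_adjacent E j I (\<lambda>i. tl (F i))"
proof -
  have nth_tl_F: "tl (F i) ! a = F i ! Suc a" if "i \<in> I" "a < j" for i a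
    using cross_adjacent_length[OF assms] that by (simp add: nth_tl)
  have "inj_on (\<lambda>i. tl (F i) ! a) I" if "a < j" for a
  proof -
    have "inj_on (\<lambda>i. F i ! Suc a) I" using cross_adjacent_inj_on[OF assms] that by simp
    then show ?thesis using that by (simp add: nth_tl_F cong: inj_on_cong)
  qed
  then show ?thesis using assms by (simp add: cross_adjacent_def nth_tl_F)
qed

lemma card_large_degree_ge:
  fixes P :: "'i \<Rightarrow> 'a \<Rightarrow> bool"
  assumes finite: "finite I" "finite V" and card_I: "card I = h * s" and pos: "0 < h" "0 < s"
    and dense: "\<And>i. i \<in> I \<Longrightarrow> 2 * card V \<le> h * card {y \<in> V. P i y}"
  shows "card V \<le> card {y \<in> V. s \<le> card {i \<in> I. P i y}} * h"
proof -
  let ?deg = "\<lambda>y. card {i \<in> I. P i y}"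
  let ?good = "{y \<in> V. s \<le> ?deg y}"
  have "h * (2 * s * card V) = (\<Sum>i\<in>I. 2 * card V)" by (simp add: card_I)
  also have "\<dots> \<le> (\<Sum>i\<in>I. h * card {y \<in> V. P i y})" by (intro sum_mono dense)
  also have "\<dots> = h * (\<Sum>i\<in>I. \<Sum>y\<in>V. if P i y then 1 else 0)"
    using finite by (simp add: sum_distrib_left sum.inter_filter[symmetric])
  also have "(\<Sum>i\<in>I. \<Sum>y\<in>V. if P i y then 1 else 0) = (\<Sum>y\<in>V. \<Sum>i\<in>I. if P i y then 1 else (0::nat))"
    by (rule sum.swap)
  also have "\<dots> = (\<Sum>y\<in>V. ?deg y)"
    using finite by (simp add: sum.inter_filter[symmetric])
  finally have "2 * s * card V \<le> (\<Sum>y\<in>V. ?deg y)" using pos by simp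
  also have "\<dots> \<le> (\<Sum>y\<in>V. (if s \<le> ?deg y then h * s else 0) + s)"
  proof (rule sum_mono)
    fix y
    have "?deg y \<le> h * s" unfolding card_I[symmetric] using finite by (intro card_mono) auto
    then show "?deg y \<le> (if s \<le> ?deg y then h * s else 0) + s" by auto
  qed
  also have "\<dots> = card ?good * (h * s) + card V * s"
    using finite by (simp add: sum.distrib sum.inter_filter[symmetric])
  finally have "s * card V \<le> s * (card ?good * h)" by (simp add: algebra_simps)
  then show ?thesis using pos(2) by simp
qed

lemma complete_bipartite_of_dense:
  fixes P :: "'i \<Rightarrow> 'a \<Rightarrow> bool"
  assumes finite: "finite I" "finite V" and card_I: "card I = h * s" and pos: "0 < h" "0 < s"
    and dense: "\<And>i. i \<in> I \<Longrightarrow> 2 * card V \<le> h * card {y \<in> V. P i y}"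
  shows "\<exists>G\<subseteq>I. \<exists>Y\<subseteq>V. card G = s \<and> (\<forall>i\<in>G. \<forall>y\<in>Y. P i y) \<and> card V \<le> card Y * (h * 2 ^ (h * s))"
proof -
  define good where "good = {y \<in> V. s \<le> card {i \<in> I. P i y}}"
  define subsets where "subsets = {G. G \<subseteq> I \<and> card G = s}"
  have "\<exists>G. G \<in> subsets \<and> (\<forall>i\<in>G. P i y)" if large: "y \<in> good" for y
  proof -
    have "s \<le> card {i \<in> I. P i y}" using large by (simp add: good_def)
    then obtain G where "G \<subseteq> {i \<in> I. P i y}" "card G = s" by (rule obtain_subset_with_card_n)
    then show ?thesis by (auto simp: subsets_def)
  qed
  then have "\<forall>y\<in>good. \<exists>G. G \<in> subsets \<and> (\<forall>i\<in>G. P i y)" by blast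
  from bchoice[OF this]
  obtain f where choice: "\<forall>y\<in>good. f y \<in> subsets \<and> (\<forall>i\<in>f y. P i y)" by blast
  have finite_subsets: "finite subsets" using finite(1) by (simp add: subsets_def)
  have "s \<le> card I" using card_I pos(1) by simp
  then obtain G0 where "G0 \<subseteq> I" "card G0 = s" by (rule obtain_subset_with_card_n)
  then have "subsets \<noteq> {}" by (auto simp: subsets_def)
  then obtain G where popular: "G \<in> subsets"
    "(\<Sum>G\<in>subsets. card {y \<in> good. f y = G}) \<le> card subsets * card {y \<in> good. f y = G}"
    using exists_ge_average[OF finite_subsets, of "\<lambda>G. card {y \<in> good. f y = G}"] by auto
  define Y where "Y = {y \<in> good. f y = G}"
  have "finite good" using finite(2) by (simp add: good_def)
  moreover have "f ` good \<subseteq> subsets" using choice by blast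
  ultimately have "card good = (\<Sum>G\<in>subsets. card {y \<in> good. f y = G})"
    using sum.group[OF _ finite_subsets, of good f "\<lambda>_. 1 :: nat"] by simp
  also have "\<dots> \<le> card subsets * card Y" using popular(2) by (simp only: Y_def)
  also have "\<dots> \<le> 2 ^ (h * s) * card Y"
  proof (rule mult_right_mono)
    have "card subsets \<le> card (Pow I)"
      using finite(1) by (intro card_mono) (auto simp: subsets_def)
    then show "card subsets \<le> 2 ^ (h * s)" using finite(1) by (simp add: card_Pow card_I)
  qed simp
  finally have card_good: "card good \<le> 2 ^ (h * s) * card Y" .
  have "card V \<le> card good * h"
    unfolding good_def by (rule card_large_degree_ge[OF finite card_I pos dense])
  also have "\<dots> \<le> 2 ^ (h * s) * card Y * h" using card_good by (rule mult_right_mono) simp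
  finally have "card V \<le> card Y * (h * 2 ^ (h * s))" by (simp only: mult_ac)
  moreover have "\<forall>i\<in>G. \<forall>y\<in>Y. P i y" using choice by (auto simp: Y_def)
  moreover have "Y \<subseteq> V" by (auto simp: Y_def good_def)
  ultimately show ?thesis using popular(1) unfolding subsets_def by blast
qed

context adjacency
begin

lemma clique_snoc_adjacent:
  assumes "R @ [y] \<in> cliques E V (Suc j)" "a < j"
  shows "E (R ! a) y"
proof -
  have "length R = j" "sorted_wrt E (R @ [y])" using assms by (auto simp: cliques_def)
  then show ?thesis using assms(2) by (auto simp: sorted_wrt_append)
qed

lemma card_dense_prefixes_ge:
  assumes finite: "finite V" "0 < card V" and M_subset: "M \<subseteq> cliques E V (Suc j)"
    and dense: "2 * Suc j * card V ^ Suc j \<le> h * card M"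
  shows "2 * j * card V ^ j \<le> h * card {R \<in> cliques E V j. 2 * card V \<le> h * card {y \<in> V. R @ [y] \<in> M}}"
    (is "_ \<le> h * card ?prefixes")
proof -
  let ?n = "card V" and ?ext = "\<lambda>R. {y \<in> V. R @ [y] \<in> M}"
  have "card M = (\<Sum>zs\<in>cliques E V (Suc j). if zs \<in> M then 1 else 0)"
    using M_subset finite_cliques[OF finite(1)] by (simp add: sum.If_cases Int_absorb1)
  also have
    "\<dots> = (\<Sum>R\<in>cliques E V j. \<Sum>y\<in>common_nbrs E V (set R). if insert_nth j y R \<in> M then 1 else 0)"
    by (rule sum_cliques_Suc[OF finite(1) order_refl])
  also have "\<dots> \<le> (\<Sum>R\<in>cliques E V j. card (?ext R))"
  proof (rule sum_mono)
    fix R assume "R \<in> cliques E V j"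
    then have "insert_nth j y R = R @ [y]" for y by (simp add: cliques_def insert_nth_def)
    then have "(\<Sum>y\<in>common_nbrs E V (set R). if insert_nth j y R \<in> M then 1 else 0) =
        card {y \<in> common_nbrs E V (set R). R @ [y] \<in> M}"
      using finite_common_nbrs[OF finite(1)] by (simp add: sum.inter_filter[symmetric])
    also have "\<dots> \<le> card (?ext R)" using finite(1) by (intro card_mono) (auto simp: common_nbrs_def)
    finally show
      "(\<Sum>y\<in>common_nbrs E V (set R). if insert_nth j y R \<in> M then 1 else 0) \<le> card (?ext R)" .
  qed
  finally have "h * card M \<le> (\<Sum>R\<in>cliques E V j. h * card (?ext R))"
    by (simp add: sum_distrib_left[symmetric])
  also have "\<dots> \<le> (\<Sum>R\<in>cliques E V j. (if 2 * ?n \<le> h * card (?ext R) then h * ?n else 0) + 2 * ?n)"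
  proof (rule sum_mono)
    fix R
    show "h * card (?ext R) \<le> (if 2 * ?n \<le> h * card (?ext R) then h * ?n else 0) + 2 * ?n"
    proof (cases "2 * ?n \<le> h * card (?ext R)")
      case True
      have "h * card (?ext R) \<le> h * ?n" using finite(1) by (intro mult_left_mono card_mono) auto
      then show ?thesis unfolding if_P[OF True] by (rule trans_le_add1)
    qed simp
  qed
  also have "\<dots> = card ?prefixes * (h * ?n) + card (cliques E V j) * (2 * ?n)"
    using finite_cliques[OF finite(1)] by (simp add: sum.distrib sum.inter_filter[symmetric])
  also have "\<dots> \<le> card ?prefixes * (h * ?n) + ?n ^ j * (2 * ?n)"
    using card_cliques_le[OF finite(1), of E j] by (intro add_left_mono mult_right_mono) auto
  finally have "h * card M \<le> ?n * (h * card ?prefixes) + ?n * (2 * ?n ^ j)" by (simp only: mult_ac)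
  moreover have "2 * Suc j * ?n ^ Suc j = ?n * (2 * j * ?n ^ j) + ?n * (2 * ?n ^ j)"
    by (simp add: algebra_simps)
  ultimately have "?n * (2 * j * ?n ^ j) \<le> ?n * (h * card ?prefixes)" using dense by linarith
  then show ?thesis using finite(2) by simp
qed

lemma cross_adjacent_snoc:
  assumes cross: "cross_adjacent E j I F" and inj: "inj_on f I"
    and adj: "\<And>i i' a. i \<in> I \<Longrightarrow> i' \<in> I \<Longrightarrow> a < j \<Longrightarrow> E (F i ! a) (f i')"
  shows "cross_adjacent E (Suc j) I (\<lambda>i. F i @ [f i])"
proof -
  have nth_snoc: "(F i @ [f i]) ! a = (if a < j then F i ! a else f i)"
    if "i \<in> I" "a < Suc j" for i a
    using cross that by (auto simp: cross_adjacent_def nth_append less_Suc_eq)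
  have "E ((F i @ [f i]) ! a) ((F i' @ [f i']) ! b)"
    if indices: "i \<in> I" "i' \<in> I" and positions: "a < Suc j" "b < Suc j" "a \<noteq> b" for i i' a b
  proof -
    consider (old) "a < j" "b < j" | (right) "a < j" "b = j" | (left) "a = j" "b < j"
      using positions by linarith
    then show ?thesis
    proof cases
      case old
      then show ?thesis
        using cross_adjacentD[OF cross indices] indices positions by (simp add: nth_snoc)
    qed (use indices adj sym in \<open>auto simp: nth_snoc\<close>)
  qed
  moreover have "inj_on (\<lambda>i. (F i @ [f i]) ! a) I" if "a < Suc j" for a
    using cross inj that by (cases "a < j") (auto simp: cross_adjacent_def nth_snoc inj_on_def)
  ultimately show ?thesis using cross by (simp add: cross_adjacent_def)
qed

lemma blowup_step:
  assumes finite: "finite V" and pos: "0 < h" "0 < s"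
    and family: "card I = h * s" "cross_adjacent E j I F" and extensions: "Y \<subseteq> V" "h * s \<le> card Y"
    and prefixes: "\<forall>i\<in>I. \<forall>y\<in>Y.
      F i @ [y] \<in> {R \<in> cliques E V (Suc j). 2 * card V \<le> h * card {z \<in> V. R @ [z] \<in> M}}"
  shows "\<exists>G\<subseteq>I. \<exists>F'. \<exists>Z\<subseteq>V. card G = s \<and> cross_adjacent E (Suc j) G F' \<and>
    (\<forall>i\<in>G. \<forall>z\<in>Z. F' i @ [z] \<in> M) \<and> card V \<le> card Z * (h * 2 ^ (h * s))"
proof -
  have "0 < card I" using family(1) pos by simp
  then have finite_I: "finite I" by (rule card_ge_0_finite)
  obtain f where injection: "f ` I \<subseteq> Y" "inj_on f I"
    using card_le_inj[OF finite_I finite_subset[OF extensions(1) finite]] family(1) extensions(2)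
    by auto
  define F' where "F' i = F i @ [f i]" for i
  have cross: "cross_adjacent E (Suc j) I F'"
    unfolding F'_def
  proof (rule cross_adjacent_snoc[OF family(2) injection(2)])
    show "E (F i ! a) (f i')" if "i \<in> I" "i' \<in> I" "a < j" for i i' a
      using clique_snoc_adjacent[of "F i" "f i'" V j a] prefixes injection(1) that by blast
  qed
  have "2 * card V \<le> h * card {z \<in> V. F' i @ [z] \<in> M}" if "i \<in> I" for i
    using prefixes injection(1) that unfolding F'_def by blast
  from complete_bipartite_of_dense[where P = "\<lambda>i z. F' i @ [z] \<in> M", OF finite_I finite family(1) pos this]
  obtain G Z where "G \<subseteq> I" "Z \<subseteq> V" "card G = s" "\<forall>i\<in>G. \<forall>z\<in>Z. F' i @ [z] \<in> M"
    "card V \<le> card Z * (h * 2 ^ (h * s))" by blast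
  then show ?thesis using cross_adjacent_subset[OF cross \<open>G \<subseteq> I\<close>] by blast
qed

lemma dense_singletons:
  assumes "M \<subseteq> cliques E V (Suc 0)" "card V \<le> h * card M" "0 < h" "h * s \<le> card V"
  shows "\<exists>Y\<subseteq>V. (\<forall>y\<in>Y. [y] \<in> M) \<and> s \<le> card Y \<and> card V \<le> card Y * h"
proof -
  define Y where "Y = {y \<in> V. [y] \<in> M}"
  have "M = (\<lambda>y. [y]) ` Y" using assms(1) by (auto simp: Y_def cliques_Suc_0)
  then have "card M = card Y" by (simp add: card_image inj_on_def)
  then have card_V_le: "card V \<le> h * card Y" using assms(2) by simp
  with assms(4) have "h * s \<le> h * card Y" by (rule le_trans)
  then have "s \<le> card Y" "card V \<le> card Y * h" using assms(3) card_V_le by (simp_all add: mult.commute)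
  moreover have "Y \<subseteq> V" "\<forall>y\<in>Y. [y] \<in> M" by (auto simp: Y_def)
  ultimately show ?thesis by blast
qed

text \<open>Arbitrary dense families of tuples have no blowup of logarithmic size. For cliques it suffices
  to keep the tuples disjoint: cross adjacency is inherited by subfamilies, so each new coordinate
  costs only a factor \<open>h\<close>.\<close>

theorem complete_multipartite_blowup:
  assumes finite: "finite V" and M_subset: "M \<subseteq> cliques E V (Suc j)"
    and dense: "2 * Suc j * card V ^ Suc j \<le> h * card M" and pos: "0 < h" "0 < s"
    and large: "h * 2 ^ (h ^ j * s) * (h ^ j * s) \<le> card V"
  shows "\<exists>(I :: nat set) F. \<exists>Y\<subseteq>V. card I = s \<and> cross_adjacent E j I F \<and>
    (\<forall>i\<in>I. \<forall>y\<in>Y. F i @ [y] \<in> M) \<and> s \<le> card Y \<and> card V \<le> card Y * (h * 2 ^ (h * s))"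
  using M_subset dense pos(2) large
proof (induction j arbitrary: M s)
  case 0
  have "h * s \<le> h * 2 ^ s * s" by simp
  also have "\<dots> \<le> card V" using 0(4) by simp
  finally have "h * s \<le> card V" .
  moreover have "card V \<le> h * card M" using 0(2) by simp
  ultimately obtain Y
    where singletons: "Y \<subseteq> V" "\<forall>y\<in>Y. [y] \<in> M" "s \<le> card Y" "card V \<le> card Y * h"
    using dense_singletons[OF 0(1) _ pos(1)] by blast
  note singletons(4)
  also have "card Y * h \<le> card Y * h * 2 ^ (h * s)" by simp
  finally have "card V \<le> card Y * (h * 2 ^ (h * s))" by (simp only: mult.assoc)
  then show ?case
    using singletons by (intro exI[of _ "{..<s}"] exI[of _ "\<lambda>_. []"] exI[of _ Y])
      (auto simp: cross_adjacent_def)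
next
  case (Suc j)
  define m where "m = h ^ Suc j * s"
  let ?prefixes = "{R \<in> cliques E V (Suc j). 2 * card V \<le> h * card {y \<in> V. R @ [y] \<in> M}}"
  have hs_le: "h * s \<le> m" unfolding m_def using pos(1) by (simp add: mult_le_mono)
  moreover have "s \<le> h * s" using pos(1) by simp
  ultimately have "s \<le> m" by (rule order_trans[rotated])
  then have "0 < h * 2 ^ m * m" using pos(1) Suc.prems(3) by simp
  then have V_pos: "0 < card V" using Suc.prems(4) unfolding m_def by (rule less_le_trans)
  have "\<exists>(I :: nat set) F. \<exists>Y\<subseteq>V. card I = h * s \<and> cross_adjacent E j I F \<and>
    (\<forall>i\<in>I. \<forall>y\<in>Y. F i @ [y] \<in> ?prefixes) \<and> h * s \<le> card Y \<and>
    card V \<le> card Y * (h * 2 ^ (h * (h * s)))"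
  proof (rule Suc.IH)
    show "2 * Suc j * card V ^ Suc j \<le> h * card ?prefixes"
      by (rule card_dense_prefixes_ge[OF finite V_pos Suc.prems(1,2)])
    show "h * 2 ^ (h ^ j * (h * s)) * (h ^ j * (h * s)) \<le> card V"
      using Suc.prems(4) by (simp add: mult_ac)
  qed (use pos Suc.prems(3) in auto)
  then obtain I :: "nat set" and F Y where family: "card I = h * s" "cross_adjacent E j I F" "Y \<subseteq> V"
    "h * s \<le> card Y" and prefixes: "\<forall>i\<in>I. \<forall>y\<in>Y. F i @ [y] \<in> ?prefixes"
    by blast
  from blowup_step[OF finite pos(1) Suc.prems(3) family prefixes]
  obtain G :: "nat set" and F' Z where extended: "Z \<subseteq> V" "card G = s"
    "cross_adjacent E (Suc j) G F'"
    "\<forall>i\<in>G. \<forall>z\<in>Z. F' i @ [z] \<in> M" "card V \<le> card Z * (h * 2 ^ (h * s))"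
    by blast
  have "(h * 2 ^ m) * m \<le> card Z * (h * 2 ^ (h * s))"
    using Suc.prems(4) extended(5) unfolding m_def by (rule le_trans)
  also have "\<dots> \<le> card Z * (h * 2 ^ m)"
    using hs_le by (intro mult_left_mono power_increasing) auto
  finally have "m \<le> card Z" using pos(1) by (simp add: mult.commute)
  then have "s \<le> card Z" using \<open>s \<le> m\<close> by (rule order_trans[rotated])
  then show ?case using extended by blast
qed

end

section \<open>Embedding\<close>

definition contains_copy :: "('a, 'b) pre_digraph \<Rightarrow> ('c, 'd) pre_digraph \<Rightarrow> bool" where
  "contains_copy G K \<longleftrightarrow> (\<exists>H. subgraph H G \<and> digraph_iso K H)"

lemma contains_copy_of_injective_hom:
  assumes "wf_digraph G" "pair_wf_digraph K"
    and inj: "inj_on \<phi> (pverts K)" and verts: "\<phi> ` pverts K \<subseteq> verts G"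
    and hom: "\<And>p q. (p, q) \<in> parcs K \<Longrightarrow> \<phi> p \<rightarrow>\<^bsub>G\<^esub> \<phi> q"
  shows "contains_copy G (with_proj K)"
proof -
  interpret wf_digraph G by fact
  interpret K: pair_wf_digraph K by fact
  have "\<exists>e. e \<in> arcs G \<and> tail G e = \<phi> (fst a) \<and> head G e = \<phi> (snd a)" if "a \<in> parcs K" for a
    using hom[of "fst a" "snd a"] that by (auto simp: arcs_ends_conv)
  then obtain \<psi> where arc_map: "\<And>a. a \<in> parcs K \<Longrightarrow>
      \<psi> a \<in> arcs G \<and> tail G (\<psi> a) = \<phi> (fst a) \<and> head G (\<psi> a) = \<phi> (snd a)" by metis
  have inj_arc_map: "inj_on \<psi> (parcs K)"
  proof (rule inj_onI)
    fix a b assume same_arc: "a \<in> parcs K" "b \<in> parcs K" "\<psi> a = \<psi> b"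
    then have "\<phi> (fst a) = \<phi> (fst b)" "\<phi> (snd a) = \<phi> (snd b)"
      using arc_map[of a] arc_map[of b] by auto
    moreover have "fst a \<in> pverts K" "fst b \<in> pverts K" "snd a \<in> pverts K" "snd b \<in> pverts K"
      using same_arc by (auto intro: K.arc_fst_in_verts K.arc_snd_in_verts)
    ultimately show "a = b" using inj by (metis inj_onD prod_eq_iff)
  qed
  define f where "f = \<lparr> iso_verts = \<phi>, iso_arcs = \<psi>, iso_head = head G, iso_tail = tail G \<rparr>"
  have iso: "K.digraph_isomorphism f"
    unfolding K.digraph_isomorphism_def f_def
    using inj inj_arc_map arc_map K.wf_digraph_axioms by simp
  let ?H = "app_iso f (with_proj K)"
  have "wf_digraph ?H" using iso by (rule K.wf_digraphI_app_iso)
  moreover have "verts ?H \<subseteq> verts G" using verts by (simp add: f_def)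
  moreover have "arcs ?H \<subseteq> arcs G" using arc_map by (auto simp: f_def)
  moreover have "compatible G ?H" by (simp add: compatible_def f_def)
  ultimately have "subgraph ?H G" unfolding subgraph_def using wf_digraph_axioms by blast
  then show ?thesis using iso unfolding contains_copy_def digraph_iso_def by blast
qed

lemma obtain_enumeration_from_pair:
  assumes "finite A" "u \<in> A" "v \<in> A" "u \<noteq> v"
  obtains L where "distinct L" "set L = A" "L ! 0 = u" "L ! 1 = v"
proof -
  obtain L where "set L = A - {u, v}" "distinct L"
    using finite_distinct_list[of "A - {u, v}"] assms(1) by auto
  then show ?thesis using assms by (intro that[of "u # v # L"]) auto
qed

lemma pverts_complete_multipartite_plus:
  "pverts (complete_multipartite_plus ss) = {(i, j). i < length ss \<and> j < ss ! i}"
  by (simp add: complete_multipartite_plus_def complete_multipartite_def Let_def)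

lemma parcs_complete_multipartite_plus:
  "parcs (complete_multipartite_plus ss) =
    {(p, q). p \<in> pverts (complete_multipartite_plus ss) \<and> q \<in> pverts (complete_multipartite_plus ss) \<and>
      fst p \<noteq> fst q} \<union> {((0, 0), (0, 1)), ((0, 1), (0, 0))}"
  by (simp add: complete_multipartite_plus_def complete_multipartite_def Let_def)

lemma enumerate_parts:
  assumes finite: "\<And>i. i < length ss \<Longrightarrow> finite (P i)"
    and size: "\<And>i. i < length ss \<Longrightarrow> ss ! i \<le> card (P i)"
    and pair: "u \<in> P 0" "v \<in> P 0" "u \<noteq> v" and not_empty: "ss \<noteq> []"
  shows "\<exists>\<phi> :: nat \<times> nat \<Rightarrow> 'a. (\<forall>i<length ss. inj_on (\<lambda>j. \<phi> (i, j)) {..<ss ! i}) \<and>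
    (\<forall>i<length ss. \<forall>j<ss ! i. \<phi> (i, j) \<in> P i) \<and> \<phi> (0, 0) = u \<and> \<phi> (0, 1) = v"
proof -
  have "\<exists>L. distinct L \<and> set L = P i \<and> (i = 0 \<longrightarrow> L ! 0 = u \<and> L ! 1 = v)" if "i < length ss" for i
  proof (cases "i = 0")
    case True
    then show ?thesis using obtain_enumeration_from_pair[OF finite[OF that]] pair by metis
  next
    case False
    then show ?thesis using finite_distinct_list[OF finite[OF that]] by auto
  qed
  then obtain L where enumeration: "\<And>i. i < length ss \<Longrightarrow> distinct (L i)"
    "\<And>i. i < length ss \<Longrightarrow> set (L i) = P i"
    and enumeration_0: "L 0 ! 0 = u" "L 0 ! 1 = v" using not_empty by (metis length_greater_0_conv)
  have length_L: "j < length (L i)" if "i < length ss" "j < ss ! i" for i j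
    using enumeration[OF that(1)] size[OF that(1)] that(2) distinct_card[of "L i"] by simp
  define \<phi> where "\<phi> = (\<lambda>(i, j). L i ! j)"
  have "inj_on (\<lambda>j. \<phi> (i, j)) {..<ss ! i}" if "i < length ss" for i
    using enumeration(1)[OF that] length_L[OF that]
    by (simp add: \<phi>_def inj_on_def nth_eq_iff_index_eq)
  moreover have "\<phi> (i, j) \<in> P i" if "i < length ss" "j < ss ! i" for i j
    using nth_mem[OF length_L[OF that]] enumeration(2)[OF that(1)] by (simp add: \<phi>_def)
  ultimately show ?thesis using enumeration_0 by (intro exI[of _ \<phi>]) (simp add: \<phi>_def)
qed

lemma contains_copy_complete_multipartite_plus:
  fixes P :: "nat \<Rightarrow> 'a set" and G :: "('a, 'b) pre_digraph"
  assumes "graph G" and sizes: "ss \<noteq> []" "2 \<le> ss ! 0"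
    and parts: "\<And>i. i < length ss \<Longrightarrow> P i \<subseteq> verts G" "\<And>i. i < length ss \<Longrightarrow> ss ! i \<le> card (P i)"
    and cross: "\<And>i j a b. i < j \<Longrightarrow> j < length ss \<Longrightarrow> a \<in> P i \<Longrightarrow> b \<in> P j \<Longrightarrow> a \<rightarrow>\<^bsub>G\<^esub> b"
    and added_edge: "u \<in> P 0" "v \<in> P 0" "u \<rightarrow>\<^bsub>G\<^esub> v"
  shows "contains_copy G (with_proj (complete_multipartite_plus ss))"
proof -
  interpret graph G by fact
  interpret adjacency "dominates G" by (rule adjacency_graph) fact
  let ?K = "complete_multipartite_plus ss"
  interpret K: pair_graph ?K using sizes by (rule pair_graph_complete_multipartite_plus)
  have "finite (P i)" if "i < length ss" for i
    using parts(1)[OF that] finite_verts by (rule finite_subset)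
  moreover have "u \<noteq> v" using added_edge(3) irrefl by blast
  ultimately obtain \<phi> where inj: "\<forall>i<length ss. inj_on (\<lambda>j. \<phi> (i, j)) {..<ss ! i}"
    and mem: "\<forall>i<length ss. \<forall>j<ss ! i. \<phi> (i, j) \<in> P i" and edge: "\<phi> (0, 0) = u" "\<phi> (0, 1) = v"
    using enumerate_parts[where P = P, OF _ parts(2) added_edge(1,2) _ sizes(1)] by blast
  have different_parts: "\<phi> p \<rightarrow>\<^bsub>G\<^esub> \<phi> q"
    if "p \<in> pverts ?K" "q \<in> pverts ?K" "fst p \<noteq> fst q" for p q
  proof -
    obtain i j i' j' where components: "p = (i, j)" "q = (i', j')" by (metis surj_pair)
    with that have "\<phi> p \<in> P i" "\<phi> q \<in> P i'" "i < length ss" "i' < length ss" "i \<noteq> i'"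
      using mem by (auto simp: pverts_complete_multipartite_plus)
    then show ?thesis using cross sym by (metis nat_neq_iff)
  qed
  show ?thesis
  proof (rule contains_copy_of_injective_hom[of _ _ \<phi>])
    show "\<phi> ` pverts ?K \<subseteq> verts G"
      using mem parts(1) by (fastforce simp: pverts_complete_multipartite_plus)
    show "\<phi> p \<rightarrow>\<^bsub>G\<^esub> \<phi> q" if "(p, q) \<in> parcs ?K" for p q
      using that edge added_edge(3) sym
      by (auto simp: parcs_complete_multipartite_plus intro: different_parts)
    show "inj_on \<phi> (pverts ?K)"
    proof (rule inj_onI)
      fix p q assume same_image: "p \<in> pverts ?K" "q \<in> pverts ?K" "\<phi> p = \<phi> q"
      then have "fst p = fst q" using different_parts irrefl by metis
      then show "p = q"
        using same_image inj by (auto simp: pverts_complete_multipartite_plus inj_on_def)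
    qed
  qed unfold_locales
qed

context adjacency
begin

lemma tail_joined_snoc_nth:
  assumes "R @ [y] \<in> tail_joined_cliques E V (Suc k) A" "w \<in> A" "0 < a" "a < k"
  shows "E w (R ! a)"
proof -
  have "length R = k" using assms(1) by (simp add: tail_joined_cliques_def cliques_def)
  then obtain x xs where R_Cons: "R = x # xs" using assms(4) by (cases R) auto
  then have "R ! a \<in> set xs" using assms(3,4) \<open>length R = k\<close> by (cases a) auto
  then show ?thesis
    using assms(1,2) sym by (auto simp: R_Cons tail_joined_cliques_def common_nbrs_def)
qed

lemma tail_joined_snoc_last:
  assumes "R @ [y] \<in> tail_joined_cliques E V (Suc k) A" "w \<in> A" "0 < k"
  shows "E w y"
proof -
  have "R \<noteq> []" using assms(1,3) by (auto simp: tail_joined_cliques_def cliques_def)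
  then show ?thesis using assms(1,2) sym by (auto simp: tail_joined_cliques_def common_nbrs_def)
qed

lemma tl_snoc_in_tail_joined_cliques:
  assumes cross: "cross_adjacent E (Suc k) I F" and "0 < k" and indices: "i \<in> I" "i' \<in> I"
    and clique: "F i @ [y] \<in> cliques E V (Suc (Suc k))" "F i' @ [y] \<in> cliques E V (Suc (Suc k))"
  shows "tl (F i) @ [y] \<in> tail_joined_cliques E V (Suc k) {F i' ! 0, F i' ! 1}"
proof -
  have lengths: "length (F i) = Suc k" "length (F i') = Suc k"
    using cross_adjacent_length[OF cross] indices by auto
  obtain x1 x2 xs where F_Cons: "F i = x1 # x2 # xs"
    using lengths(1) \<open>0 < k\<close> by (metis length_Suc_conv gr0_conv_Suc)
  have joined: "E z (F i' ! b)" if z_mem: "z \<in> set (xs @ [y])" and b_less: "b < 2" for z b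
  proof (cases "z = y")
    case True
    then show ?thesis using clique_snoc_adjacent[OF clique(2), of b] b_less \<open>0 < k\<close> sym by simp
  next
    case False
    then obtain a where "a < length xs" "z = F i ! Suc (Suc a)"
      using z_mem by (auto simp: F_Cons in_set_conv_nth)
    then show ?thesis
      using cross_adjacentD[OF cross indices, of "Suc (Suc a)" b] lengths(1) b_less
      by (simp add: F_Cons)
  qed
  have "F i' ! 0 \<in> V" "F i' ! 1 \<in> V"
    using clique(2) lengths(2) \<open>0 < k\<close> nth_mem[of 0 "F i'"] nth_mem[of 1 "F i'"]
    by (auto simp: cliques_def)
  moreover have "tl (F i) @ [y] \<in> cliques E V (Suc k)"
    using clique(1) by (simp add: F_Cons cliques_def)
  ultimately show ?thesis
    using joined[of _ 0] joined[of _ 1]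
    by (auto simp: tail_joined_cliques_def common_nbrs_def F_Cons)
qed

end

lemma contains_copy_of_joined_family:
  fixes G :: "('a, 'b) pre_digraph" and I :: "'i set"
  assumes graph_G: "graph G" and k_pos: "0 < k" and edge: "u \<in> verts G" "v \<in> verts G" "u \<rightarrow>\<^bsub>G\<^esub> v"
    and family: "2 \<le> card I" "cross_adjacent (dominates G) k I F"
    and last_part: "Y \<subseteq> verts G" "Y \<noteq> {}" "t \<le> card Y"
    and joined: "\<And>i y. i \<in> I \<Longrightarrow> y \<in> Y \<Longrightarrow>
      F i @ [y] \<in> tail_joined_cliques (dominates G) (verts G) (Suc k) {u, v}"
  shows "contains_copy G (with_proj (complete_multipartite_plus (replicate k (card I) @ [t])))"
proof -
  interpret graph G by fact
  interpret adjacency "dominates G" by (rule adjacency_graph) fact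
  let ?ss = "replicate k (card I) @ [t]"
  define column where "column a = (\<lambda>i. F i ! a) ` I" for a
  define P where "P a = (if a = k then Y else if a = 0 then {u, v} \<union> column 0 else column a)" for a
  obtain i0 y0 where i0_mem: "i0 \<in> I" and y0_mem: "y0 \<in> Y" using family(1) last_part(2) by fastforce
  have finite_I: "finite I" using family(1) by (metis card.infinite not_numeral_le_zero)
  have "F i @ [y] \<in> cliques (dominates G) (verts G) (Suc k)" if "i \<in> I" "y \<in> Y" for i y
    using joined[OF that] by (simp add: tail_joined_cliques_def)
  note clique = this
  have column_verts: "column a \<subseteq> verts G" if "a < k" for a
    using clique[OF _ y0_mem] that by (fastforce simp: column_def cliques_def)
  have column_column: "x \<rightarrow>\<^bsub>G\<^esub> z" if "x \<in> column a" "z \<in> column b" "a < b" "b < k" for x z a b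
    using cross_adjacentD[OF family(2)] that by (auto simp: column_def)
  have column_Y: "x \<rightarrow>\<^bsub>G\<^esub> y" if "x \<in> column a" "a < k" "y \<in> Y" for x y a
    using that clique_snoc_adjacent[OF clique] by (auto simp: column_def)
  have uv_column: "w \<rightarrow>\<^bsub>G\<^esub> x" if "w \<in> {u, v}" "x \<in> column a" "0 < a" "a < k" for w x a
    using that tail_joined_snoc_nth[OF joined[OF _ y0_mem]] by (auto simp: column_def)
  have uv_Y: "w \<rightarrow>\<^bsub>G\<^esub> y" if "w \<in> {u, v}" "y \<in> Y" for w y
    using tail_joined_snoc_last[OF joined[OF i0_mem that(2)] that(1) k_pos] .
  show ?thesis
  proof (rule contains_copy_complete_multipartite_plus[OF graph_G, where P = P and u = u and v = v])
    show "2 \<le> ?ss ! 0" using k_pos family(1) by (simp add: nth_append)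
    show "P a \<subseteq> verts G" if "a < length ?ss" for a
      using that column_verts last_part(1) edge k_pos by (auto simp: P_def)
    show "?ss ! a \<le> card (P a)" if "a < length ?ss" for a
    proof (cases "a = k")
      case False
      then have "a < k" using that by simp
      then have "card I = card (column a)"
        using cross_adjacent_inj_on[OF family(2)] by (simp add: column_def card_image)
      also have "\<dots> \<le> card (P a)"
        using \<open>a < k\<close> finite_I by (intro card_mono) (auto simp: P_def column_def)
      finally show ?thesis using \<open>a < k\<close> by (simp add: nth_append)
    qed (simp add: P_def nth_append last_part(3))
    show "x \<rightarrow>\<^bsub>G\<^esub> z" if "a < b" "b < length ?ss" "x \<in> P a" "z \<in> P b" for a b x z
      using that column_column column_Y uv_column uv_Y
      unfolding P_def by (auto split: if_splits)
    show "u \<in> P 0" "v \<in> P 0" using k_pos by (auto simp: P_def)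
  qed (use edge in simp_all)
qed

lemma contains_copy_from_tail_joined_cliques:
  fixes G :: "('a, 'b) pre_digraph"
  assumes graph_G: "graph G" and k_pos: "0 < k" and two_le_s: "2 \<le> s" and h_pos: "0 < h"
    and edge: "u \<in> verts G" "v \<in> verts G" "u \<rightarrow>\<^bsub>G\<^esub> v"
    and dense: "2 * Suc k * card (verts G) ^ Suc k \<le>
      h * card (tail_joined_cliques (dominates G) (verts G) (Suc k) {u, v})"
    and large: "h * 2 ^ (h ^ k * s) * (h ^ k * s) \<le> card (verts G)"
    and t_le: "\<And>y. card (verts G) \<le> y * (h * 2 ^ (h * s)) \<Longrightarrow> t \<le> y"
  shows "contains_copy G (with_proj (complete_multipartite_plus (replicate k s @ [t])))"
proof -
  interpret graph G by fact
  interpret A: adjacency "dominates G" by (rule adjacency_graph) fact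
  have "tail_joined_cliques (dominates G) (verts G) (Suc k) {u, v} \<subseteq> cliques (dominates G) (verts G) (Suc k)"
    by (auto simp: tail_joined_cliques_def)
  from A.complete_multipartite_blowup[OF finite_verts this dense h_pos _ large] two_le_s
  obtain I :: "nat set" and F Y where family: "card I = s" "cross_adjacent (dominates G) k I F"
    and last_part: "Y \<subseteq> verts G" "s \<le> card Y" "card (verts G) \<le> card Y * (h * 2 ^ (h * s))"
    and joined: "\<forall>i\<in>I. \<forall>y\<in>Y. F i @ [y] \<in> tail_joined_cliques (dominates G) (verts G) (Suc k) {u, v}"
    by auto
  have "Y \<noteq> {}" using last_part(2) two_le_s by auto
  then show ?thesis
    using family(1) two_le_s joined
      contains_copy_of_joined_family[OF graph_G k_pos edge _ family(2) last_part(1) _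
        t_le[OF last_part(3)]]
    by simp
qed

lemma contains_copy_from_larger_cliques:
  fixes G :: "('a, 'b) pre_digraph"
  assumes graph_G: "graph G" and k_pos: "0 < k" and two_le_s: "2 \<le> s" and h_pos: "0 < h"
    and dense: "2 * Suc (Suc k) * card (verts G) ^ Suc (Suc k) \<le>
      h * card (cliques (dominates G) (verts G) (Suc (Suc k)))"
    and large: "h * 2 ^ (h ^ Suc k * s) * (h ^ Suc k * s) \<le> card (verts G)"
    and t_le: "\<And>y. card (verts G) \<le> y * (h * 2 ^ (h * s)) \<Longrightarrow> t \<le> y"
  shows "contains_copy G (with_proj (complete_multipartite_plus (replicate k s @ [t])))"
proof -
  interpret graph G by fact
  interpret A: adjacency "dominates G" by (rule adjacency_graph) fact
  from A.complete_multipartite_blowup[OF finite_verts order_refl dense h_pos _ large] two_le_s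
  obtain I :: "nat set" and F Y where family: "card I = s"
    "cross_adjacent (dominates G) (Suc k) I F"
    and last_part: "Y \<subseteq> verts G" "s \<le> card Y" "card (verts G) \<le> card Y * (h * 2 ^ (h * s))"
    and clique: "\<forall>i\<in>I. \<forall>y\<in>Y. F i @ [y] \<in> cliques (dominates G) (verts G) (Suc (Suc k))"
    by auto
  have "Y \<noteq> {}" "I \<noteq> {}" using family(1) last_part(2) two_le_s by auto
  then obtain i0 y0 where i0_mem: "i0 \<in> I" and y0_mem: "y0 \<in> Y" by blast
  have edge: "F i0 ! 0 \<rightarrow>\<^bsub>G\<^esub> F i0 ! 1"
    using cross_adjacentD[OF family(2) i0_mem i0_mem] k_pos by simp
  have "F i0 @ [y0] \<in> cliques (dominates G) (verts G) (Suc (Suc k))"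
    using clique i0_mem y0_mem by blast
  then have "length (F i0) = Suc k" "set (F i0) \<subseteq> verts G" by (auto simp: cliques_def)
  then have ends: "F i0 ! 0 \<in> verts G" "F i0 ! 1 \<in> verts G" using k_pos by auto
  have "tl (F i) @ [y] \<in> tail_joined_cliques (dominates G) (verts G) (Suc k) {F i0 ! 0, F i0 ! 1}"
    if "i \<in> I" "y \<in> Y" for i y
    using A.tl_snoc_in_tail_joined_cliques[OF family(2) k_pos that(1) i0_mem] clique that i0_mem
    by blast
  then show ?thesis
    using contains_copy_of_joined_family[OF graph_G k_pos ends edge _ cross_adjacent_tl[OF family(2)]
      last_part(1) \<open>Y \<noteq> {}\<close> t_le[OF last_part(3)]]
      family(1) two_le_s by simp
qed

section \<open>The quantitative estimates\<close>

lemma two_power_le_exp: "(2 :: real) ^ k \<le> exp (real k)"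
proof -
  have "(2 :: real) ^ k \<le> exp 1 ^ k" using exp_ge_add_one_self[of 1] by (intro power_mono) auto
  then show ?thesis by (simp add: exp_of_nat_mult[symmetric])
qed

lemma le_exp_self: "x \<le> exp x" for x :: real
  using exp_ge_add_one_self[of x] by linarith

lemma blowup_order_le:
  fixes c :: real
  assumes c_bounds: "0 < c" "2 / c \<le> ln (real n)" and n_pos: "0 < n"
    and h_bounds: "1 \<le> h" "1 \<le> e" "4 * c * real h ^ e \<le> 1" and s_le: "real s \<le> c * ln (real n)"
  shows "h * 2 ^ (h ^ e * s) * (h ^ e * s) \<le> n"
proof -
  define L where "L = ln (real n)"
  define m where "m = h ^ e * s"
  have "0 < 2 / c" using c_bounds(1) by simp
  then have L_pos: "0 < L" using c_bounds(2) unfolding L_def by (rule less_le_trans)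
  have "real m \<le> real h ^ e * (c * L)" using s_le by (simp add: m_def L_def mult_left_mono)
  also have "\<dots> = (4 * c * real h ^ e) * (L / 4)" by simp
  also have "\<dots> \<le> 1 * (L / 4)" using h_bounds(3) L_pos by (intro mult_right_mono) auto
  finally have m_le: "real m \<le> L / 4" by simp
  then have "real m \<le> exp (L / 4)" using le_exp_self by (rule order_trans)
  moreover have "(2 :: real) ^ m \<le> exp (L / 4)"
    using two_power_le_exp m_le by (rule order_trans[OF _ exp_le_cancel_iff[THEN iffD2]])
  moreover have "real h \<le> exp (L / 4)"
  proof -
    have "real h \<le> real h ^ e" using h_bounds by (simp add: self_le_power)
    also have "\<dots> \<le> 1 / (4 * c)" using h_bounds c_bounds by (simp add: field_simps)
    also have "\<dots> \<le> L / 4" using c_bounds by (simp add: L_def field_simps)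
    also have "\<dots> \<le> exp (L / 4)" by (rule le_exp_self)
    finally show ?thesis .
  qed
  ultimately have "real h * 2 ^ m * real m \<le> exp (L / 4) * exp (L / 4) * exp (L / 4)"
    by (intro mult_mono) auto
  also have "\<dots> = exp (L / 4 + L / 4 + L / 4)" by (simp only: exp_add)
  also have "\<dots> \<le> exp L" using L_pos by simp
  also have "\<dots> = real n" using n_pos by (simp add: L_def)
  finally have "real (h * 2 ^ m * m) \<le> real n" by simp
  then show ?thesis unfolding m_def by (simp only: of_nat_le_iff)
qed

lemma ceiling_powr_le_of_blowup:
  fixes c :: real
  assumes c_bounds: "0 < c" "2 / c \<le> ln (real n)" and n_pos: "0 < n"
    and h_bounds: "1 \<le> h" "4 * c * (real h)\<^sup>2 \<le> 1" and s_le: "real s \<le> c * ln (real n)"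
    and order_le: "n \<le> y * (h * 2 ^ (h * s))"
  shows "nat \<lceil>real n powr (1 - sqrt c)\<rceil> \<le> y"
proof -
  define L where "L = ln (real n)"
  have "0 < 2 / c" using c_bounds(1) by simp
  then have L_pos: "0 < L" using c_bounds(2) unfolding L_def by (rule less_le_trans)
  have "(2 * sqrt c * real h)\<^sup>2 \<le> 1\<^sup>2" using h_bounds(2) c_bounds by (simp add: power_mult_distrib)
  then have sqrt_mult_base_le: "2 * sqrt c * real h \<le> 1" by (rule power2_le_imp_le) simp
  have "real (h * s) \<le> real h * (c * L)" using s_le by (simp add: L_def mult_left_mono)
  also have "\<dots> = (sqrt c * L / 2) * (2 * sqrt c * real h)" using c_bounds by simp
  also have "\<dots> \<le> (sqrt c * L / 2) * 1"
    using sqrt_mult_base_le c_bounds L_pos by (intro mult_left_mono) auto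
  finally have "real (h * s) \<le> sqrt c * L / 2" by simp
  then have power_le: "(2 :: real) ^ (h * s) \<le> exp (sqrt c * L / 2)"
    using two_power_le_exp by (rule order_trans[OF _ exp_le_cancel_iff[THEN iffD2], rotated])
  have "2 * real h \<le> 2 / (2 * sqrt c) * 2"
    using sqrt_mult_base_le c_bounds by (simp add: field_simps)
  also have "\<dots> = sqrt c * (2 / c)" using c_bounds by (simp add: field_simps)
  also have "\<dots> \<le> sqrt c * L" unfolding L_def using c_bounds by (intro mult_left_mono) auto
  finally have "real h \<le> exp (sqrt c * L / 2)" using le_exp_self[of "sqrt c * L / 2"] by simp
  with power_le have "real n powr (1 - sqrt c) * (real h * 2 ^ (h * s)) \<le>
      exp ((1 - sqrt c) * L) * (exp (sqrt c * L / 2) * exp (sqrt c * L / 2))"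
    using n_pos by (intro mult_mono) (auto simp: powr_def L_def)
  also have "\<dots> = exp ((1 - sqrt c) * L + (sqrt c * L / 2 + sqrt c * L / 2))" by (simp only: exp_add)
  also have "\<dots> = exp L" by (simp add: algebra_simps)
  also have "\<dots> = real n" using n_pos by (simp add: L_def)
  also have "\<dots> \<le> real (y * (h * 2 ^ (h * s)))" using order_le by (simp only: of_nat_le_iff)
  finally have "real n powr (1 - sqrt c) * (real h * 2 ^ (h * s)) \<le> real y * (real h * 2 ^ (h * s))"
    by simp
  then have "real n powr (1 - sqrt c) \<le> real y"
    by (rule mult_right_le_imp_le) (use h_bounds in simp)
  then show ?thesis by (simp add: ceiling_le_iff nat_le_iff)
qed

text \<open>For \<open>r = 2\<close> the base has to lie between \<open>2 powr 17.8\<close> (by \<open>blowup_base_ge_cliques\<close>) and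
  \<open>2 powr 18.5\<close> (by \<open>blowup_base_le\<close>).\<close>

definition blowup_base :: "nat \<Rightarrow> nat" where
  "blowup_base r = 2 ^ 12 * r ^ (2 * r + 2)"

lemma blowup_base_pos: "2 \<le> r \<Longrightarrow> 1 \<le> blowup_base r"
  by (simp add: blowup_base_def)

lemma two_power_le_self_power:
  assumes "2 \<le> r"
  shows "(2 :: nat) ^ (12 * r + 2) \<le> r ^ (9 * r + 9)"
proof (cases "r = 2")
  case False
  then have "3 \<le> r" using assms by simp
  have "(2 :: nat) ^ (12 * r + 2) \<le> 2 ^ (3 * (4 * r + 1))" by (rule power_increasing) auto
  also have "\<dots> = 8 ^ (4 * r + 1)" by (subst power_mult) simp
  also have "\<dots> \<le> 9 ^ (4 * r + 1)" by (rule power_mono) auto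
  also have "\<dots> = 3 ^ (2 * (4 * r + 1))" by (subst power_mult) simp
  also have "\<dots> \<le> r ^ (2 * (4 * r + 1))" using \<open>3 \<le> r\<close> by (rule power_mono) simp
  also have "\<dots> \<le> r ^ (9 * r + 9)" using assms by (intro power_increasing) auto
  finally show ?thesis .
qed simp

lemma blowup_base_le:
  fixes c :: real
  assumes two_le_r: "2 \<le> r" and c_bounds: "0 < c" "c \<le> 1 / real r ^ ((2 * r + 9) * (r + 1))"
  shows "4 * c * real (blowup_base r) ^ r \<le> 1"
proof -
  have "4 * blowup_base r ^ r = 2 ^ (12 * r + 2) * r ^ ((2 * r + 2) * r)"
    unfolding blowup_base_def power_mult_distrib power_mult[symmetric] by (simp add: power_add)
  also have "\<dots> \<le> r ^ (9 * r + 9) * r ^ ((2 * r + 2) * r)"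
    using two_power_le_self_power[OF two_le_r] by (rule mult_right_mono) simp
  also have "\<dots> = r ^ ((2 * r + 9) * (r + 1))"
    unfolding power_add[symmetric]
    by (rule arg_cong[where f = "\<lambda>k. r ^ k"]) (simp add: algebra_simps)
  finally have "real (4 * blowup_base r ^ r) \<le> real (r ^ ((2 * r + 9) * (r + 1)))"
    by (simp only: of_nat_le_iff)
  then have "c * (4 * real (blowup_base r) ^ r) \<le> c * real r ^ ((2 * r + 9) * (r + 1))"
    using c_bounds(1) by (intro mult_left_mono) auto
  also have "\<dots> \<le> 1" using c_bounds two_le_r by (simp add: field_simps)
  finally show ?thesis by simp
qed

lemma two_power_fact_le: "1 \<le> r \<Longrightarrow> 2 ^ r * fact r \<le> 2 * real r ^ r"
proof (induction r rule: nat_induct_at_least)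
  case base
  then show ?case by simp
next
  case (Suc r)
  have "2 \<le> 1 + real r * (1 / real r)" using Suc.hyps by simp
  also have "\<dots> \<le> (1 + 1 / real r) ^ r"
    by (rule Bernoulli_inequality) (rule order_trans[of _ 0], auto)
  finally have "2 * real r ^ r \<le> (1 + 1 / real r) ^ r * real r ^ r" by (rule mult_right_mono) auto
  also have "\<dots> = real (Suc r) ^ r"
    using Suc.hyps by (simp add: power_mult_distrib[symmetric] field_simps)
  finally have ratio_bound: "2 * real r ^ r \<le> real (Suc r) ^ r" .
  have "2 ^ Suc r * fact (Suc r) = 2 * real (Suc r) * (2 ^ r * fact r)" by (simp add: algebra_simps)
  also have "\<dots> \<le> 2 * real (Suc r) * real (Suc r) ^ r"
    using Suc.IH ratio_bound by (intro mult_left_mono) auto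
  finally show ?case by (simp only: power_Suc mult.assoc)
qed

lemma blowup_base_ge_edge:
  assumes two_le_r: "2 \<le> r"
  shows "4 * real r * ((2 * real r) ^ r * fact (Suc r)) \<le> real (blowup_base r)"
proof -
  have "4 * real r * ((2 * real r) ^ r * fact (Suc r)) =
      4 * real r * real r ^ r * ((real r + 1) * (2 ^ r * fact r))"
    by (simp add: power_mult_distrib algebra_simps)
  also have "\<dots> \<le> 4 * real r * real r ^ r * ((2 * real r) * (2 * real r ^ r))"
    using two_le_r by (intro mult_left_mono mult_mono[OF _ two_power_fact_le]) auto
  also have "\<dots> = 16 * (real r ^ r * real r ^ r * (real r * real r))" by simp
  also have "\<dots> = 16 * real r ^ (2 * r + 2)" by (simp only: power_add mult_2 power2_eq_square)
  also have "\<dots> \<le> real (blowup_base r)" by (simp add: blowup_base_def)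
  finally show ?thesis .
qed

lemma blowup_base_ge_cliques:
  assumes two_le_r: "2 \<le> r"
  shows "24576 * (real r + 1) * real r ^ (r + 3) \<le> real (blowup_base r) * (5 * fact r)"
proof -
  have "6 * (real r + 1) * real r \<le> real r ^ r * (5 * fact r)"
  proof (cases "r = 2")
    case False
    then have "3 \<le> r" using two_le_r by simp
    have "6 * (real r + 1) * real r \<le> 6 * (2 * real r) * real r"
      using two_le_r by (intro mult_right_mono mult_left_mono) auto
    also have "\<dots> \<le> real r ^ 3 * (5 * 1)"
      using \<open>3 \<le> r\<close> by (simp add: power3_eq_cube)
    also have "\<dots> \<le> real r ^ r * (5 * fact r)"
      using \<open>3 \<le> r\<close> by (intro mult_mono power_increasing) (auto simp: fact_ge_1)
    finally show ?thesis .
  qed simp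
  then have "(6 * (real r + 1) * real r) * (4096 * real r ^ (r + 2)) \<le>
      (real r ^ r * (5 * fact r)) * (4096 * real r ^ (r + 2))"
    by (rule mult_right_mono) simp
  moreover have "real r ^ (r + 3) = real r * real r ^ (r + 2)"
    by (simp add: numeral_3_eq_3)
  moreover have "real (blowup_base r) = 4096 * (real r ^ r * real r ^ (r + 2))"
    unfolding power_add[symmetric] by (simp add: blowup_base_def mult_2 add.assoc)
  ultimately show ?thesis by (simp add: mult_ac)
qed

lemma one_minus_inverse_power_ge:
  assumes two_le_r: "2 \<le> r"
  shows "1 / 12 \<le> (1 - 1 / real r) ^ Suc r"
proof -
  obtain k where r_Suc: "r = Suc k" "0 < k" using two_le_r by (cases r) auto
  have "(1 + 1 / real k) ^ k \<le> exp (1 / real k) ^ k"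
    using exp_ge_add_one_self[of "1 / real k"] by (intro power_mono) auto
  also have "\<dots> = exp 1" using r_Suc by (simp add: exp_of_nat_mult[symmetric])
  also have "\<dots> \<le> 3" by (rule exp_le)
  finally have "(1 + 1 / real k) ^ k \<le> 3" .
  moreover have "0 < (1 + 1 / real k) ^ k" by (intro zero_less_power add_pos_nonneg) auto
  ultimately have "1 / 3 \<le> (1 / (1 + 1 / real k)) ^ k" by (simp add: power_one_over field_simps)
  also have "1 / (1 + 1 / real k) = 1 - 1 / real r" using r_Suc by (simp add: field_simps)
  finally have "1 / 3 \<le> (1 - 1 / real r) ^ k" .
  moreover have "(1 / 2)\<^sup>2 \<le> (1 - 1 / real r)\<^sup>2"
    using two_le_r by (intro power_mono) (auto simp: field_simps)
  ultimately have "1 / 3 * (1 / 2)\<^sup>2 \<le> (1 - 1 / real r) ^ k * (1 - 1 / real r)\<^sup>2"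
    by (intro mult_mono) auto
  also have "\<dots> = (1 - 1 / real r) ^ Suc r" unfolding power_add[symmetric] r_Suc by simp
  finally show ?thesis by (simp add: power2_eq_square)
qed

lemma power_one_minus_ge:
  fixes a x :: real
  assumes "0 \<le> a" "x \<le> 1"
  shows "(1 - real k * x) * a ^ k \<le> ((1 - x) * a) ^ k"
proof -
  have "1 + real k * (- x) \<le> (1 + - x) ^ k" using assms(2) by (intro Bernoulli_inequality) simp
  then have "(1 - real k * x) * a ^ k \<le> (1 - x) ^ k * a ^ k"
    using assms(1) by (intro mult_right_mono) auto
  then show ?thesis by (simp only: power_mult_distrib)
qed

lemma remaining_degree_ge:
  fixes k n r :: real
  assumes two_le_r: "2 \<le> r" and n_nonneg: "0 \<le> n" and order_ge: "(1 - 1 / (4 * r)) * n \<le> k"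
  shows "(1 - 3 / (4 * r)) * (n / (2 * r)) \<le> k - (r - 1 / 2) * ((1 / r + 1 / (4 * r ^ 3)) * k)"
proof -
  have "(1 - 3 / (4 * r)) * (n / (2 * r)) \<le>
      (1 - 1 / (2 * r)) * (1 / (2 * r)) * ((1 - 1 / (4 * r)) * n)"
    using two_le_r n_nonneg by (simp add: field_simps)
  also have "\<dots> \<le> (1 - 1 / (2 * r)) * (1 / (2 * r)) * k"
    using order_ge two_le_r by (intro mult_left_mono mult_nonneg_nonneg) (auto simp: field_simps)
  also have "\<dots> \<le> (1 / (2 * r) - (r - 1 / 2) * (1 / (4 * r ^ 3))) * k"
  proof (rule mult_right_mono)
    show "(1 - 1 / (2 * r)) * (1 / (2 * r)) \<le> 1 / (2 * r) - (r - 1 / 2) * (1 / (4 * r ^ 3))"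
      using two_le_r by (simp add: field_simps power3_eq_cube)
    have "0 \<le> (1 - 1 / (4 * r)) * n"
      using two_le_r n_nonneg by (intro mult_nonneg_nonneg) (auto simp: field_simps)
    then show "0 \<le> k" using order_ge by (rule order_trans)
  qed
  also have "\<dots> = k - (r - 1 / 2) * ((1 / r + 1 / (4 * r ^ 3)) * k)"
    using two_le_r by (simp add: field_simps)
  finally show ?thesis .
qed

context adjacency
begin

lemma many_tail_joined_cliques:
  fixes n r :: nat
  assumes finite: "finite S" and two_le_r: "2 \<le> r"
    and order: "(1 - 1 / (4 * real r)) * real n \<le> real (card S)"
    and deg: "\<And>w. w \<in> S \<Longrightarrow>
      (1 - 1 / real r - 1 / (4 * real r ^ 3)) * real (card S) < real (card (nbrs E S w))"
    and clique: "cliques E S (Suc r) \<noteq> {}"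
  shows "\<exists>u\<in>S. \<exists>v\<in>S. E u v \<and>
    2 * r * n ^ r \<le> blowup_base r * card (tail_joined_cliques E S r {u, v})"
proof -
  define k where "k = real (card S)"
  define D where "D = (1 / real r + 1 / (4 * real r ^ 3)) * k"
  define g where "g = (1 - 3 / (4 * real r)) * (real n / (2 * real r))"
  have "k - D \<le> real (card (nbrs E S w))" if "w \<in> S" for w
    using deg[OF that] by (simp add: k_def D_def algebra_simps)
  moreover have "0 \<le> D" by (simp add: D_def k_def)
  moreover have "0 \<le> g"
    unfolding g_def using two_le_r by (intro mult_nonneg_nonneg) (auto simp: field_simps)
  moreover have "g \<le> k - (real r - 1 / 2) * D"
    unfolding g_def D_def using two_le_r order by (intro remaining_degree_ge) (auto simp: k_def)
  ultimately obtain u v where edge: "u \<in> S" "v \<in> S" "E u v"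
    and many: "2 * g ^ r / fact (Suc r) \<le> real (card (tail_joined_cliques E S r {u, v}))"
    using many_cliques_on_an_edge[OF finite _ clique, of D g] two_le_r unfolding k_def by auto
  let ?M = "tail_joined_cliques E S r {u, v}"
  have "1 / 4 * (real n / (2 * real r)) ^ r \<le> g ^ r"
    using power_one_minus_ge[of "real n / (2 * real r)" "3 / (4 * real r)" r] two_le_r
    by (simp add: g_def field_simps)
  then have "2 * (1 / 4 * (real n / (2 * real r)) ^ r) / fact (Suc r) \<le> 2 * g ^ r / fact (Suc r)"
    by (intro divide_right_mono mult_left_mono) auto
  also note many
  finally have
    "2 * real r * real n ^ r \<le> 4 * real r * ((2 * real r) ^ r * fact (Suc r)) * real (card ?M)"
    using two_le_r by (simp add: field_simps power_divide del: fact_Suc)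
  also have "\<dots> \<le> real (blowup_base r) * real (card ?M)"
    using blowup_base_ge_edge[OF two_le_r] by (intro mult_right_mono) auto
  finally have "real (2 * r * n ^ r) \<le> real (blowup_base r * card ?M)" by simp
  then have "2 * r * n ^ r \<le> blowup_base r * card ?M" by (simp only: of_nat_le_iff)
  then show ?thesis using edge by blast
qed

lemma spectral_radius_power_ge:
  fixes n r :: nat
  assumes two_le_r: "2 \<le> r" and order: "(1 - 1 / (4 * real r)) * real n \<le> real (card S)"
    and radius: "(1 - 1 / real r) * real (card S) \<le> spectral_radius E S"
  shows "5 / 96 * real n ^ Suc r \<le> spectral_radius E S ^ Suc r"
proof -
  have "5 / 8 * real n ^ Suc r \<le> (1 - real (Suc r) * (1 / (4 * real r))) * real n ^ Suc r"
    using two_le_r by (intro mult_right_mono) (auto simp: field_simps)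
  also have "\<dots> \<le> ((1 - 1 / (4 * real r)) * real n) ^ Suc r"
    using two_le_r by (intro power_one_minus_ge) (auto simp: field_simps)
  also have "\<dots> \<le> real (card S) ^ Suc r"
    using two_le_r by (intro power_mono[OF order] mult_nonneg_nonneg) (auto simp: field_simps)
  finally have
    "1 / 12 * (5 / 8 * real n ^ Suc r) \<le> (1 - 1 / real r) ^ Suc r * real (card S) ^ Suc r"
    using one_minus_inverse_power_ge[OF two_le_r] two_le_r by (intro mult_mono) auto
  also have "\<dots> = ((1 - 1 / real r) * real (card S)) ^ Suc r" by (simp only: power_mult_distrib)
  also have "\<dots> \<le> spectral_radius E S ^ Suc r"
    using two_le_r by (intro power_mono[OF radius] mult_nonneg_nonneg) auto
  finally show ?thesis by simp
qed

lemma many_cliques_of_spectral_density: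
  fixes n r :: nat
  assumes finite: "finite S" and two_le_r: "2 \<le> r"
    and order: "(1 - 1 / (4 * real r)) * real n \<le> real (card S)"
    and density: "1 - 1 / real r + 1 / (128 * real r ^ 4) \<le> spectral_density E S"
  shows "2 * Suc r * n ^ Suc r \<le> blowup_base r * card (cliques E S (Suc r))"
proof -
  define \<sigma> where "\<sigma> = 1 - spectral_density E S"
  let ?C = "real (card (cliques E S (Suc r)))"
  have gain: "0 < 1 / (128 * real r ^ 4)" using two_le_r by simp
  moreover have "0 \<le> 1 - 1 / real r" using two_le_r by simp
  ultimately have "0 < spectral_density E S" using density by linarith
  then have "S \<noteq> {}" "0 < real (card S)" by (auto simp: spectral_density_def zero_less_divide_iff)
  have "1 - 1 / real r \<le> spectral_density E S" using density gain by linarith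
  then have radius: "(1 - 1 / real r) * real (card S) \<le> spectral_radius E S"
    using \<open>0 < real (card S)\<close> by (simp add: spectral_density_def field_simps)
  have "real r * \<sigma> \<le> real r * (1 / real r - 1 / (128 * real r ^ 4))"
    using density by (intro mult_left_mono) (auto simp: \<sigma>_def)
  also have "\<dots> = 1 - 1 / (128 * real r ^ 3)"
    using two_le_r by (simp add: field_simps eval_nat_numeral)
  finally have deficit_le: "1 / (128 * real r ^ 3) \<le> 1 - real r * \<sigma>" by simp
  moreover have "0 < 1 / (128 * real r ^ 3)" using two_le_r by simp
  ultimately have deficit_less: "real r * \<sigma> < 1" by linarith
  have "fact r / real r ^ r * (1 / (128 * real r ^ 3)) \<le> fact r / real r ^ r * (1 - real r * \<sigma>)"
    using deficit_le by (intro mult_left_mono) auto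
  also have "\<dots> \<le> (\<Prod>k\<le>r. 1 - real k * \<sigma>)"
    using two_le_r deficit_less by (intro prod_one_minus_ge) auto
  finally have "5 / 96 * real n ^ Suc r * (fact r / real r ^ r * (1 / (128 * real r ^ 3)))
      \<le> spectral_radius E S ^ Suc r * (\<Prod>k\<le>r. 1 - real k * \<sigma>)"
    using spectral_radius_power_ge[OF two_le_r order radius]
      spectral_radius_nonneg[OF finite \<open>S \<noteq> {}\<close>]
    by (intro mult_mono) auto
  also have "\<dots> \<le> ?C"
    by (rule card_cliques_spectral_ge[OF finite \<open>S \<noteq> {}\<close> \<sigma>_def deficit_less])
  finally have "5 * fact r * real n ^ Suc r \<le> 12288 * real r ^ (r + 3) * ?C"
    using two_le_r by (simp add: power_add divide_simps mult_ac del: power_Suc)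
  from mult_left_mono[OF this, of "2 * (real r + 1)"]
  have "(5 * fact r) * (2 * (real r + 1) * real n ^ Suc r) \<le> 24576 * (real r + 1) * real r ^ (r + 3) * ?C"
    by (simp add: algebra_simps del: power_Suc)
  also have "\<dots> \<le> real (blowup_base r) * (5 * fact r) * ?C"
    using blowup_base_ge_cliques[OF two_le_r] by (intro mult_right_mono) auto
  also have "\<dots> = (5 * fact r) * (real (blowup_base r) * ?C)" by (simp only: mult_ac)
  finally have "2 * (real r + 1) * real n ^ Suc r \<le> real (blowup_base r) * ?C"
    by (rule mult_left_le_imp_le) simp
  then have "real (2 * Suc r * n ^ Suc r) \<le> real (blowup_base r * card (cliques E S (Suc r)))"
    by (simp add: algebra_simps)
  then show ?thesis by (simp only: of_nat_le_iff)
qed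

end

section \<open>The theorem\<close>

definition deletion_tolerance :: "nat \<Rightarrow> real" where
  "deletion_tolerance r = 1 / (4 * real r ^ 3)"

definition deletion_gain :: "nat \<Rightarrow> nat \<Rightarrow> real" where
  "deletion_gain r n = deletion_tolerance r / (4 * real n)"

definition deletion_limit :: "nat \<Rightarrow> nat \<Rightarrow> nat" where
  "deletion_limit r n = nat \<lfloor>real n / (4 * real r)\<rfloor>"

lemma deletion_tolerance_bounds:
  assumes "2 \<le> r"
  shows "0 < deletion_tolerance r" "deletion_tolerance r \<le> 1 / 32"
proof -
  show "0 < deletion_tolerance r" using assms by (simp add: deletion_tolerance_def)
  have "2 ^ 3 \<le> real r ^ 3" using assms by (intro power_mono) auto
  then have "1 / (4 * real r ^ 3) \<le> 1 / 32" using assms by (intro divide_left_mono) auto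
  then show "deletion_tolerance r \<le> 1 / 32" by (simp add: deletion_tolerance_def)
qed

lemma deletion_gain_bounds:
  assumes "2 \<le> r" "0 < n"
  shows "0 < deletion_gain r n" "deletion_gain r n \<le> deletion_tolerance r / 4"
proof -
  note tolerance_pos = deletion_tolerance_bounds(1)[OF assms(1)]
  then show "0 < deletion_gain r n" using assms(2) by (simp add: deletion_gain_def)
  show "deletion_gain r n \<le> deletion_tolerance r / 4"
    unfolding deletion_gain_def using assms(2) tolerance_pos by (intro divide_left_mono) auto
qed

lemma turan_defect_less_deletion_gain:
  assumes "2 \<le> r" "1024 * real r ^ 5 \<le> real n"
  shows "real r / (real n)\<^sup>2 < deletion_gain r n"
proof -
  have "16 * real r ^ 4 \<le> 16 * real r ^ 5"
    using assms(1) by (intro mult_left_mono power_increasing) auto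
  also have "\<dots> < 1024 * real r ^ 5" using assms(1) by simp
  finally have "real r * (16 * real r ^ 3) < real n" using assms(2) by (simp add: eval_nat_numeral)
  then have "real r < real n / (16 * real r ^ 3)"
    using assms(1) by (subst pos_less_divide_eq) auto
  moreover from this have "0 < n" by (cases n) auto
  ultimately have "real r / (real n)\<^sup>2 < real n / (16 * real r ^ 3) / (real n)\<^sup>2"
    by (intro divide_strict_right_mono) auto
  also have "\<dots> = deletion_gain r n"
    by (simp add: deletion_gain_def deletion_tolerance_def power2_eq_square)
  finally show ?thesis .
qed

lemma deletion_gain_le:
  assumes "2 \<le> r" "1024 * real r ^ 5 \<le> real n"
  shows "deletion_gain r n \<le> 1 / (256 * real r ^ 4)"
proof -
  have "16 * real r \<le> 1024 * real r ^ 5" using assms(1) by (intro mult_mono self_le_power) auto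
  then have "16 * real r \<le> real n" using assms(2) by simp
  then have "16 * real r ^ 3 * (16 * real r) \<le> 16 * real r ^ 3 * real n"
    by (intro mult_left_mono) auto
  then have "256 * real r ^ 4 \<le> 16 * real r ^ 3 * real n" by (simp add: eval_nat_numeral)
  then have "1 / (16 * real r ^ 3 * real n) \<le> 1 / (256 * real r ^ 4)"
    using assms(1) \<open>16 * real r \<le> real n\<close> by (intro divide_left_mono mult_pos_pos) auto
  then show ?thesis by (simp add: deletion_gain_def deletion_tolerance_def)
qed

lemma order_after_deletion_ge:
  assumes "j \<le> deletion_limit r n"
  shows "(1 - 1 / (4 * real r)) * real n \<le> real (n - j)"
proof -
  have "real j \<le> real n / (4 * real r)"
    using assms by (simp add: deletion_limit_def le_nat_iff le_floor_iff)
  moreover have "real n - real j \<le> real (n - j)" by linarith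
  moreover have "(1 - 1 / (4 * real r)) * real n = real n - real n / (4 * real r)"
    by (simp add: algebra_simps)
  ultimately show ?thesis by linarith
qed

lemma tolerance_mult_order_after_deletion_ge:
  assumes "2 \<le> r" "1024 * real r ^ 5 \<le> real n"
  shows "10 \<le> deletion_tolerance r * real (n - deletion_limit r n)"
proof -
  have "80 * real r ^ 3 \<le> 1024 * real r ^ 5"
    using assms(1) by (intro mult_mono power_increasing) auto
  then have "80 * real r ^ 3 \<le> real n" using assms(2) by simp
  then have "10 \<le> deletion_tolerance r * (1 / 2 * real n)"
    using assms(1) by (simp add: deletion_tolerance_def field_simps)
  also have "\<dots> \<le> deletion_tolerance r * real (n - deletion_limit r n)"
  proof (rule mult_left_mono)
    have "1 / 2 * real n \<le> (1 - 1 / (4 * real r)) * real n"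
      using assms(1) by (intro mult_right_mono) (auto simp: field_simps)
    also have "\<dots> \<le> real (n - deletion_limit r n)" by (rule order_after_deletion_ge) simp
    finally show "1 / 2 * real n \<le> real (n - deletion_limit r n)" .
  qed (use deletion_tolerance_bounds[OF assms(1)] in simp)
  finally show ?thesis .
qed

lemma limit_mult_deletion_gain_ge:
  assumes "2 \<le> r" "0 < n"
  shows "1 / (64 * real r ^ 4) - deletion_gain r n \<le> real (deletion_limit r n) * deletion_gain r n"
proof -
  have "real n / (4 * real r) - 1 \<le> real (deletion_limit r n)"
    unfolding deletion_limit_def by linarith
  then have
    "(real n / (4 * real r) - 1) * deletion_gain r n \<le> real (deletion_limit r n) * deletion_gain r n"
    using deletion_gain_bounds(1)[OF assms] by (intro mult_right_mono) auto
  moreover have "real n / (4 * real r) * deletion_gain r n = 1 / (64 * real r ^ 4)"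
    using assms by (simp add: deletion_gain_def deletion_tolerance_def field_simps eval_nat_numeral)
  ultimately show ?thesis by (simp add: left_diff_distrib)
qed

context adjacency
begin

lemma clique_order_le:
  assumes "finite S" "cliques E S k \<noteq> {}"
  shows "k \<le> card S"
proof -
  obtain R where clique_list: "length R = k" "set R \<subseteq> S" "sorted_wrt E R"
    using assms(2) by (auto simp: cliques_def)
  then have "card (set R) = k" using sorted_wrt_imp_pairwise_distinct by (auto simp: distinct_card)
  then show ?thesis using card_mono[OF assms(1) clique_list(2)] by simp
qed

lemma card_gt_of_spectral_radius_gt_turan:
  assumes "finite S" "S \<noteq> {}" "0 < r"
    and "largest_eigenvalue (with_proj (turan_graph r (card S))) < spectral_radius E S"
  shows "r < card S"
proof -
  have "cliques E S (Suc r) \<noteq> {}" using spectral_turan[OF assms(1-3)] assms(4) by fastforce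
  then show ?thesis using clique_order_le[OF assms(1)] by fastforce
qed

lemma spectral_density_gt_turan_density:
  assumes "0 < r" "0 < card V"
    and radius: "largest_eigenvalue (with_proj (turan_graph r (card V))) < spectral_radius E V"
  shows "1 - 1 / real r - real r / (real (card V))\<^sup>2 < spectral_density E V"
proof -
  let ?n = "real (card V)"
  have "(1 - 1 / real r) * ?n - real r / ?n < spectral_radius E V"
    using largest_eigenvalue_turan_graph_ge[OF assms(1,2)] radius by simp
  from divide_strict_right_mono[OF this, of ?n]
  show ?thesis
    using assms(2) by (simp add: spectral_density_def diff_divide_distrib power2_eq_square)
qed

lemma spectral_radius_gt_turan_deletion:
  assumes finite: "finite V" and two_le_r: "2 \<le> r" and large: "1024 * real r ^ 5 \<le> real (card V)"
    and radius: "largest_eigenvalue (with_proj (turan_graph r (card V))) < spectral_radius E V"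
  obtains j S where "j \<le> deletion_limit r (card V)" "S \<subseteq> V" "card S = card V - j"
    "1 - 1 / real r + (real j - 1) * deletion_gain r (card V) < spectral_density E S"
    "j = deletion_limit r (card V) \<or>
      (\<forall>w\<in>S. (1 - 1 / real r - deletion_tolerance r) * real (card S) < real (card (nbrs E S w)))"
proof -
  let ?\<theta> = "1 - 1 / real r" and ?\<epsilon> = "deletion_tolerance r" and ?\<eta> = "deletion_gain r (card V)"
  have "0 < 1024 * real r ^ 5" using two_le_r by simp
  then have order_pos: "0 < card V" using large by (cases "card V") auto
  have defect: "?\<theta> - ?\<eta> < spectral_density E V"
    using spectral_density_gt_turan_density[OF _ order_pos radius]
      turan_defect_less_deletion_gain[OF two_le_r large] two_le_r
    by simp
  have "1 / 2 \<le> ?\<theta>" using two_le_r by (simp add: field_simps)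
  then have "?\<theta> - ?\<epsilon> + ?\<epsilon> / 2 \<le> spectral_density E V" "2 / 5 \<le> spectral_density E V"
    using defect deletion_tolerance_bounds[OF two_le_r] deletion_gain_bounds[OF two_le_r order_pos]
    by linarith+
  from vertex_deletion[OF finite this deletion_tolerance_bounds(1)[OF two_le_r] _
      tolerance_mult_order_after_deletion_ge[OF two_le_r large]]
  obtain j S where deleted: "j \<le> deletion_limit r (card V)" "S \<subseteq> V" "card S = card V - j"
    "spectral_density E V + real j * ?\<eta> \<le> spectral_density E S"
    "j = deletion_limit r (card V) \<or>
      (\<forall>w\<in>S. (?\<theta> - ?\<epsilon>) * real (card S) < real (card (nbrs E S w)))"
    using deletion_tolerance_bounds(2)[OF two_le_r] unfolding deletion_gain_def by auto
  moreover have "?\<theta> + (real j - 1) * ?\<eta> < spectral_density E S"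
    using defect deleted(4) by (simp add: left_diff_distrib)
  ultimately show ?thesis using that by blast
qed

lemma cliques_not_empty_after_deletion:
  assumes finite: "finite V" and two_le_r: "2 \<le> r"
    and radius: "largest_eigenvalue (with_proj (turan_graph r (card V))) < spectral_radius E V"
    and remaining: "S \<subseteq> V" "S \<noteq> {}" "card S = card V - j"
    and density: "1 - 1 / real r + (real j - 1) * deletion_gain r (card V) < spectral_density E S"
  shows "cliques E S (Suc r) \<noteq> {}"
proof (cases "j = 0")
  case True
  then have "S = V" using remaining card_subset_eq[OF finite] by simp
  then show ?thesis using spectral_turan[of V r] finite remaining(2) radius two_le_r by fastforce
next
  case False
  have "0 < card V" using remaining finite by (auto simp: card_gt_0_iff)
  then have "0 \<le> (real j - 1) * deletion_gain r (card V)"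
    using False deletion_gain_bounds(1)[OF two_le_r]
    by (intro mult_nonneg_nonneg) (auto intro: less_imp_le)
  then have "1 - 1 / real r < spectral_density E S" using density by linarith
  then show ?thesis
    by (rule cliques_not_empty_of_spectral_density[OF finite_subset[OF remaining(1) finite] two_le_r])
qed

lemma spectral_radius_gt_turan_cases:
  assumes finite: "finite V" and two_le_r: "2 \<le> r" and large: "1024 * real r ^ 5 \<le> real (card V)"
    and radius: "largest_eigenvalue (with_proj (turan_graph r (card V))) < spectral_radius E V"
  obtains (edge) u v where "u \<in> V" "v \<in> V" "E u v"
      "2 * r * card V ^ r \<le> blowup_base r * card (tail_joined_cliques E V r {u, v})"
    | (cliques) "2 * Suc r * card V ^ Suc r \<le> blowup_base r * card (cliques E V (Suc r))"
proof -
  let ?n = "card V"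
  have "V \<noteq> {}" using large two_le_r by auto
  then have order_pos: "0 < ?n" using finite by (simp add: card_gt_0_iff)
  obtain j S where few_deleted: "j \<le> deletion_limit r ?n" and remaining: "S \<subseteq> V" "card S = ?n - j"
    and density: "1 - 1 / real r + (real j - 1) * deletion_gain r ?n < spectral_density E S"
    and stop: "j = deletion_limit r ?n \<or>
      (\<forall>w\<in>S. (1 - 1 / real r - deletion_tolerance r) * real (card S) < real (card (nbrs E S w)))"
    using spectral_radius_gt_turan_deletion[OF finite two_le_r large radius] by metis
  have finite_S: "finite S" using remaining(1) finite by (rule finite_subset)
  have order: "(1 - 1 / (4 * real r)) * real ?n \<le> real (card S)"
    unfolding remaining(2) by (rule order_after_deletion_ge[OF few_deleted])
  from stop show thesis
  proof
    assume "j = deletion_limit r ?n"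
    then have "1 - 1 / real r + 1 / (128 * real r ^ 4) \<le> spectral_density E S"
      using density limit_mult_deletion_gain_ge[OF two_le_r order_pos]
        deletion_gain_le[OF two_le_r large]
      by (simp add: left_diff_distrib)
    from many_cliques_of_spectral_density[OF finite_S two_le_r order this]
    have "2 * Suc r * ?n ^ Suc r \<le> blowup_base r * card (cliques E S (Suc r))" .
    also have "\<dots> \<le> blowup_base r * card (cliques E V (Suc r))"
      by (intro mult_left_mono card_mono finite_cliques finite cliques_mono remaining(1)) simp
    finally show thesis by (rule cliques)
  next
    assume deg:
      "\<forall>w\<in>S. (1 - 1 / real r - deletion_tolerance r) * real (card S) < real (card (nbrs E S w))"
    have "0 < (1 - 1 / (4 * real r)) * real ?n" using two_le_r order_pos by (simp add: field_simps)
    then have "S \<noteq> {}" using order by auto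
    then have "cliques E S (Suc r) \<noteq> {}"
      using cliques_not_empty_after_deletion[OF finite two_le_r radius remaining(1) _ remaining(2) density] by blast
    with many_tail_joined_cliques[OF finite_S two_le_r order] deg
    obtain u v where ends: "u \<in> S" "v \<in> S" "E u v"
      and many: "2 * r * ?n ^ r \<le> blowup_base r * card (tail_joined_cliques E S r {u, v})"
      by (auto simp: deletion_tolerance_def)
    note many
    also have "\<dots> \<le> blowup_base r * card (tail_joined_cliques E V r {u, v})"
      by (intro mult_left_mono card_mono finite_tail_joined_cliques finite tail_joined_cliques_mono remaining(1)) simp
    finally show thesis using edge ends remaining(1) by blast
  qed
qed

end

lemma order_ge_of_le_ln:
  fixes c :: real
  assumes two_le_r: "2 \<le> r" and c_bounds: "0 < c" "c \<le> 1 / real r ^ ((2 * r + 9) * (r + 1))"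
    and order: "0 < n" "2 / c \<le> ln (real n)"
  shows "1024 * real r ^ 5 \<le> real n"
proof -
  have "2 ^ 10 \<le> real r ^ 10" using two_le_r by (intro power_mono) auto
  then have "1024 * real r ^ 5 \<le> real r ^ 10 * real r ^ 5" by (intro mult_right_mono) auto
  also have "\<dots> = real r ^ 15" by (simp add: power_add[symmetric])
  also have "\<dots> \<le> real r ^ ((2 * r + 9) * (r + 1))"
  proof (rule power_increasing)
    have "13 * 3 \<le> (2 * r + 9) * (r + 1)" using two_le_r by (intro mult_mono) auto
    then show "15 \<le> (2 * r + 9) * (r + 1)" by simp
  qed (use two_le_r in simp)
  also have "\<dots> \<le> 1 / c" using c_bounds two_le_r by (simp add: field_simps)
  also have "\<dots> \<le> 2 / c" using c_bounds by (simp add: divide_right_mono)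
  also have "\<dots> \<le> real n" using order ln_bound[of "real n"] by simp
  finally show ?thesis .
qed

theorem contains_copy_of_spectral_radius_gt_turan:
  fixes G :: "('a, 'b) pre_digraph" and c :: real
  assumes two_le_r: "2 \<le> r" and n_pos: "0 < n" and c_bounds: "0 < c" "2 / c \<le> ln (real n)"
    "c \<le> 1 / real r ^ ((2 * r + 9) * (r + 1))"
    and graph_G: "graph G" "card (verts G) = n"
    and radius:
      "largest_eigenvalue (with_proj (turan_graph r n)) < spectral_radius (dominates G) (verts G)"
  shows "contains_copy G (with_proj (complete_multipartite_plus
    (replicate (r - 1) (nat \<lfloor>c * ln (real n)\<rfloor>) @ [nat \<lceil>real n powr (1 - sqrt c)\<rceil>])))"
proof -
  interpret graph G by fact
  interpret adjacency "dominates G" by (rule adjacency_graph) fact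
  obtain k where r_Suc: "r = Suc k" "0 < k" using two_le_r by (cases r) auto
  define s where "s = nat \<lfloor>c * ln (real n)\<rfloor>"
  define t where "t = nat \<lceil>real n powr (1 - sqrt c)\<rceil>"
  define h where "h = blowup_base r"
  have "2 \<le> c * ln (real n)" using c_bounds(1,2) by (simp add: field_simps)
  then have s_bounds: "2 \<le> s" "real s \<le> c * ln (real n)" unfolding s_def by linarith+
  have h_bounds: "1 \<le> h" "4 * c * real h ^ r \<le> 1"
    using blowup_base_pos[OF two_le_r] blowup_base_le[OF two_le_r c_bounds(1,3)]
    by (simp_all add: h_def)
  have h_power: "4 * c * real h ^ e \<le> 1" if "e \<le> r" for e
  proof -
    have "4 * c * real h ^ e \<le> 4 * c * real h ^ r"
      using that c_bounds(1) h_bounds(1) by (intro mult_left_mono power_increasing) auto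
    then show ?thesis using h_bounds(2) by simp
  qed
  have large: "h * 2 ^ (h ^ e * s) * (h ^ e * s) \<le> n" if "1 \<le> e" "e \<le> r" for e
    using blowup_order_le[OF c_bounds(1,2) n_pos h_bounds(1) that(1) h_power[OF that(2)] s_bounds(2)] .
  have t_le: "t \<le> y" if "n \<le> y * (h * 2 ^ (h * s))" for y
    unfolding t_def
    using ceiling_powr_le_of_blowup[OF c_bounds(1,2) n_pos h_bounds(1)
        h_power[OF two_le_r] s_bounds(2) that] .
  have "1024 * real r ^ 5 \<le> real (card (verts G))"
    using order_ge_of_le_ln[OF two_le_r c_bounds(1,3) n_pos c_bounds(2)] graph_G(2) by simp
  then have "contains_copy G (with_proj (complete_multipartite_plus (replicate k s @ [t])))"
  proof (cases rule: spectral_radius_gt_turan_cases[OF finite_verts two_le_r _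
        radius[folded graph_G(2)], case_names large edge cliques])
    case (edge u v)
    show ?thesis
      by (rule contains_copy_from_tail_joined_cliques[OF graph_G(1) r_Suc(2) s_bounds(1), of h u v])
        (use edge h_bounds(1) r_Suc large[of k] t_le graph_G(2) in \<open>auto simp: h_def\<close>)
  next
    case cliques
    show ?thesis
      by (rule contains_copy_from_larger_cliques[OF graph_G(1) r_Suc(2) s_bounds(1), of h])
        (use cliques h_bounds(1) r_Suc large[of r] t_le graph_G(2) in \<open>auto simp: h_def\<close>)
  qed
  then show ?thesis by (simp add: r_Suc s_def t_def)
qed

theorem theorem2:
  fixes G :: "('a, 'b) pre_digraph" and r n :: nat and c :: real
  assumes "r \<ge> 2" and "n > 0"
    and "2 / ln (real n) \<le> c" and "c \<le> 1 / real r ^ ((2 * r + 9) * (r + 1))"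
    and "graph G" and "card (verts G) = n"
    and "largest_eigenvalue G > largest_eigenvalue (with_proj (turan_graph r n))"
  shows "\<exists>H. subgraph H G \<and>
    digraph_iso
      (with_proj (complete_multipartite_plus
        (replicate (r - 1) (nat \<lfloor>c * ln (real n)\<rfloor>) @ [nat \<lceil>real n powr (1 - sqrt c)\<rceil>]))) H"
proof -
  interpret graph G by fact
  interpret adjacency "dominates G" by (rule adjacency_graph) fact
  have not_empty: "verts G \<noteq> {}" using assms(2,6) by auto
  have radius:
    "largest_eigenvalue (with_proj (turan_graph r n)) < spectral_radius (dominates G) (verts G)"
    using assms(7) by (simp add: largest_eigenvalue_eq_spectral_radius[OF assms(5) not_empty])
  then have "1 < n"
    using card_gt_of_spectral_radius_gt_turan[OF finite_verts not_empty, of r] assms(1,6) by simp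
  then have ln_pos: "0 < ln (real n)" by simp
  then have "0 < 2 / ln (real n)" by simp
  then have c_pos: "0 < c" using assms(3) by (rule less_le_trans)
  then have "2 / c \<le> ln (real n)" using assms(3) ln_pos by (simp add: field_simps)
  from contains_copy_of_spectral_radius_gt_turan[OF assms(1,2) c_pos this assms(4-6) radius]
  show ?thesis unfolding contains_copy_def .
qed

end
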